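(* Let $G$ be a unimodular, locally compact group which has the Kunze--Stein property. Then $\mathrm{PF}_p(G)$ is directly finite for all $1<p<\infty$.
   Context: Algebras need not be commutative nor have an identity. For $a,b$ in an algebra (or ring) $R$ put $a\bullet b := a+b-ab$. $R$ is called directly finite if for all $a,b\in R$, $a\bullet b=0$ implies $b\bullet a=0$. Fix a left Haar measure on $G$. $C_c(G)$ is the space of continuous compactly supported functions $G\to\mathbb{C}$, an algebra under convolution. For $p\in(1,\infty)$, $\lambda_p: C_c(G)\to\mathcal{B}(L^p(G))$ is the homomorphism $\lambda_p(f)(h)=f*h$. The algebra of $p$-pseudofunctions $\mathrm{PF}_p(G)$ is the operator-norm closure of $\lambda_p(C_c(G))$ in $\mathcal{B}(L^p(G))$. A locally compact group $G$ has the Kunze--Stein property if for each $1\le p<2$ there exists a constant $C_p\ge 1$ such that $\|g*h\|_2\le C_p\|g\|_p\|h\|_2$ for all $g\in L^p(G)$ and all $h\in C_c(G)$. *)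

theory Defs
  imports "HOL-Analysis.Analysis" "HOL-Algebra.Ring"
begin

text \<open>
  A locally compact group is a type of class \<open>topological_group_add\<close> and \<open>t2_space\<close> whose
  topology is locally compact.  That class is written additively but is \<^emph>\<open>not\<close> commutative:
  \<open>x + y\<close>, \<open>0\<close> and \<open>- x + y\<close> stand for the product \<open>x y\<close>, the identity and \<open>x\<^sup>-\<^sup>1 y\<close>.
\<close>

text \<open>
  Rings need not have an identity: the record \<open>R\<close> carries a field \<open>one\<close>, but it is never used here
  and need not belong to \<open>carrier R\<close>.
\<close>

definition bullet :: "('a, 'm) ring_scheme \<Rightarrow> 'a \<Rightarrow> 'a \<Rightarrow> 'a" where
  "bullet R a b = (a \<oplus>\<^bsub>R\<^esub> b) \<ominus>\<^bsub>R\<^esub> (a \<otimes>\<^bsub>R\<^esub> b)"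

definition directly_finite :: "('a, 'm) ring_scheme \<Rightarrow> bool" where
  "directly_finite R \<longleftrightarrow>
     (\<forall>a\<in>carrier R. \<forall>b\<in>carrier R. bullet R a b = \<zero>\<^bsub>R\<^esub> \<longrightarrow> bullet R b a = \<zero>\<^bsub>R\<^esub>)"

text \<open>
  Left Haar measures are Radon measures in the usual sense: finite on compact sets, outer regular
  on Borel sets and inner regular on open sets.  No countability of the topology is assumed.
\<close>

definition left_haar_measure :: "'g::{topological_group_add, t2_space} measure \<Rightarrow> bool" where
  "left_haar_measure \<mu> \<longleftrightarrow>
     sets \<mu> = sets borel \<and>
     emeasure \<mu> UNIV \<noteq> 0 \<and>
     (\<forall>K. compact K \<longrightarrow> emeasure \<mu> K < \<infinity>) \<and>
     (\<forall>A\<in>sets borel. emeasure \<mu> A = (INF U\<in>{U. open U \<and> A \<subseteq> U}. emeasure \<mu> U)) \<and>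
     (\<forall>U. open U \<longrightarrow> emeasure \<mu> U = (SUP K\<in>{K. compact K \<and> K \<subseteq> U}. emeasure \<mu> K)) \<and>
     (\<forall>x. \<forall>A\<in>sets borel. emeasure \<mu> ((\<lambda>y. x + y) ` A) = emeasure \<mu> A)"

text \<open>Unimodularity of the group, expressed through its fixed left Haar measure.\<close>

definition unimodular :: "'g::{topological_group_add, t2_space} measure \<Rightarrow> bool" where
  "unimodular \<mu> \<longleftrightarrow> (\<forall>x. \<forall>A\<in>sets borel. emeasure \<mu> ((\<lambda>y. y + x) ` A) = emeasure \<mu> A)"

text \<open>
  \<open>lp_fun\<close> consists of functions, \<open>Lp\<close> of their classes modulo equality almost everywhere.  The
  operations on \<open>Lp\<close> are those on functions, lifted to classes in the style of \<open>Equiv_Relations\<close>.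
\<close>

definition lp_fun :: "'a measure \<Rightarrow> real \<Rightarrow> ('a \<Rightarrow> complex) set" where
  "lp_fun M p = {f \<in> borel_measurable M. integrable M (\<lambda>x. norm (f x) powr p)}"

definition lp_norm :: "'a measure \<Rightarrow> real \<Rightarrow> ('a \<Rightarrow> complex) \<Rightarrow> real" where
  "lp_norm M p f = (\<integral>x. norm (f x) powr p \<partial>M) powr (1 / p)"

definition ae_eq :: "'a measure \<Rightarrow> real \<Rightarrow> (('a \<Rightarrow> complex) \<times> ('a \<Rightarrow> complex)) set" where
  "ae_eq M p = {(f, g). f \<in> lp_fun M p \<and> g \<in> lp_fun M p \<and> (AE x in M. f x = g x)}"

definition Lp :: "'a measure \<Rightarrow> real \<Rightarrow> ('a \<Rightarrow> complex) set set" where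
  "Lp M p = lp_fun M p // ae_eq M p"

definition Lp_norm :: "'a measure \<Rightarrow> real \<Rightarrow> ('a \<Rightarrow> complex) set \<Rightarrow> real" where
  "Lp_norm M p X = the_elem (lp_norm M p ` X)"

definition Lp_zero :: "'a measure \<Rightarrow> real \<Rightarrow> ('a \<Rightarrow> complex) set" where
  "Lp_zero M p = ae_eq M p `` {\<lambda>x. 0}"

definition Lp_add ::
  "'a measure \<Rightarrow> real \<Rightarrow> ('a \<Rightarrow> complex) set \<Rightarrow> ('a \<Rightarrow> complex) set \<Rightarrow> ('a \<Rightarrow> complex) set" where
  "Lp_add M p X Y = (\<Union>f\<in>X. \<Union>g\<in>Y. ae_eq M p `` {\<lambda>x. f x + g x})"

definition Lp_scale ::
  "'a measure \<Rightarrow> real \<Rightarrow> complex \<Rightarrow> ('a \<Rightarrow> complex) set \<Rightarrow> ('a \<Rightarrow> complex) set" where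
  "Lp_scale M p c X = (\<Union>f\<in>X. ae_eq M p `` {\<lambda>x. c * f x})"

text \<open>
  The ring of bounded linear operators on \<open>Lp M p\<close>; operators are \<open>undefined\<close> outside \<open>Lp M p\<close>, so
  that equality of operators is equality of functions.
\<close>

definition bounded_ops ::
  "'a measure \<Rightarrow> real \<Rightarrow> (('a \<Rightarrow> complex) set \<Rightarrow> ('a \<Rightarrow> complex) set) ring" where
  "bounded_ops M p =
    \<lparr>carrier = {T \<in> Lp M p \<rightarrow>\<^sub>E Lp M p.
        (\<forall>X\<in>Lp M p. \<forall>Y\<in>Lp M p. T (Lp_add M p X Y) = Lp_add M p (T X) (T Y)) \<and>
        (\<forall>c. \<forall>X\<in>Lp M p. T (Lp_scale M p c X) = Lp_scale M p c (T X)) \<and>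
        (\<exists>C. \<forall>X\<in>Lp M p. Lp_norm M p (T X) \<le> C * Lp_norm M p X)},
     mult = (\<lambda>S T. compose (Lp M p) S T),
     one = (\<lambda>X\<in>Lp M p. X),
     zero = (\<lambda>X\<in>Lp M p. Lp_zero M p),
     add = (\<lambda>S T. \<lambda>X\<in>Lp M p. Lp_add M p (S X) (T X))\<rparr>"

definition op_norm ::
  "'a measure \<Rightarrow> real \<Rightarrow> (('a \<Rightarrow> complex) set \<Rightarrow> ('a \<Rightarrow> complex) set) \<Rightarrow> real" where
  "op_norm M p T = (SUP X\<in>{X \<in> Lp M p. Lp_norm M p X \<le> 1}. Lp_norm M p (T X))"

definition Cc :: "('g::topological_space \<Rightarrow> complex) set" where
  "Cc = {f. continuous_on UNIV f \<and> compact (closure {x. f x \<noteq> 0})}"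

definition convol ::
  "'g::group_add measure \<Rightarrow> ('g \<Rightarrow> complex) \<Rightarrow> ('g \<Rightarrow> complex) \<Rightarrow> 'g \<Rightarrow> complex" where
  "convol \<mu> f h s = (\<integral>t. f t * h (- t + s) \<partial>\<mu>)"

definition lambda_p ::
  "'g::group_add measure \<Rightarrow> real \<Rightarrow> ('g \<Rightarrow> complex) \<Rightarrow> ('g \<Rightarrow> complex) set \<Rightarrow> ('g \<Rightarrow> complex) set" where
  "lambda_p \<mu> p f = (\<lambda>X\<in>Lp \<mu> p. \<Union>h\<in>X. ae_eq \<mu> p `` {convol \<mu> f h})"

definition PF ::
  "'g::{topological_group_add, t2_space} measure \<Rightarrow> real \<Rightarrow>
     (('g \<Rightarrow> complex) set \<Rightarrow> ('g \<Rightarrow> complex) set) ring" where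
  "PF \<mu> p = (bounded_ops \<mu> p)\<lparr>carrier :=
     {T \<in> carrier (bounded_ops \<mu> p).
        \<forall>\<epsilon>>0. \<exists>f\<in>Cc. op_norm \<mu> p (T \<ominus>\<^bsub>bounded_ops \<mu> p\<^esub> lambda_p \<mu> p f) < \<epsilon>}\<rparr>"

text \<open>
  That \<open>g * h\<close> lies in \<open>L\<^sup>2\<close> is part of the inequality, because \<open>lp_norm\<close> is real-valued and says
  nothing about functions outside \<open>lp_fun\<close>.
\<close>

definition kunze_stein :: "'g::{topological_group_add, t2_space} measure \<Rightarrow> bool" where
  "kunze_stein \<mu> \<longleftrightarrow>
     (\<forall>p. 1 \<le> p \<and> p < 2 \<longrightarrow>
        (\<exists>C\<ge>1. \<forall>g\<in>lp_fun \<mu> p. \<forall>h\<in>Cc.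
           convol \<mu> g h \<in> lp_fun \<mu> 2 \<and>
           lp_norm \<mu> 2 (convol \<mu> g h) \<le> C * lp_norm \<mu> p g * lp_norm \<mu> 2 h))"

end

theory Submission
  imports Defs
begin

text \<open>
  Write \<open>\<alpha> = 1 - a\<close> and \<open>\<beta> = 1 - b\<close>.  Operators \<open>S\<close>, \<open>T\<close> in \<open>PF\<^sub>p\<close> with \<open>S \<bullet> T = 0\<close> are approximated
  by convolution with \<open>a, b \<in> C\<^sub>c\<close>, so that \<open>\<alpha> \<beta> = 1 - c\<close> with \<open>c\<close> small on \<open>L\<^sup>p\<close>.  By the
  Kunze--Stein inequality (after passing to adjoints if \<open>p > 2\<close>) the powers of \<open>c\<close> decay geometrically
  on \<open>L\<^sup>2\<close> as well.  Hence, on \<open>L\<^sup>2\<close>, the operators \<open>\<beta>\<^sub>n = \<beta> (1 + c + \<dots> + c\<^sup>n)\<close> are asymptotic right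
  inverses of \<open>\<alpha>\<close>, while on \<open>L\<^sup>p\<close> they stay uniformly close to \<open>1 - T\<close>.

  On \<open>L\<^sup>2\<close> the group trace forces \<open>\<beta>\<^sub>n \<alpha> \<rightarrow> 1\<close> weakly: \<open>\<alpha> \<alpha>\<^sup>*\<close> is bounded below, so for
  \<open>w\<^sub>n(t) = (1 - t) (1 - t / M)\<^sup>n\<close> the elements \<open>w\<^sub>n(\<alpha> \<alpha>\<^sup>*)\<close>, which lie in \<open>C\<^sub>c\<close>, tend to \<open>0\<close> in \<open>L\<^sup>2\<close>; by
  traciality \<open>w\<^sub>n(\<alpha>\<^sup>* \<alpha>)\<close> has the same \<open>L\<^sup>2\<close> norm, and it approximates the projection onto the kernel
  of \<open>\<alpha>\<close>.  Working with \<open>C\<^sub>c\<close> and these polynomials avoids completeness of \<open>L\<^sup>p\<close> and all operator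
  theory on Hilbert space.
\<close>

section \<open>Functions in \<open>L\<^sup>p\<close>\<close>

text \<open>\<open>S\<close> and \<open>T\<close> act on L^p only, and nothing extends them to L^2;
  the two spaces meet only in C_c. What Kunze--Stein transfers is the rate at which the powers of
  \<open>c\<close> decay, not the norm of \<open>c\<close>: the constant in front of r^n depends on
  \<open>c\<close>, hence on the approximants, and nothing keeps it bounded as they improve. No L^2
  constant may therefore survive into the final estimate.

  This dictates the order of limits. Paired with a fixed \<open>k\<close> in C_c, the vector v_n = h
  - \<open>\<beta>\<^sub>n\<close> \<alpha> h is compared twice: in L^p it lies within O(e) of (T
  bullet S) h, uniformly in n, and in L^2 it tends weakly to 0. Letting n tend to infinity for fixed
  approximants removes every L^2 constant; only then does the quality e of the approximation tend to
  0.

  Weak convergence is what can be had, because the element E near the kernel projection is small as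
  a vector of L^2 but not as a convolution operator. In the pairing of E v with k, traciality moves
  v across, leaving E paired with k (adj v), where convolution by k is bounded.\<close>

lemma lp_funI:
  assumes "f \<in> borel_measurable M" "integrable M (\<lambda>x. norm (f x) powr p)"
  shows "f \<in> lp_fun M p"
  using assms by (simp add: lp_fun_def)

lemma lp_fun_measurable [measurable_dest]: "f \<in> lp_fun M p \<Longrightarrow> f \<in> borel_measurable M"
  by (simp add: lp_fun_def)

lemma lp_fun_integrable: "f \<in> lp_fun M p \<Longrightarrow> integrable M (\<lambda>x. norm (f x) powr p)"
  by (simp add: lp_fun_def)

lemma lp_norm_nonneg [simp]: "0 \<le> lp_norm M p f"
  by (simp add: lp_norm_def)

lemma lp_norm_powr:
  assumes "1 \<le> p"
  shows "lp_norm M p f powr p = (\<integral>x. norm (f x) powr p \<partial>M)"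
  using assms by (simp add: lp_norm_def powr_powr)

lemma lp_norm_le:
  assumes "1 \<le> p" "0 \<le> c" "(\<integral>x. norm (f x) powr p \<partial>M) \<le> c powr p"
  shows "lp_norm M p f \<le> c"
proof -
  have "lp_norm M p f \<le> (c powr p) powr (1 / p)"
    unfolding lp_norm_def using assms by (intro powr_mono2) auto
  then show ?thesis using assms by (simp add: powr_powr)
qed

lemma lp_norm_cong_AE:
  assumes "f \<in> borel_measurable M" "g \<in> borel_measurable M" "AE x in M. f x = g x"
  shows "lp_norm M p f = lp_norm M p g"
proof -
  have "(\<integral>x. norm (f x) powr p \<partial>M) = (\<integral>x. norm (g x) powr p \<partial>M)"
    using assms by (intro integral_cong_AE) auto
  then show ?thesis by (simp add: lp_norm_def)
qed

lemma lp_fun_bound: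
  assumes "f \<in> lp_fun M p" "0 \<le> p" "g \<in> borel_measurable M"
    "\<And>x. norm (g x) \<le> norm (f x)"
  shows "g \<in> lp_fun M p"
proof (rule lp_funI)
  show "integrable M (\<lambda>x. norm (g x) powr p)"
    by (rule Bochner_Integration.integrable_bound[OF lp_fun_integrable[OF assms(1)]])
      (use assms in \<open>auto intro!: powr_mono2\<close>)
qed (use assms in auto)

lemma lp_fun_zero [simp]: "(\<lambda>x. 0) \<in> lp_fun M p"
  by (simp add: lp_fun_def)

lemma lp_norm_zero [simp]: "lp_norm M p (\<lambda>x. 0) = 0"
  by (simp add: lp_norm_def)

lemma lp_fun_scale:
  assumes "f \<in> lp_fun M p"
  shows "(\<lambda>x. c * f x) \<in> lp_fun M p"
  using assms by (auto simp: lp_fun_def norm_mult powr_mult)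

lemma lp_norm_scale:
  assumes "1 \<le> p"
  shows "lp_norm M p (\<lambda>x. c * f x) = norm c * lp_norm M p f"
  using assms by (simp add: lp_norm_def norm_mult powr_mult powr_powr)

lemma lp_fun_add:
  assumes f: "f \<in> lp_fun M p" and g: "g \<in> lp_fun M p" and p: "0 \<le> p"
  shows "(\<lambda>x. f x + g x) \<in> lp_fun M p"
proof (rule lp_funI)
  have [measurable]: "f \<in> borel_measurable M" "g \<in> borel_measurable M"
    using f g by (auto dest: lp_fun_measurable)
  show "(\<lambda>x. f x + g x) \<in> borel_measurable M" by simp
  have *: "norm (f x + g x) powr p \<le> 2 powr p * (norm (f x) powr p + norm (g x) powr p)" for x
  proof -
    have "norm (f x + g x) powr p \<le> (2 * max (norm (f x)) (norm (g x))) powr p"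
      using p by (intro powr_mono2 order_trans[OF norm_triangle_ineq]) auto
    also have "\<dots> = 2 powr p * max (norm (f x)) (norm (g x)) powr p"
      by (simp add: powr_mult)
    also have "\<dots> \<le> 2 powr p * (norm (f x) powr p + norm (g x) powr p)"
      by (intro mult_left_mono) (auto simp: max_def)
    finally show ?thesis .
  qed
  show "integrable M (\<lambda>x. norm (f x + g x) powr p)"
    by (rule Bochner_Integration.integrable_bound[where
          f="\<lambda>x. 2 powr p * (norm (f x) powr p + norm (g x) powr p)"])
      (use f g * in \<open>auto dest: lp_fun_integrable\<close>)
qed

lemma lp_fun_diff:
  assumes "f \<in> lp_fun M p" "g \<in> lp_fun M p" "0 \<le> p"
  shows "(\<lambda>x. f x - g x) \<in> lp_fun M p"
  using lp_fun_add[OF assms(1) lp_fun_scale[OF assms(2), of "-1"]] assms(3) by simp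

lemma lp_norm_minus_commute: "lp_norm M p (\<lambda>x. f x - g x) = lp_norm M p (\<lambda>x. g x - f x)"
  by (simp add: lp_norm_def norm_minus_commute)

lemma lp_norm_eq_0D:
  assumes f: "f \<in> lp_fun M p" and "1 \<le> p" and "lp_norm M p f = 0"
  shows "AE x in M. f x = 0"
proof -
  have "(\<integral>x. norm (f x) powr p \<partial>M) = 0"
    using lp_norm_powr[of p M f] assms by simp
  then have "AE x in M. norm (f x) powr p = 0"
    using integral_nonneg_eq_0_iff_AE[OF lp_fun_integrable[OF f]] by simp
  then show ?thesis by auto
qed

section \<open>Minkowski and Hoelder inequalities\<close>

lemma powr_convex_combination:
  fixes t :: real
  assumes p: "1 \<le> p" and "0 \<le> x" "0 \<le> y" "0 \<le> t" "t \<le> 1"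
  shows "(t * x + (1 - t) * y) powr p \<le> t * x powr p + (1 - t) * y powr p"
proof (cases "x = 0 \<or> y = 0")
  case True
  \<comment> \<open>At the boundary, convexity comes down to s^p lying below s on the unit
    interval.\<close>
  have *: "s powr p \<le> s" if "0 \<le> s" "s \<le> 1" for s :: real
    using powr_mono'[of 1 p s] p that by simp
  from True show ?thesis
  proof
    assume "x = 0"
    have "(1 - t) powr p * y powr p \<le> (1 - t) * y powr p"
      by (intro mult_right_mono *) (use assms in auto)
    then show ?thesis using \<open>x = 0\<close> assms by (simp add: powr_mult)
  next
    assume "y = 0"
    have "t powr p * x powr p \<le> t * x powr p"
      by (intro mult_right_mono *) (use assms in auto)
    then show ?thesis using \<open>y = 0\<close> assms by (simp add: powr_mult)
  qed
next
  case False
  then show ?thesis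
    using convex_onD[OF powr_convex[OF p], of "1 - t" x y] assms by simp
qed

text \<open>With a and b the two norms, (f + g) / (a + b) is a convex combination of the normalized
  functions f / a and g / b with weights a / (a + b) and b / (a + b); convexity of x^p is
  integrated. The normalization is why vanishing norms are split off.\<close>

theorem Minkowski_lp_norm:
  assumes f: "f \<in> lp_fun M p" and g: "g \<in> lp_fun M p" and p: "1 \<le> p"
  shows "lp_norm M p (\<lambda>x. f x + g x) \<le> lp_norm M p f + lp_norm M p g"
proof -
  have [measurable]: "f \<in> borel_measurable M" "g \<in> borel_measurable M"
    using f g by (auto dest: lp_fun_measurable)
  define a where "a = lp_norm M p f"
  define b where "b = lp_norm M p g"
  have ab: "a \<ge> 0" "b \<ge> 0" by (auto simp: a_def b_def)
  consider "a = 0" | "b = 0" | "a > 0" "b > 0" using ab by fastforce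
  then show ?thesis
  proof cases
    case 1
    then have "AE x in M. f x = 0" using lp_norm_eq_0D[OF f p] by (simp add: a_def)
    then have "lp_norm M p (\<lambda>x. f x + g x) = b"
      unfolding b_def by (intro lp_norm_cong_AE) auto
    then show ?thesis using ab by (simp add: a_def b_def)
  next
    case 2
    then have "AE x in M. g x = 0" using lp_norm_eq_0D[OF g p] by (simp add: b_def)
    then have "lp_norm M p (\<lambda>x. f x + g x) = a"
      unfolding a_def by (intro lp_norm_cong_AE) auto
    then show ?thesis using ab by (simp add: a_def b_def)
  next
    case 3
    define t where "t = a / (a + b)"
    have t: "0 \<le> t" "t \<le> 1" "t * (1 / a) = 1 / (a + b)" "(1 - t) * (1 / b) = 1 / (a + b)"
      using 3 by (auto simp: t_def field_simps)
    have pw: "norm (f x + g x) powr p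
        \<le> (a + b) powr p * (t * (norm (f x) powr p / a powr p) + (1 - t) * (norm (g x) powr p / b powr p))" for x
    proof -
      have eq: "(norm (f x) + norm (g x)) = (a + b) * (t * (norm (f x) / a) + (1 - t) * (norm (g x) / b))"
      proof -
        have e: "t * (norm (f x) / a) = norm (f x) * (t * (1 / a))"
          "(1 - t) * (norm (g x) / b) = norm (g x) * ((1 - t) * (1 / b))" by simp_all
        then have "(a + b) * (t * (norm (f x) / a) + (1 - t) * (norm (g x) / b))
          = (a + b) * (norm (f x) * (1 / (a + b)) + norm (g x) * (1 / (a + b)))"
          by (simp only: e t(3,4))
        then show ?thesis using 3 by (simp flip: add_divide_distrib)
      qed
      have "norm (f x + g x) powr p \<le> (norm (f x) + norm (g x)) powr p"
        using p by (intro powr_mono2 norm_triangle_ineq) auto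
      also have "\<dots> = (a + b) powr p * (t * (norm (f x) / a) + (1 - t) * (norm (g x) / b)) powr p"
        by (subst eq, subst powr_mult) (use 3 t in \<open>auto simp: powr_mult\<close>)
      also have "\<dots> \<le> (a + b) powr p * (t * (norm (f x) / a) powr p + (1 - t) * (norm (g x) / b) powr p)"
        by (intro mult_left_mono powr_convex_combination) (use 3 t p in auto)
      finally show ?thesis using 3 by (simp add: powr_divide)
    qed
    have "(\<integral>x. norm (f x + g x) powr p \<partial>M)
      \<le> (\<integral>x. (a + b) powr p * (t * (norm (f x) powr p / a powr p) + (1 - t) * (norm (g x) powr p / b powr p)) \<partial>M)"
      by (intro integral_mono pw lp_fun_integrable[OF lp_fun_add[OF f g]])
        (use p f g in \<open>auto dest!: lp_fun_integrable\<close>)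
    also have "\<dots> = (a + b) powr p * (t * (a powr p / a powr p) + (1 - t) * (b powr p / b powr p))"
      using f g p by (simp add: lp_fun_integrable lp_norm_powr a_def b_def)
    also have "\<dots> = (a + b) powr p" using 3 by simp
    finally show ?thesis
      using lp_norm_le[of p "a + b" M "\<lambda>x. f x + g x"] p ab by (simp add: a_def b_def)
  qed
qed

lemma lp_norm_triangle_diff:
  assumes "f \<in> lp_fun M p" "g \<in> lp_fun M p" "1 \<le> p"
  shows "lp_norm M p (\<lambda>x. f x - g x) \<le> lp_norm M p f + lp_norm M p g"
  using Minkowski_lp_norm[OF assms(1) lp_fun_scale[OF assms(2), of "-1"] assms(3)]
    lp_norm_scale[OF assms(3), of M "-1" g] by simp

lemma lp_norm_dist_triangle:
  assumes "f \<in> lp_fun M p" "g \<in> lp_fun M p" "h \<in> lp_fun M p" "1 \<le> p"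
  shows "lp_norm M p (\<lambda>x. f x - h x)
    \<le> lp_norm M p (\<lambda>x. f x - g x) + lp_norm M p (\<lambda>x. g x - h x)"
  using Minkowski_lp_norm[OF lp_fun_diff[OF assms(1,2)] lp_fun_diff[OF assms(2,3)] assms(4)] assms(4)
  by simp

text \<open>Young's inequality for f and g gives integrability; applied to f and g divided by their
  norms and then integrated, it gives the sharp bound.\<close>

theorem Hoelder_lp_norm:
  assumes f: "f \<in> lp_fun M p" and g: "g \<in> lp_fun M q"
    and pq: "1 < p" "1 < q" "1 / p + 1 / q = 1"
  shows "integrable M (\<lambda>x. norm (f x) * norm (g x))"
    and "(\<integral>x. norm (f x) * norm (g x) \<partial>M) \<le> lp_norm M p f * lp_norm M q g"
proof -
  have [measurable]: "f \<in> borel_measurable M" "g \<in> borel_measurable M"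
    using f g by (auto dest: lp_fun_measurable)
  note fi = lp_fun_integrable[OF f] and gi = lp_fun_integrable[OF g]
  have young: "norm (f x) * norm (g x) \<le> norm (f x) powr p / p + norm (g x) powr q / q" for x
    by (rule Youngs_inequality) (use pq in auto)
  show int: "integrable M (\<lambda>x. norm (f x) * norm (g x))"
    by (rule Bochner_Integration.integrable_bound[where f="\<lambda>x. norm (f x) powr p / p + norm (g x) powr q / q"])
      (use fi gi order_trans[OF young abs_ge_self] in auto)
  define a where "a = lp_norm M p f"
  define b where "b = lp_norm M q g"
  have ab: "a \<ge> 0" "b \<ge> 0" by (auto simp: a_def b_def)
  show "(\<integral>x. norm (f x) * norm (g x) \<partial>M) \<le> lp_norm M p f * lp_norm M q g"
  proof (cases "a = 0 \<or> b = 0")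
    case True
    have "AE x in M. norm (f x) * norm (g x) = 0"
    proof (cases "a = 0")
      case True
      then have "AE x in M. f x = 0" using lp_norm_eq_0D[OF f] pq by (simp add: a_def)
      then show ?thesis by auto
    next
      case False
      then have "AE x in M. g x = 0" using lp_norm_eq_0D[OF g] pq True by (simp add: b_def)
      then show ?thesis by auto
    qed
    then have "(\<integral>x. norm (f x) * norm (g x) \<partial>M) = 0"
      by (intro integral_eq_zero_AE) auto
    then show ?thesis by simp
  next
    case False
    then have ab: "a > 0" "b > 0" using ab by auto
    have pw: "norm (f x) * norm (g x)
      \<le> a * b * (norm (f x) powr p / a powr p / p + norm (g x) powr q / b powr q / q)" for x
    proof -
      have "(norm (f x) / a) * (norm (g x) / b) \<le> (norm (f x) / a) powr p / p + (norm (g x) / b) powr q / q"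
        by (rule Youngs_inequality) (use pq ab in auto)
      then have "a * b * ((norm (f x) / a) * (norm (g x) / b))
         \<le> a * b * ((norm (f x) / a) powr p / p + (norm (g x) / b) powr q / q)"
        using ab by (intro mult_left_mono) auto
      then show ?thesis using ab by (simp add: powr_divide)
    qed
    have "(\<integral>x. norm (f x) * norm (g x) \<partial>M)
      \<le> (\<integral>x. a * b * (norm (f x) powr p / a powr p / p + norm (g x) powr q / b powr q / q) \<partial>M)"
      by (intro integral_mono pw int) (use fi gi in auto)
    also have "\<dots> = a * b * (a powr p / a powr p / p + b powr q / b powr q / q)"
      using fi gi pq by (simp add: lp_norm_powr a_def b_def)
    also have "\<dots> = a * b" using pq ab by simp
    finally show ?thesis by (simp add: a_def b_def)
  qed
qed

section \<open>Bounded operators on \<open>L\<^sup>p\<close>\<close>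

definition lp_class :: "'a measure \<Rightarrow> real \<Rightarrow> ('a \<Rightarrow> complex) \<Rightarrow> ('a \<Rightarrow> complex) set" where
  "lp_class M p f = ae_eq M p `` {f}"

lemma mem_lp_class:
  "g \<in> lp_class M p f \<longleftrightarrow> f \<in> lp_fun M p \<and> g \<in> lp_fun M p \<and> (AE x in M. f x = g x)"
  by (simp add: lp_class_def ae_eq_def)

lemma equiv_ae_eq: "equiv (lp_fun M p) (ae_eq M p)"
proof (rule equivI)
  show "ae_eq M p \<subseteq> lp_fun M p \<times> lp_fun M p" by (auto simp: ae_eq_def)
  show "refl_on (lp_fun M p) (ae_eq M p)" by (auto simp: refl_on_def ae_eq_def)
  show "sym (ae_eq M p)" by (auto simp: sym_def ae_eq_def)
  show "trans (ae_eq M p)" by (auto simp: trans_def ae_eq_def)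
qed

lemma Lp_eq: "Lp M p = lp_class M p ` lp_fun M p"
  by (auto simp: Lp_def quotient_def lp_class_def)

lemma lp_class_in_Lp [simp]: "f \<in> lp_fun M p \<Longrightarrow> lp_class M p f \<in> Lp M p"
  by (simp add: Lp_eq)

lemma LpE:
  assumes "X \<in> Lp M p"
  obtains f where "f \<in> lp_fun M p" "X = lp_class M p f"
  using assms by (auto simp: Lp_eq)

lemma lp_class_eq_iff:
  assumes "f \<in> lp_fun M p" "g \<in> lp_fun M p"
  shows "lp_class M p f = lp_class M p g \<longleftrightarrow> (AE x in M. f x = g x)"
  using eq_equiv_class_iff[OF equiv_ae_eq assms] assms
  by (simp add: lp_class_def ae_eq_def)

text \<open>Operations on \<open>Lp\<close> are unions over representatives. Once F respects
  equality almost everywhere, all members of the union coincide, so the operation can be computed on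
  one representative.\<close>

lemma lp_class_UN:
  assumes f: "f \<in> lp_fun M p"
    and F: "\<And>g. g \<in> lp_fun M p \<Longrightarrow> F g \<in> lp_fun M p"
    and cong: "\<And>g. g \<in> lp_fun M p \<Longrightarrow> AE x in M. f x = g x \<Longrightarrow> AE x in M. F f x = F g x"
  shows "(\<Union>g\<in>lp_class M p f. ae_eq M p `` {F g}) = lp_class M p (F f)"
proof -
  have "ae_eq M p `` {F g} = lp_class M p (F f)" if "g \<in> lp_class M p f" for g
  proof -
    from that have g: "g \<in> lp_fun M p" "AE x in M. f x = g x" by (auto simp: mem_lp_class)
    have "lp_class M p (F f) = lp_class M p (F g)"
      by (subst lp_class_eq_iff) (use F f g cong in auto)
    then show ?thesis by (simp add: lp_class_def)
  qed
  moreover have "f \<in> lp_class M p f" using f by (simp add: mem_lp_class)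
  ultimately show ?thesis by blast
qed

lemma Lp_scale_class:
  assumes "f \<in> lp_fun M p"
  shows "Lp_scale M p c (lp_class M p f) = lp_class M p (\<lambda>x. c * f x)"
  unfolding Lp_scale_def by (rule lp_class_UN) (use assms lp_fun_scale in auto)

lemma Lp_add_class:
  assumes f: "f \<in> lp_fun M p" and g: "g \<in> lp_fun M p" and p: "0 \<le> p"
  shows "Lp_add M p (lp_class M p f) (lp_class M p g) = lp_class M p (\<lambda>x. f x + g x)"
proof -
  have "(\<Union>g'\<in>lp_class M p g. ae_eq M p `` {\<lambda>x. f' x + g' x}) = lp_class M p (\<lambda>x. f' x + g x)"
    if "f' \<in> lp_class M p f" for f'
    by (rule lp_class_UN[where F="\<lambda>g' x. f' x + g' x"])
      (use that g p in \<open>auto simp: mem_lp_class intro!: lp_fun_add\<close>)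
  then have "Lp_add M p (lp_class M p f) (lp_class M p g)
      = (\<Union>f'\<in>lp_class M p f. ae_eq M p `` {\<lambda>x. f' x + g x})"
    by (simp add: Lp_add_def lp_class_def)
  also have "\<dots> = lp_class M p (\<lambda>x. f x + g x)"
    by (rule lp_class_UN[where F="\<lambda>f' x. f' x + g x"]) (use f g p in \<open>auto intro!: lp_fun_add\<close>)
  finally show ?thesis .
qed

text \<open>\<open>lp_norm\<close> is constant on a class, so its image is a singleton and
  \<open>the_elem\<close> has a value.\<close>

lemma Lp_norm_class:
  assumes f: "f \<in> lp_fun M p"
  shows "Lp_norm M p (lp_class M p f) = lp_norm M p f"
proof -
  have *: "lp_norm M p g = lp_norm M p f" if "g \<in> lp_class M p f" for g
    by (rule lp_norm_cong_AE) (use that in \<open>auto simp: mem_lp_class dest: lp_fun_measurable\<close>)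
  have "f \<in> lp_class M p f" using f by (simp add: mem_lp_class)
  then have "lp_norm M p ` lp_class M p f = (\<lambda>_. lp_norm M p f) ` lp_class M p f"
    "lp_class M p f \<noteq> {}"
    by (auto intro!: image_cong *)
  then show ?thesis by (simp add: Lp_norm_def image_constant_conv)
qed

lemma Lp_zero_class: "Lp_zero M p = lp_class M p (\<lambda>x. 0)"
  by (simp add: Lp_zero_def lp_class_def)

lemma Lp_zero_in_Lp [simp]: "Lp_zero M p \<in> Lp M p"
  by (simp add: Lp_zero_class)

lemma Lp_norm_nonneg: "X \<in> Lp M p \<Longrightarrow> 0 \<le> Lp_norm M p X"
  by (erule LpE) (simp add: Lp_norm_class)

lemma Lp_norm_zero [simp]: "Lp_norm M p (Lp_zero M p) = 0"
  by (simp add: Lp_zero_class Lp_norm_class)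

lemma Lp_scale_in_Lp [simp]: "X \<in> Lp M p \<Longrightarrow> Lp_scale M p c X \<in> Lp M p"
  by (erule LpE) (simp add: Lp_scale_class lp_fun_scale)

lemma Lp_add_in_Lp [simp]:
  "0 \<le> p \<Longrightarrow> X \<in> Lp M p \<Longrightarrow> Y \<in> Lp M p \<Longrightarrow> Lp_add M p X Y \<in> Lp M p"
  by (erule LpE, erule LpE) (simp add: Lp_add_class lp_fun_add)

lemma Lp_add_assoc:
  assumes "0 \<le> p" "X \<in> Lp M p" "Y \<in> Lp M p" "Z \<in> Lp M p"
  shows "Lp_add M p (Lp_add M p X Y) Z = Lp_add M p X (Lp_add M p Y Z)"
  using assms(2-4) by (elim LpE) (simp add: Lp_add_class lp_fun_add assms(1) add.assoc)

lemma Lp_add_commute: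
  assumes "0 \<le> p" "X \<in> Lp M p" "Y \<in> Lp M p"
  shows "Lp_add M p X Y = Lp_add M p Y X"
  using assms(2-3) by (elim LpE) (simp add: Lp_add_class assms(1) add.commute)

lemma Lp_zero_add [simp]: "0 \<le> p \<Longrightarrow> X \<in> Lp M p \<Longrightarrow> Lp_add M p (Lp_zero M p) X = X"
  by (elim LpE) (simp add: Lp_add_class Lp_zero_class)

lemma Lp_neg_add:
  "0 \<le> p \<Longrightarrow> X \<in> Lp M p \<Longrightarrow> Lp_add M p (Lp_scale M p (-1) X) X = Lp_zero M p"
  by (elim LpE)
    (use lp_fun_scale[of _ M p "-1"] in \<open>simp add: Lp_add_class Lp_scale_class Lp_zero_class\<close>)

lemma Lp_scale_add:
  assumes "0 \<le> p" "X \<in> Lp M p" "Y \<in> Lp M p"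
  shows "Lp_scale M p c (Lp_add M p X Y) = Lp_add M p (Lp_scale M p c X) (Lp_scale M p c Y)"
  using assms(2-3)
  by (elim LpE) (simp add: Lp_add_class Lp_scale_class lp_fun_scale lp_fun_add assms(1) distrib_left)

lemma Lp_scale_scale:
  assumes "X \<in> Lp M p"
  shows "Lp_scale M p c (Lp_scale M p d X) = Lp_scale M p d (Lp_scale M p c X)"
  using assms by (elim LpE) (simp add: Lp_scale_class lp_fun_scale mult.left_commute)

lemma Lp_norm_add_le:
  assumes "1 \<le> p" "X \<in> Lp M p" "Y \<in> Lp M p"
  shows "Lp_norm M p (Lp_add M p X Y) \<le> Lp_norm M p X + Lp_norm M p Y"
  using assms(2-3) assms(1)
  by (elim LpE) (simp add: Lp_add_class Lp_norm_class lp_fun_add Minkowski_lp_norm)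

lemma Lp_norm_scale:
  assumes "1 \<le> p" "X \<in> Lp M p"
  shows "Lp_norm M p (Lp_scale M p c X) = norm c * Lp_norm M p X"
  using assms by (elim LpE) (simp add: Lp_scale_class Lp_norm_class lp_fun_scale lp_norm_scale)

section \<open>The ring of bounded operators and the operator norm\<close>

lemma bounded_opsI:
  assumes "\<And>X. X \<in> Lp M p \<Longrightarrow> T X \<in> Lp M p"
    and "\<And>X. X \<notin> Lp M p \<Longrightarrow> T X = undefined"
    and "\<And>X Y. X \<in> Lp M p \<Longrightarrow> Y \<in> Lp M p \<Longrightarrow> T (Lp_add M p X Y) = Lp_add M p (T X) (T Y)"
    and "\<And>c X. X \<in> Lp M p \<Longrightarrow> T (Lp_scale M p c X) = Lp_scale M p c (T X)"
    and "\<And>X. X \<in> Lp M p \<Longrightarrow> Lp_norm M p (T X) \<le> C * Lp_norm M p X"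
  shows "T \<in> carrier (bounded_ops M p)"
  using assms by (auto simp: bounded_ops_def PiE_def extensional_def intro!: exI[of _ C])

lemma bounded_opsD:
  assumes "T \<in> carrier (bounded_ops M p)"
  shows "X \<in> Lp M p \<Longrightarrow> T X \<in> Lp M p"
    and "X \<notin> Lp M p \<Longrightarrow> T X = undefined"
    and "X \<in> Lp M p \<Longrightarrow> Y \<in> Lp M p \<Longrightarrow> T (Lp_add M p X Y) = Lp_add M p (T X) (T Y)"
    and "X \<in> Lp M p \<Longrightarrow> T (Lp_scale M p c X) = Lp_scale M p c (T X)"
  using assms by (auto simp: bounded_ops_def PiE_def extensional_def)

lemma bounded_ops_bound:
  assumes "T \<in> carrier (bounded_ops M p)"
  obtains C where "0 \<le> C" "\<And>X. X \<in> Lp M p \<Longrightarrow> Lp_norm M p (T X) \<le> C * Lp_norm M p X"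
proof -
  from assms have "\<exists>C. \<forall>X\<in>Lp M p. Lp_norm M p (T X) \<le> C * Lp_norm M p X"
    by (simp add: bounded_ops_def)
  then obtain C where C: "\<And>X. X \<in> Lp M p \<Longrightarrow> Lp_norm M p (T X) \<le> C * Lp_norm M p X"
    by blast
  show ?thesis
  proof (rule that[of "max C 0"])
    fix X assume X: "X \<in> Lp M p"
    show "Lp_norm M p (T X) \<le> max C 0 * Lp_norm M p X"
      by (rule order_trans[OF C[OF X]]) (intro mult_right_mono Lp_norm_nonneg X, simp)
  qed simp
qed

lemma bounded_ops_eqI:
  assumes "S \<in> carrier (bounded_ops M p)" "T \<in> carrier (bounded_ops M p)"
    and "\<And>X. X \<in> Lp M p \<Longrightarrow> S X = T X"
  shows "S = T"
proof
  fix X show "S X = T X"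
    using assms(3) bounded_opsD(2)[OF assms(1)] bounded_opsD(2)[OF assms(2)] by metis
qed

lemma bounded_ops_add_apply:
  "X \<in> Lp M p \<Longrightarrow> (S \<oplus>\<^bsub>bounded_ops M p\<^esub> T) X = Lp_add M p (S X) (T X)"
  by (simp add: bounded_ops_def)

lemma bounded_ops_mult_apply:
  "X \<in> Lp M p \<Longrightarrow> (S \<otimes>\<^bsub>bounded_ops M p\<^esub> T) X = S (T X)"
  by (simp add: bounded_ops_def compose_def)

lemma bounded_ops_zero_apply:
  "X \<in> Lp M p \<Longrightarrow> \<zero>\<^bsub>bounded_ops M p\<^esub> X = Lp_zero M p"
  by (simp add: bounded_ops_def)

lemma bounded_ops_add_closed:
  assumes p: "1 \<le> p" and S: "S \<in> carrier (bounded_ops M p)" and T: "T \<in> carrier (bounded_ops M p)"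
  shows "S \<oplus>\<^bsub>bounded_ops M p\<^esub> T \<in> carrier (bounded_ops M p)"
proof -
  obtain C where C: "\<And>X. X \<in> Lp M p \<Longrightarrow> Lp_norm M p (S X) \<le> C * Lp_norm M p X"
    using bounded_ops_bound[OF S] by metis
  obtain D where D: "\<And>X. X \<in> Lp M p \<Longrightarrow> Lp_norm M p (T X) \<le> D * Lp_norm M p X"
    using bounded_ops_bound[OF T] by metis
  note [simp] = bounded_ops_add_apply bounded_opsD[OF S] bounded_opsD[OF T]
  show ?thesis
  proof (rule bounded_opsI)
    fix X assume "X \<notin> Lp M p" then show "(S \<oplus>\<^bsub>bounded_ops M p\<^esub> T) X = undefined"
      by (simp add: bounded_ops_def)
  next
    fix X Y assume [simp]: "X \<in> Lp M p" "Y \<in> Lp M p"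
    show "(S \<oplus>\<^bsub>bounded_ops M p\<^esub> T) (Lp_add M p X Y)
      = Lp_add M p ((S \<oplus>\<^bsub>bounded_ops M p\<^esub> T) X) ((S \<oplus>\<^bsub>bounded_ops M p\<^esub> T) Y)"
      using p Lp_add_assoc[of p "S X" M "S Y" "Lp_add M p (T X) (T Y)"]
         Lp_add_assoc[of p "S X" M "T X" "Lp_add M p (S Y) (T Y)"]
         Lp_add_assoc[of p "S Y" M "T X" "T Y"] Lp_add_assoc[of p "T X" M "S Y" "T Y"]
         Lp_add_commute[of p "T X" M "S Y"] by simp
  next
    fix X assume [simp]: "X \<in> Lp M p"
    show "Lp_norm M p ((S \<oplus>\<^bsub>bounded_ops M p\<^esub> T) X) \<le> (C + D) * Lp_norm M p X"
      using Lp_norm_add_le[OF p, of "S X" M "T X"] C[of X] D[of X] by (simp add: distrib_right)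
  qed (use p in \<open>auto simp: Lp_scale_add\<close>)
qed

lemma bounded_ops_mult_closed:
  assumes p: "1 \<le> p" and S: "S \<in> carrier (bounded_ops M p)" and T: "T \<in> carrier (bounded_ops M p)"
  shows "S \<otimes>\<^bsub>bounded_ops M p\<^esub> T \<in> carrier (bounded_ops M p)"
proof -
  obtain C where C: "0 \<le> C" "\<And>X. X \<in> Lp M p \<Longrightarrow> Lp_norm M p (S X) \<le> C * Lp_norm M p X"
    using bounded_ops_bound[OF S] by metis
  obtain D where D: "\<And>X. X \<in> Lp M p \<Longrightarrow> Lp_norm M p (T X) \<le> D * Lp_norm M p X"
    using bounded_ops_bound[OF T] by metis
  note [simp] = bounded_ops_mult_apply bounded_opsD[OF S] bounded_opsD[OF T]
  show ?thesis
  proof (rule bounded_opsI)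
    fix X assume "X \<notin> Lp M p" then show "(S \<otimes>\<^bsub>bounded_ops M p\<^esub> T) X = undefined"
      by (simp add: bounded_ops_def compose_def)
  next
    fix X Y assume [simp]: "X \<in> Lp M p" "Y \<in> Lp M p"
    show "(S \<otimes>\<^bsub>bounded_ops M p\<^esub> T) (Lp_add M p X Y)
      = Lp_add M p ((S \<otimes>\<^bsub>bounded_ops M p\<^esub> T) X) ((S \<otimes>\<^bsub>bounded_ops M p\<^esub> T) Y)"
      using p by simp
  next
    fix X assume [simp]: "X \<in> Lp M p"
    show "Lp_norm M p ((S \<otimes>\<^bsub>bounded_ops M p\<^esub> T) X) \<le> (C * D) * Lp_norm M p X"
      using C(2)[of "T X"] mult_left_mono[OF D[of X] C(1)] by simp
  qed auto
qed

lemma bounded_ops_zero_closed: "1 \<le> p \<Longrightarrow> \<zero>\<^bsub>bounded_ops M p\<^esub> \<in> carrier (bounded_ops M p)"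
  by (rule bounded_opsI[where C=0])
    (auto simp: bounded_ops_def Lp_zero_class Lp_scale_class Lp_add_class Lp_norm_class)

text \<open>An explicit additive inverse. The ring record provides only addition and zero; negation
  is a description over the carrier and has to be identified with a concrete operator.\<close>

definition op_neg where
  "op_neg M p T = (\<lambda>X\<in>Lp M p. Lp_scale M p (-1) (T X))"

lemma op_neg_closed:
  assumes p: "1 \<le> p" and T: "T \<in> carrier (bounded_ops M p)"
  shows "op_neg M p T \<in> carrier (bounded_ops M p)"
proof -
  obtain D where D: "\<And>X. X \<in> Lp M p \<Longrightarrow> Lp_norm M p (T X) \<le> D * Lp_norm M p X"
    using bounded_ops_bound[OF T] by metis
  note T' = bounded_opsD[OF T]
  show ?thesis
  proof (rule bounded_opsI[where C=D])
    fix c X assume "X \<in> Lp M p"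
    then show "op_neg M p T (Lp_scale M p c X) = Lp_scale M p c (op_neg M p T X)"
      using Lp_scale_scale[OF T'(1), of X "-1" c] by (simp add: op_neg_def T')
  qed (use p D T' in \<open>auto simp: op_neg_def Lp_scale_add Lp_norm_scale\<close>)
qed

lemma op_neg_add:
  assumes p: "1 \<le> p" and T: "T \<in> carrier (bounded_ops M p)"
  shows "op_neg M p T \<oplus>\<^bsub>bounded_ops M p\<^esub> T = \<zero>\<^bsub>bounded_ops M p\<^esub>"
proof (rule bounded_ops_eqI[where M=M and p=p])
  fix X assume X: "X \<in> Lp M p"
  have "0 \<le> p" using p by simp
  then show "(op_neg M p T \<oplus>\<^bsub>bounded_ops M p\<^esub> T) X = \<zero>\<^bsub>bounded_ops M p\<^esub> X"
    using X Lp_neg_add[of p "T X" M] bounded_opsD(1)[OF T X]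
    by (simp add: bounded_ops_add_apply bounded_ops_zero_apply op_neg_def)
qed (use op_neg_closed[OF p T] T p bounded_ops_add_closed[OF p] bounded_ops_zero_closed[OF p] in auto)

lemma abelian_group_bounded_ops:
  assumes p: "1 \<le> p"
  shows "abelian_group (bounded_ops M p)"
proof (rule abelian_groupI)
  note closed = bounded_ops_add_closed[OF p, where M=M] bounded_ops_zero_closed[OF p, where M=M]
  note app = bounded_ops_add_apply bounded_ops_zero_apply
  have p0: "0 \<le> p" using p by simp
  fix x assume x: "x \<in> carrier (bounded_ops M p)"
  note x' = bounded_opsD(1)[OF x]
  show "\<zero>\<^bsub>bounded_ops M p\<^esub> \<oplus>\<^bsub>bounded_ops M p\<^esub> x = x"
  proof (rule bounded_ops_eqI[where M=M and p=p])
    fix X assume X: "X \<in> Lp M p"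
    show "(\<zero>\<^bsub>bounded_ops M p\<^esub> \<oplus>\<^bsub>bounded_ops M p\<^esub> x) X = x X"
      unfolding bounded_ops_add_apply[OF X] bounded_ops_zero_apply[OF X]
      by (rule Lp_zero_add[OF p0 x'[OF X]])
  qed (use x closed in auto)
  show "\<exists>y\<in>carrier (bounded_ops M p). y \<oplus>\<^bsub>bounded_ops M p\<^esub> x = \<zero>\<^bsub>bounded_ops M p\<^esub>"
    using op_neg_closed[OF p x] op_neg_add[OF p x] by blast
  fix y assume y: "y \<in> carrier (bounded_ops M p)"
  note y' = bounded_opsD(1)[OF y]
  show "x \<oplus>\<^bsub>bounded_ops M p\<^esub> y = y \<oplus>\<^bsub>bounded_ops M p\<^esub> x"
    by (rule bounded_ops_eqI[where M=M and p=p]) (use x y closed in \<open>simp_all add: app Lp_add_commute[OF p0 x' y']\<close>)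
  fix z assume z: "z \<in> carrier (bounded_ops M p)"
  note z' = bounded_opsD(1)[OF z]
  show "x \<oplus>\<^bsub>bounded_ops M p\<^esub> y \<oplus>\<^bsub>bounded_ops M p\<^esub> z = x \<oplus>\<^bsub>bounded_ops M p\<^esub> (y \<oplus>\<^bsub>bounded_ops M p\<^esub> z)"
    by (rule bounded_ops_eqI[where M=M and p=p]) (use x y z closed in \<open>simp_all add: app Lp_add_assoc[OF p0 x' y' z']\<close>)
qed (use bounded_ops_add_closed bounded_ops_zero_closed p in auto)

lemma bounded_ops_minus_apply:
  assumes p: "1 \<le> p" and T: "T \<in> carrier (bounded_ops M p)" and X: "X \<in> Lp M p"
  shows "(S \<ominus>\<^bsub>bounded_ops M p\<^esub> T) X = Lp_add M p (S X) (Lp_scale M p (-1) (T X))"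
proof -
  interpret abelian_group "bounded_ops M p" by (rule abelian_group_bounded_ops[OF p])
  have "\<ominus>\<^bsub>bounded_ops M p\<^esub> T = op_neg M p T"
    using op_neg_closed[OF p T] op_neg_add[OF p T] T by (intro minus_equality)
  then show ?thesis using X by (simp add: minus_eq bounded_ops_add_apply op_neg_def)
qed

text \<open>Boundedness makes the supremum over the unit ball finite, and homogeneity carries its
  bound to all vectors. Vectors of norm 0 cannot be rescaled; for them the bound \<open>C\<close>
  already gives 0.\<close>

lemma op_norm_bound:
  assumes p: "1 \<le> p" and T: "T \<in> carrier (bounded_ops M p)" and X: "X \<in> Lp M p"
  shows "Lp_norm M p (T X) \<le> op_norm M p T * Lp_norm M p X"
proof -
  obtain C where C: "0 \<le> C" "\<And>X. X \<in> Lp M p \<Longrightarrow> Lp_norm M p (T X) \<le> C * Lp_norm M p X"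
    using bounded_ops_bound[OF T] by metis
  have bdd: "bdd_above ((\<lambda>X. Lp_norm M p (T X)) ` {X \<in> Lp M p. Lp_norm M p X \<le> 1})"
  proof (rule bdd_aboveI2)
    fix X assume X: "X \<in> {X \<in> Lp M p. Lp_norm M p X \<le> 1}"
    then show "Lp_norm M p (T X) \<le> C"
      using C(2)[of X] mult_left_mono[of "Lp_norm M p X" 1 C] C(1) by simp
  qed
  show ?thesis
  proof (cases "Lp_norm M p X = 0")
    case True
    then show ?thesis using C(2)[OF X] by simp
  next
    case False
    define r where "r = Lp_norm M p X"
    have r: "r > 0" using False Lp_norm_nonneg[OF X] by (simp add: r_def)
    define Y where "Y = Lp_scale M p (of_real (1 / r)) X"
    have Y: "Y \<in> Lp M p" using X by (simp add: Y_def)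
    have "Lp_norm M p Y = 1"
      using r by (simp add: Y_def Lp_norm_scale[OF p X] norm_divide flip: r_def)
    then have "Lp_norm M p (T Y) \<le> op_norm M p T"
      unfolding op_norm_def using Y by (intro cSUP_upper bdd) auto
    moreover have "Lp_norm M p (T Y) = Lp_norm M p (T X) / r"
      using r by (simp add: Y_def bounded_opsD(4)[OF T X] Lp_norm_scale[OF p bounded_opsD(1)[OF T X]] norm_divide)
    ultimately show ?thesis using r by (simp add: field_simps flip: r_def)
  qed
qed

lemma op_norm_le:
  assumes C: "0 \<le> C" and le: "\<And>X. X \<in> Lp M p \<Longrightarrow> Lp_norm M p (T X) \<le> C * Lp_norm M p X"
  shows "op_norm M p T \<le> C"
  unfolding op_norm_def
proof (rule cSUP_least)
  show "{X \<in> Lp M p. Lp_norm M p X \<le> 1} \<noteq> {}"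
  proof -
    have "Lp_zero M p \<in> {X \<in> Lp M p. Lp_norm M p X \<le> 1}" by simp
    then show ?thesis by blast
  qed
  fix X assume "X \<in> {X \<in> Lp M p. Lp_norm M p X \<le> 1}"
  then show "Lp_norm M p (T X) \<le> C"
    using le[of X] mult_left_mono[of "Lp_norm M p X" 1 C] C by simp
qed

section \<open>Compactly supported functions and the Haar integral\<close>

lemma Hausdorff_space_euclidean_t2: "Hausdorff_space (euclidean :: 'a::t2_space topology)"
  unfolding Hausdorff_space_def by (auto simp: disjnt_def dest!: hausdorff)

lemma continuous_on_compose_UNIV:
  "continuous_on UNIV f \<Longrightarrow> continuous_on S g \<Longrightarrow> continuous_on S (\<lambda>x. f (g x))"
  by (rule continuous_on_compose2) auto

lemma CcI:
  fixes f :: "'g::t2_space \<Rightarrow> complex"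
  assumes "continuous_on UNIV f" "compact K" "\<And>x. x \<notin> K \<Longrightarrow> f x = 0"
  shows "f \<in> Cc"
proof -
  have "closure {x. f x \<noteq> 0} \<subseteq> K"
    using assms by (intro closure_minimal compact_imp_closed) auto
  then have "closure {x. f x \<noteq> 0} = K \<inter> closure {x. f x \<noteq> 0}" by blast
  also have "compact \<dots>" by (rule compact_Int_closed) (use assms in auto)
  finally show ?thesis using assms by (simp add: Cc_def)
qed

lemma Cc_continuous: "f \<in> Cc \<Longrightarrow> continuous_on UNIV f"
  by (simp add: Cc_def)

lemma Cc_supportE:
  assumes "f \<in> Cc"
  obtains K where "compact K" "\<And>x. x \<notin> K \<Longrightarrow> f x = 0"
proof
  show "compact (closure {x. f x \<noteq> 0})" using assms by (simp add: Cc_def)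
  fix x assume "x \<notin> closure {x. f x \<noteq> 0}"
  then show "f x = 0" using closure_subset[of "{x. f x \<noteq> 0}"] by blast
qed

lemma Cc_compose:
  fixes f :: "'g::t2_space \<Rightarrow> complex"
  assumes f: "f \<in> Cc" and \<phi>: "continuous_on UNIV \<phi>" "\<phi> 0 = 0"
  shows "(\<lambda>x. \<phi> (f x)) \<in> Cc"
proof -
  obtain K where K: "compact K" "\<And>x. x \<notin> K \<Longrightarrow> f x = 0" using Cc_supportE[OF f] by metis
  show ?thesis
    by (rule CcI[OF _ K(1)]) (use K \<phi> Cc_continuous[OF f] in \<open>auto intro: continuous_on_compose_UNIV\<close>)
qed

lemma Cc_bounded:
  assumes "f \<in> Cc"
  obtains B where "0 \<le> B" "\<And>x. norm (f x) \<le> B"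
proof -
  obtain K where K: "compact K" "\<And>x. x \<notin> K \<Longrightarrow> f x = 0" using Cc_supportE[OF assms] by metis
  have "compact (f ` K)"
    by (rule compact_continuous_image[OF continuous_on_subset[OF Cc_continuous[OF assms]] K(1)]) simp
  then obtain B where B: "\<And>x. x \<in> K \<Longrightarrow> norm (f x) \<le> B"
    using compact_imp_bounded bounded_iff by (metis imageI)
  show ?thesis
  proof (rule that[of "max B 0"])
    fix x show "norm (f x) \<le> max B 0" using B[of x] K(2)[of x] by (cases "x \<in> K") auto
  qed simp
qed

lemma Cc_mult_continuous:
  fixes f :: "'g::t2_space \<Rightarrow> complex"
  assumes f: "f \<in> Cc" and g: "continuous_on UNIV g"
  shows "(\<lambda>x. f x * g x) \<in> Cc"
proof -
  obtain K where K: "compact K" "\<And>x. x \<notin> K \<Longrightarrow> f x = 0" using Cc_supportE[OF f] by metis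
  show ?thesis
    by (rule CcI[OF _ K(1)]) (use K g Cc_continuous[OF f] in \<open>auto intro: continuous_on_mult\<close>)
qed

lemma Cc_zero [simp]: "(\<lambda>x. 0) \<in> Cc"
  by (simp add: Cc_def)

lemma Cc_scale: "f \<in> Cc \<Longrightarrow> (\<lambda>x. c * f x) \<in> Cc"
  for f :: "'g::t2_space \<Rightarrow> complex"
  by (erule Cc_compose) (auto intro!: continuous_intros)

lemma Cc_add:
  fixes f :: "'g::t2_space \<Rightarrow> complex"
  assumes f: "f \<in> Cc" and g: "g \<in> Cc"
  shows "(\<lambda>x. f x + g x) \<in> Cc"
proof -
  obtain K where K: "compact K" "\<And>x. x \<notin> K \<Longrightarrow> f x = 0" using Cc_supportE[OF f] by metis
  obtain L where L: "compact L" "\<And>x. x \<notin> L \<Longrightarrow> g x = 0" using Cc_supportE[OF g] by metis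
  show ?thesis
    by (rule CcI[OF continuous_on_add[OF Cc_continuous[OF f] Cc_continuous[OF g]] compact_Un[OF K(1) L(1)]])
      (use K(2) L(2) in auto)
qed

lemma Cc_diff:
  fixes f :: "'g::t2_space \<Rightarrow> complex"
  assumes "f \<in> Cc" "g \<in> Cc"
  shows "(\<lambda>x. f x - g x) \<in> Cc"
  using Cc_add[OF assms(1) Cc_scale[OF assms(2), of "-1"]] by simp

lemma Cc_homeo:
  fixes f :: "'g::t2_space \<Rightarrow> complex" and g :: "'h::t2_space \<Rightarrow> 'g"
  assumes f: "f \<in> Cc" and g: "continuous_on UNIV g" and h: "continuous_on UNIV h"
    and hg: "\<And>x. h (g x) = x"
  shows "(\<lambda>x. f (g x)) \<in> Cc"
proof -
  obtain K where K: "compact K" "\<And>x. x \<notin> K \<Longrightarrow> f x = 0" using Cc_supportE[OF f] by metis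
  have "compact (h ` K)"
    by (rule compact_continuous_image[OF continuous_on_subset[OF h] K(1)]) simp
  moreover have "f (g x) = 0" if "x \<notin> h ` K" for x
    using K(2)[of "g x"] hg[of x] that by (metis imageI)
  ultimately show ?thesis
    by (rule CcI[OF continuous_on_compose_UNIV[OF Cc_continuous[OF f] g]])
qed

lemma Cc_translate_left: "f \<in> Cc \<Longrightarrow> (\<lambda>x. f (a + x)) \<in> Cc"
  for f :: "'g::{topological_group_add, t2_space} \<Rightarrow> complex"
  by (erule Cc_homeo[where h="\<lambda>x. - a + x"]) (auto intro!: continuous_intros simp flip: add.assoc)

lemma Cc_translate_right: "f \<in> Cc \<Longrightarrow> (\<lambda>x. f (x + a)) \<in> Cc"
  for f :: "'g::{topological_group_add, t2_space} \<Rightarrow> complex"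
  by (erule Cc_homeo[where h="\<lambda>x. x - a"]) (auto intro!: continuous_intros)

lemma Cc_uminus: "f \<in> Cc \<Longrightarrow> (\<lambda>x. f (- x)) \<in> Cc"
  for f :: "'g::{topological_group_add, t2_space} \<Rightarrow> complex"
  by (erule Cc_homeo[where h="\<lambda>x. - x"]) (auto intro!: continuous_intros)

lemma Cc_cnj: "f \<in> Cc \<Longrightarrow> (\<lambda>x. cnj (f x)) \<in> Cc"
  for f :: "'g::t2_space \<Rightarrow> complex"
  by (erule Cc_compose) (auto intro!: continuous_intros)

section \<open>Integration against a unimodular Haar measure\<close>

locale unimodular_haar =
  fixes M :: "'g::{topological_group_add, t2_space} measure"
  assumes locally_compact: "locally_compact_space (euclidean :: 'g topology)"
    and haar: "left_haar_measure M"
    and unimodular: "unimodular M"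
begin

lemma sets_haar [simp, measurable_cong]: "sets M = sets borel"
  using haar by (simp add: left_haar_measure_def)

lemma space_haar [simp]: "space M = UNIV"
  using sets_eq_imp_space_eq[OF sets_haar] by simp

lemma emeasure_compact_finite: "compact K \<Longrightarrow> emeasure M K < \<infinity>"
  using haar by (simp add: left_haar_measure_def)

lemma outer_regular:
  "A \<in> sets borel \<Longrightarrow> emeasure M A = (INF U\<in>{U. open U \<and> A \<subseteq> U}. emeasure M U)"
  using haar unfolding left_haar_measure_def by blast

lemma inner_regular:
  "open U \<Longrightarrow> emeasure M U = (SUP K\<in>{K. compact K \<and> K \<subseteq> U}. emeasure M K)"
  using haar unfolding left_haar_measure_def by blast

lemma compact_borel [measurable, simp]: "compact K \<Longrightarrow> K \<in> sets borel" for K :: "'g set"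
  by (intro borel_closed compact_imp_closed)

lemma continuous_measurable: "continuous_on UNIV f \<Longrightarrow> f \<in> borel_measurable M"
  for f :: "'g \<Rightarrow> 'b::topological_space"
  using borel_measurable_continuous_onI[of f] by (simp cong: measurable_cong_sets)

lemma distr_homeo:
  assumes "continuous_on UNIV h" "\<And>x. h (g x) = x" "\<And>x. g (h x) = x"
    and "\<And>A. A \<in> sets borel \<Longrightarrow> emeasure M (g ` A) = emeasure M A"
  shows "distr M M h = M"
proof (rule measure_eqI)
  have [measurable]: "h \<in> measurable M M"
    using continuous_measurable[OF assms(1)] by (simp cong: measurable_cong_sets)
  fix A assume A: "A \<in> sets (distr M M h)"
  have "h -` A = g ` A"
  proof (intro equalityI subsetI)
    fix x assume "x \<in> h -` A"
    then show "x \<in> g ` A" using assms(3)[of x] by (metis imageI vimageD)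
  qed (use assms(2) in auto)
  then show "emeasure (distr M M h) A = emeasure M A"
    using A assms(4)[of A] by (simp add: emeasure_distr)
qed simp

lemma distr_translate_left: "distr M M ((+) a) = M"
proof (rule distr_homeo[where g="(+) (- a)"])
  show "emeasure M ((+) (- a) ` A) = emeasure M A" if "A \<in> sets borel" for A
    using haar that unfolding left_haar_measure_def by blast
qed (auto intro!: continuous_intros simp flip: add.assoc)

lemma distr_translate_right: "distr M M (\<lambda>x. x + a) = M"
proof (rule distr_homeo[where g="\<lambda>x. x + - a"])
  show "emeasure M ((\<lambda>x. x + - a) ` A) = emeasure M A" if "A \<in> sets borel" for A
    using unimodular that unfolding unimodular_def by blast
qed (auto intro!: continuous_intros simp: add.assoc)

lemma measurable_homeo: "continuous_on UNIV h \<Longrightarrow> h \<in> measurable M M"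
  using continuous_measurable[of h] by (simp cong: measurable_cong_sets)

lemma integral_translate_left:
  fixes f :: "'g \<Rightarrow> 'b::{banach, second_countable_topology}"
  assumes "f \<in> borel_measurable M"
  shows "(\<integral>x. f (a + x) \<partial>M) = (\<integral>x. f x \<partial>M)"
  using integral_distr[OF measurable_homeo[of "(+) a"] assms] distr_translate_left[of a]
  by (simp add: continuous_intros)

lemma integral_translate_right:
  fixes f :: "'g \<Rightarrow> 'b::{banach, second_countable_topology}"
  assumes "f \<in> borel_measurable M"
  shows "(\<integral>x. f (x + a) \<partial>M) = (\<integral>x. f x \<partial>M)"
  using integral_distr[OF measurable_homeo[of "\<lambda>x. x + a"] assms] distr_translate_right[of a]
  by (simp add: continuous_intros)

lemma bounded_support_integrable:
  fixes f :: "'g \<Rightarrow> 'b::{banach, second_countable_topology}"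
  assumes "f \<in> borel_measurable M" "compact K" "\<And>x. x \<notin> K \<Longrightarrow> f x = 0" "\<And>x. norm (f x) \<le> B"
  shows "integrable M f"
proof (rule Bochner_Integration.integrable_bound[where f="\<lambda>x. B * indicator K x"])
  show "integrable M (\<lambda>x. B * indicator K x)"
    using assms(2) emeasure_compact_finite[OF assms(2)]
    by (intro integrable_mult_right integrable_real_indicator) auto
  have "0 \<le> B" using assms(4)[of undefined] norm_ge_zero order_trans by blast
  then have "norm (f x) \<le> norm (B * indicator K x)" for x
    using assms(3)[of x] assms(4)[of x] by (cases "x \<in> K") auto
  then show "AE x in M. norm (f x) \<le> norm (B * indicator K x)" by simp
qed (use assms in auto)

lemma integrable_compact_support:
  fixes f :: "'g \<Rightarrow> 'b::{banach, second_countable_topology}"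
  assumes f: "continuous_on UNIV f" and K: "compact K" "\<And>x. x \<notin> K \<Longrightarrow> f x = 0"
  shows "integrable M f"
proof -
  have "compact (f ` K)"
    by (rule compact_continuous_image[OF continuous_on_subset[OF f] K(1)]) simp
  then obtain B where B: "\<And>x. x \<in> K \<Longrightarrow> norm (f x) \<le> B"
    using compact_imp_bounded bounded_iff by (metis imageI)
  show ?thesis
  proof (rule bounded_support_integrable[OF continuous_measurable[OF f] K])
    fix x show "norm (f x) \<le> max B 0" using B[of x] K(2)[of x] by (cases "x \<in> K") auto
  qed
qed

lemma Cc_integrable: "f \<in> Cc \<Longrightarrow> integrable M f"
  by (metis Cc_continuous Cc_supportE integrable_compact_support)

lemma Cc_measurable: "f \<in> Cc \<Longrightarrow> f \<in> borel_measurable M"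
  by (intro continuous_measurable Cc_continuous)

lemma Cc_norm_powr_integrable:
  assumes "f \<in> Cc" and p: "0 \<le> p"
  shows "integrable M (\<lambda>x. norm (f x) powr p)"
proof -
  obtain K where K: "compact K" "\<And>x. x \<notin> K \<Longrightarrow> f x = 0" using Cc_supportE[OF assms(1)] by metis
  obtain B where B: "0 \<le> B" "\<And>x. norm (f x) \<le> B" using Cc_bounded[OF assms(1)] by metis
  show ?thesis
    by (rule bounded_support_integrable[where K=K and B="B powr p"])
      (use K B p Cc_measurable[OF assms(1)] in \<open>auto intro!: powr_mono2\<close>)
qed

lemma Cc_in_lp_fun: "f \<in> Cc \<Longrightarrow> 0 \<le> p \<Longrightarrow> f \<in> lp_fun M p"
  by (simp add: lp_fun_def Cc_norm_powr_integrable Cc_measurable)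

text \<open>Compactness of \<open>L\<close> makes \<open>F x\<close> uniformly close to
  \<open>F x0\<close> on \<open>L\<close> for all x in one neighbourhood of \<open>x0\<close>; the
  integrals then differ by at most that distance times the measure of \<open>L\<close>.\<close>

lemma continuous_on_parametric_integral:
  fixes F :: "'a::topological_space \<Rightarrow> 'g \<Rightarrow> 'b::{banach, second_countable_topology}"
  assumes F: "continuous_on UNIV (\<lambda>z. F (fst z) (snd z))" and L: "compact L"
    and supp: "\<And>x y. y \<notin> L \<Longrightarrow> F x y = 0"
  shows "continuous_on UNIV (\<lambda>x. \<integral>y. F x y \<partial>M)"
  unfolding continuous_on_def
proof (intro ballI tendstoI)
  fix x0 and e :: real assume e: "0 < e"
  have cont: "continuous_on UNIV (F x)" for x
    using continuous_on_compose_UNIV[OF F, of UNIV "\<lambda>y. (x, y)"] by (simp add: continuous_intros)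
  note int = integrable_compact_support[OF cont L supp]
  define m where "m = measure M L"
  \<comment> \<open>Then \<open>d * m\<close> is below e / 2; adding 1 to m keeps the denominator
    positive if \<open>L\<close> is a null set.\<close>
  define d where "d = e / (2 * (m + 1))"
  have m: "m \<ge> 0" by (simp add: m_def)
  then have d: "0 < d" using e by (simp add: d_def)
  obtain X where X: "x0 \<in> X" "open X"
      "\<forall>x\<in>X \<inter> UNIV. \<forall>t \<in> L. dist (F (fst (x, t)) (snd (x, t))) (F (fst (x0, t)) (snd (x0, t))) \<le> d"
    by (rule continuous_on_prod_compactE[OF continuous_on_subset[OF F, of "UNIV \<times> L"] L _ d, of x0]) auto
  have "dist (\<integral>y. F x y \<partial>M) (\<integral>y. F x0 y \<partial>M) < e" if "x \<in> X" for x
  proof -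
    have "dist (\<integral>y. F x y \<partial>M) (\<integral>y. F x0 y \<partial>M) = norm (\<integral>y. F x y - F x0 y \<partial>M)"
      using int by (simp add: dist_norm)
    also have "\<dots> \<le> (\<integral>y. norm (F x y - F x0 y) \<partial>M)"
      by (rule integral_norm_bound)
    also have "\<dots> \<le> (\<integral>y. d * indicator L y \<partial>M)"
    proof (rule integral_mono)
      show "integrable M (\<lambda>y. d * indicator L y)"
        using L emeasure_compact_finite[OF L] by (intro integrable_mult_right integrable_real_indicator) auto
      show "norm (F x y - F x0 y) \<le> d * indicator L y" for y
        using X(3) that supp[of y] by (cases "y \<in> L") (auto simp: dist_norm)
    qed (use int in auto)
    also have "\<dots> = d * m" using L by (simp add: m_def)
    also have "\<dots> < e"
      using m e mult_strict_left_mono[of m "2 * (m + 1)" e] by (simp add: d_def field_simps)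
    finally show ?thesis .
  qed
  then show "\<forall>\<^sub>F x in at x0 within UNIV. dist (\<integral>y. F x y \<partial>M) (\<integral>y. F x0 y \<partial>M) < e"
    unfolding eventually_at_topological using X by blast
qed

section \<open>Urysohn functions on a locally compact group\<close>

lemma completely_regular: "completely_regular_space (euclidean :: 'g topology)"
  using locally_compact_regular_imp_completely_regular_space[OF locally_compact]
    Hausdorff_space_euclidean_t2 by blast

lemma separating_function:
  assumes "x \<noteq> (y::'g)"
  obtains f :: "'g \<Rightarrow> real" where "continuous_on UNIV f" "f x \<noteq> f y"
proof -
  have "compactin euclidean {x}" "closedin euclidean {y}" "disjnt {x} {y}"
    using assms by auto
  then obtain f where "continuous_map euclidean euclideanreal f" "f ` {y} \<subseteq> {0::real}" "f ` {x} \<subseteq> {1}"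
    using Urysohn_completely_regular_compact_closed_alt[OF completely_regular, of "{x}" "{y}" 0 1] by metis
  then show ?thesis using that[of f] by auto
qed

lemma compact_neighbourhood:
  assumes "compact (K :: 'g set)"
  obtains V L where "open V" "compact L" "K \<subseteq> V" "V \<subseteq> L"
proof -
  have "\<exists>U C. open U \<and> compact C \<and> x \<in> U \<and> U \<subseteq> C" for x :: 'g
    using locally_compact unfolding locally_compact_space_def by simp
  then have "\<forall>x :: 'g. \<exists>P. open (fst P) \<and> compact (snd P) \<and> x \<in> fst P \<and> fst P \<subseteq> snd P"
    by simp
  then obtain P where P: "\<forall>x :: 'g. open (fst (P x)) \<and> compact (snd (P x)) \<and> x \<in> fst (P x) \<and> fst (P x) \<subseteq> snd (P x)"
    by (rule choice[THEN exE])
  define U where "U x = fst (P x)" for x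
  define C where "C x = snd (P x)" for x
  have UC: "\<And>x :: 'g. open (U x)" "\<And>x. compact (C x)" "\<And>x. x \<in> U x" "\<And>x. U x \<subseteq> C x"
    using P by (auto simp: U_def C_def)
  obtain D where D: "D \<subseteq> K" "finite D" "K \<subseteq> (\<Union>x\<in>D. U x)"
    by (rule compactE_image[OF assms, of K U]) (use UC in auto)
  show ?thesis
  proof (rule that)
    show "open (\<Union>x\<in>D. U x)" using UC by blast
    show "compact (\<Union>x\<in>D. C x)" using D UC by blast
    show "(\<Union>x\<in>D. U x) \<subseteq> (\<Union>x\<in>D. C x)" using UC by blast
  qed (rule D)
qed

text \<open>Complete regularity separates the compact \<open>K\<close> from the complement of
  \<open>U \<inter> V\<close>. The factor \<open>V\<close>, contained in a compact set, makes the
  support compact; the factor \<open>U\<close> makes the function vanish off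
  \<open>U\<close>.\<close>

lemma bump_function:
  assumes K: "compact K" and U: "open (U :: 'g set)" "K \<subseteq> U"
  obtains \<phi> :: "'g \<Rightarrow> real" where "(\<lambda>x. complex_of_real (\<phi> x)) \<in> Cc"
    "\<And>x. 0 \<le> \<phi> x" "\<And>x. \<phi> x \<le> 1" "\<And>x. x \<in> K \<Longrightarrow> \<phi> x = 1" "\<And>x. x \<notin> U \<Longrightarrow> \<phi> x = 0"
proof -
  obtain V L where VL: "open V" "compact L" "K \<subseteq> V" "V \<subseteq> L" using compact_neighbourhood[OF K] by metis
  have "closed (- (U \<inter> V))" using U VL by auto
  moreover have "disjnt K (- (U \<inter> V))" using U VL by (auto simp: disjnt_def)
  ultimately obtain \<phi> :: "'g \<Rightarrow> real" where \<phi>: "continuous_map euclidean (top_of_set {0..1}) \<phi>"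
     "\<phi> ` (- (U \<inter> V)) \<subseteq> {0}" "\<phi> ` K \<subseteq> {1}"
    using Urysohn_completely_regular_compact_closed[OF _ completely_regular, of 0 1 K "- (U \<inter> V)"] K
    by (metis closed_closedin compactin_euclidean_iff zero_le_one)
  have c: "continuous_on UNIV \<phi>" and r: "\<And>x. \<phi> x \<in> {0..1}"
    using \<phi>(1) by (auto simp: continuous_map_in_subtopology)
  show ?thesis
  proof (rule that)
    show "(\<lambda>x. complex_of_real (\<phi> x)) \<in> Cc"
      by (rule CcI[OF _ VL(2)]) (use c \<phi>(2) VL in \<open>auto intro!: continuous_on_of_real\<close>)
  qed (use r \<phi> in auto)
qed

text \<open>
  Without second countability a continuous function on the product need not be measurable for the
  product \<open>\<sigma>\<close>-algebra; on compact sets, Stone--Weierstrass provides measurability.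
\<close>

lemma product_measurable_real:
  fixes F :: "'g \<times> 'g \<Rightarrow> real"
  assumes F: "continuous_on UNIV F" and K: "compact K" and supp: "\<And>z. z \<notin> K \<times> K \<Longrightarrow> F z = 0"
  shows "F \<in> borel_measurable (borel \<Otimes>\<^sub>M borel)"
proof -
  \<comment> \<open>Functions that are both continuous on \<open>K \<times> K\<close> and product
    measurable form an algebra, and functions of a single coordinate already separate points;
    Stone--Weierstrass then makes \<open>F\<close> a uniform limit of measurable functions on
    \<open>K \<times> K\<close>.\<close>
  define R where "R = {f :: 'g \<times> 'g \<Rightarrow> real. continuous_on (K \<times> K) f \<and> f \<in> borel_measurable (borel \<Otimes>\<^sub>M borel)}"
  interpret function_ring_on R "K \<times> K"
  proof
    fix z w :: "'g \<times> 'g" assume "z \<noteq> w"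
    then consider "fst z \<noteq> fst w" | "snd z \<noteq> snd w" by (auto simp: prod_eq_iff)
    then show "\<exists>f\<in>R. f z \<noteq> f w"
    proof cases
      case 1
      then obtain f :: "'g \<Rightarrow> real" where f: "continuous_on UNIV f" "f (fst z) \<noteq> f (fst w)"
        using separating_function by metis
      have [measurable]: "f \<in> borel_measurable borel" using f by (intro borel_measurable_continuous_onI)
      have "(\<lambda>z. f (fst z)) \<in> R"
        using continuous_on_compose_UNIV[OF f(1) continuous_on_fst[OF continuous_on_id], of "K \<times> K"]
        by (simp add: R_def)
      then show ?thesis using f by (intro bexI[of _ "\<lambda>z. f (fst z)"])
    next
      case 2
      then obtain f :: "'g \<Rightarrow> real" where f: "continuous_on UNIV f" "f (snd z) \<noteq> f (snd w)"
        using separating_function by metis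
      have [measurable]: "f \<in> borel_measurable borel" using f by (intro borel_measurable_continuous_onI)
      have "(\<lambda>z. f (snd z)) \<in> R"
        using continuous_on_compose_UNIV[OF f(1) continuous_on_snd[OF continuous_on_id], of "K \<times> K"]
        by (simp add: R_def)
      then show ?thesis using f by (intro bexI[of _ "\<lambda>z. f (snd z)"])
    qed
  next
    show "compact (K \<times> K)" by (rule compact_Times[OF K K])
  qed (simp_all add: R_def continuous_on_add continuous_on_mult borel_measurable_add borel_measurable_times)
  obtain h where h: "h \<in> UNIV \<rightarrow> R" "uniform_limit (K \<times> K) h F sequentially"
    using Stone_Weierstrass[OF continuous_on_subset[OF F subset_UNIV]] by blast
  have KK [measurable]: "K \<times> K \<in> sets (borel \<Otimes>\<^sub>M borel)"
    using K by (intro pair_measureI) auto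
  show ?thesis
  proof (rule borel_measurable_LIMSEQ_real)
    show "(\<lambda>z. indicator (K \<times> K) z * h n z) \<in> borel_measurable (borel \<Otimes>\<^sub>M borel)" for n
      using h(1) by (intro borel_measurable_times borel_measurable_indicator KK) (auto simp: R_def)
    fix z
    show "(\<lambda>n. indicator (K \<times> K) z * h n z) \<longlonglongrightarrow> F z"
      using tendsto_uniform_limitI[OF h(2), of z] supp[of z] by (cases "z \<in> K \<times> K") auto
  qed
qed

lemma product_measurable:
  fixes F :: "'g \<times> 'g \<Rightarrow> complex"
  assumes F: "continuous_on UNIV F" and K: "compact K" and supp: "\<And>z. z \<notin> K \<times> K \<Longrightarrow> F z = 0"
  shows "F \<in> borel_measurable (borel \<Otimes>\<^sub>M borel)"
  unfolding borel_measurable_complex_iff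
  using product_measurable_real[OF continuous_on_Re[OF F] K] product_measurable_real[OF continuous_on_Im[OF F] K] supp
  by simp

text \<open>Haar measure may fail to be sigma-finite. Its restriction to a compact set
  \<open>Q\<close> containing both supports is finite, and the integrals occurring here do not see
  the difference.\<close>

theorem Fubini_compact_support:
  fixes F :: "'g \<Rightarrow> 'g \<Rightarrow> complex"
  assumes F: "continuous_on UNIV (\<lambda>z. F (fst z) (snd z))" and K: "compact K" "compact L"
    and supp: "\<And>x y. x \<notin> K \<Longrightarrow> F x y = 0" "\<And>x y. y \<notin> L \<Longrightarrow> F x y = 0"
  shows "(\<integral>x. \<integral>y. F x y \<partial>M \<partial>M) = (\<integral>y. \<integral>x. F x y \<partial>M \<partial>M)"
proof -
  define Q where "Q = K \<union> L"
  have Q: "compact Q" using K by (auto simp: Q_def)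
  define \<nu> where "\<nu> = density M (\<lambda>x. ennreal (indicator Q x))"
  have [measurable_cong, simp]: "sets \<nu> = sets borel" and [simp]: "space \<nu> = UNIV" by (simp_all add: \<nu>_def)
  have "emeasure \<nu> UNIV = emeasure M Q"
    using Q by (subst \<nu>_def, subst emeasure_density) (auto simp: ennreal_indicator)
  then have "emeasure \<nu> (space \<nu>) \<noteq> \<infinity>"
    using emeasure_compact_finite[OF Q] by simp
  then interpret finite_measure \<nu> by (rule finite_measureI)
  interpret P: pair_sigma_finite \<nu> \<nu> ..
  interpret PP: finite_measure "\<nu> \<Otimes>\<^sub>M \<nu>"
    by (rule finite_measure_pair_measure[OF finite_measure_axioms finite_measure_axioms])
  have F': "continuous_on UNIV (\<lambda>z. F (snd z) (fst z))"
    using continuous_on_compose_UNIV[OF F, of UNIV "\<lambda>z. (snd z, fst z)"] by (simp add: continuous_intros)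
  have c1: "continuous_on UNIV (F x)" for x
    using continuous_on_compose_UNIV[OF F, of UNIV "\<lambda>y. (x, y)"] by (simp add: continuous_intros)
  have c2: "continuous_on UNIV (\<lambda>x. F x y)" for y
    using continuous_on_compose_UNIV[OF F, of UNIV "\<lambda>x. (x, y)"] by (simp add: continuous_intros)
  have \<nu>_int: "(\<integral>x. f x \<partial>\<nu>) = (\<integral>x. f x \<partial>M)"
    if "continuous_on UNIV f" "\<And>x. x \<notin> Q \<Longrightarrow> f x = 0" for f :: "'g \<Rightarrow> complex"
  proof -
    have "(\<integral>x. f x \<partial>\<nu>) = (\<integral>x. indicator Q x *\<^sub>R f x \<partial>M)"
      unfolding \<nu>_def by (rule integral_density) (use Q continuous_measurable[OF that(1)] in auto)
    also have "\<dots> = (\<integral>x. f x \<partial>M)"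
      by (intro Bochner_Integration.integral_cong) (use that(2) in \<open>auto simp: indicator_def\<close>)
    finally show ?thesis .
  qed
  have "compact ((\<lambda>z. F (fst z) (snd z)) ` (Q \<times> Q))"
    by (rule compact_continuous_image[OF continuous_on_subset[OF F]]) (auto intro: compact_Times Q)
  then obtain B where B0: "\<And>w. w \<in> (\<lambda>z. F (fst z) (snd z)) ` (Q \<times> Q) \<Longrightarrow> norm w \<le> B"
    using compact_imp_bounded bounded_iff by metis
  have B: "norm (F x y) \<le> max B 0" for x y
  proof (cases "x \<in> Q \<and> y \<in> Q")
    case True
    then show ?thesis using B0[OF imageI, of "(x, y)"] by simp
  next
    case False
    then have "F x y = 0" using supp by (auto simp: Q_def)
    then show ?thesis by simp
  qed
  have meas: "case_prod F \<in> borel_measurable (borel \<Otimes>\<^sub>M borel)"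
  proof -
    have "F (fst z) (snd z) = 0" if "z \<notin> Q \<times> Q" for z
      using that supp by (auto simp: Q_def mem_Times_iff)
    then show ?thesis using product_measurable[OF F Q] by (simp add: case_prod_unfold)
  qed
  have "sets (\<nu> \<Otimes>\<^sub>M \<nu>) = sets (borel \<Otimes>\<^sub>M borel)" by (intro sets_pair_measure_cong) auto
  then have "case_prod F \<in> borel_measurable (\<nu> \<Otimes>\<^sub>M \<nu>)"
    using meas by (simp cong: measurable_cong_sets)
  then have "integrable (\<nu> \<Otimes>\<^sub>M \<nu>) (case_prod F)"
    by (intro PP.integrable_const_bound[where B="max B 0"]) (auto simp: B intro!: AE_I2)
  then have eq: "(\<integral>y. \<integral>x. F x y \<partial>\<nu> \<partial>\<nu>) = (\<integral>x. \<integral>y. F x y \<partial>\<nu> \<partial>\<nu>)"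
    by (rule P.Fubini_integral)
  have i1: "(\<integral>y. F x y \<partial>\<nu>) = (\<integral>y. F x y \<partial>M)" for x
    by (rule \<nu>_int[OF c1]) (use supp in \<open>auto simp: Q_def\<close>)
  have i2: "(\<integral>x. F x y \<partial>\<nu>) = (\<integral>x. F x y \<partial>M)" for y
    by (rule \<nu>_int[OF c2]) (use supp in \<open>auto simp: Q_def\<close>)
  have "(\<integral>x. \<integral>y. F x y \<partial>M \<partial>\<nu>) = (\<integral>x. \<integral>y. F x y \<partial>M \<partial>M)"
    by (rule \<nu>_int[OF continuous_on_parametric_integral[OF F K(2)]])
      (use supp in \<open>auto simp: Q_def intro!: integral_eq_zero_AE\<close>)
  moreover have "(\<integral>y. \<integral>x. F x y \<partial>M \<partial>\<nu>) = (\<integral>y. \<integral>x. F x y \<partial>M \<partial>M)"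
    by (rule \<nu>_int[OF continuous_on_parametric_integral[OF F' K(1)]])
      (use supp in \<open>auto simp: Q_def intro!: integral_eq_zero_AE\<close>)
  ultimately show ?thesis using eq by (simp add: i1 i2)
qed

text \<open>Both sides are the double integral of \<open>f x * g (y + x)\<close>.\<close>

lemma Cc_integral_uminus_product:
  assumes f: "f \<in> Cc" and g: "g \<in> Cc"
  shows "(\<integral>x. f x \<partial>M) * (\<integral>x. g x \<partial>M) = (\<integral>x. g x \<partial>M) * (\<integral>x. f (- x) \<partial>M)"
proof -
  note fc = Cc_continuous[OF f] and gc = Cc_continuous[OF g]
  obtain K where K: "compact K" "\<And>x. x \<notin> K \<Longrightarrow> f x = 0" using Cc_supportE[OF f] by metis
  obtain L where L: "compact L" "\<And>x. x \<notin> L \<Longrightarrow> g x = 0" using Cc_supportE[OF g] by metis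
  \<comment> \<open>If \<open>f x\<close> and \<open>g (y + x)\<close> are both nonzero, then y = (y
    + x) - x lies in \<open>D\<close>, so \<open>D\<close> bounds the support in y.\<close>
  define D where "D = (\<lambda>z. fst z - snd z) ` (L \<times> K)"
  have D: "compact D" unfolding D_def
    by (rule compact_continuous_image) (intro continuous_intros compact_Times K L)+
  have DI: "a - b \<in> D" if "a \<in> L" "b \<in> K" for a b
    using that by (force simp: D_def)
  have c1: "continuous_on UNIV (\<lambda>z. f (fst z) * g (snd z + fst z))"
    by (intro continuous_on_mult continuous_on_compose_UNIV[OF fc] continuous_on_compose_UNIV[OF gc]
        continuous_intros)
  have c2: "continuous_on UNIV (\<lambda>z. f (- fst z + snd z) * g (snd z))"
    by (intro continuous_on_mult continuous_on_compose_UNIV[OF fc] continuous_on_compose_UNIV[OF gc]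
        continuous_intros)
  \<comment> \<open>Right invariance rewrites the integral of g for each x separately; this is where
    unimodularity enters.\<close>
  have "(\<integral>x. f x \<partial>M) * (\<integral>x. g x \<partial>M) = (\<integral>x. f x * (\<integral>y. g (y + x) \<partial>M) \<partial>M)"
    using integral_translate_right[OF Cc_measurable[OF g]] by simp
  also have "\<dots> = (\<integral>x. \<integral>y. f x * g (y + x) \<partial>M \<partial>M)"
    by simp
  also have "\<dots> = (\<integral>y. \<integral>x. f x * g (y + x) \<partial>M \<partial>M)"
  proof (rule Fubini_compact_support[OF c1 K(1) D])
    fix x y assume "y \<notin> D"
    then show "f x * g (y + x) = 0"
      using K(2)[of x] L(2)[of "y + x"] DI[of "y + x" x] by auto
  qed (use K in simp)
  also have "\<dots> = (\<integral>y. \<integral>x. f (- y + x) * g x \<partial>M \<partial>M)"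
  proof (rule Bochner_Integration.integral_cong[OF refl])
    fix y
    have "(\<lambda>x. f x * g (y + x)) \<in> borel_measurable M"
      by (intro Cc_measurable Cc_mult_continuous f Cc_continuous Cc_translate_left g)
    then show "(\<integral>x. f x * g (y + x) \<partial>M) = (\<integral>x. f (- y + x) * g x \<partial>M)"
      using integral_translate_left[of "\<lambda>x. f x * g (y + x)" "- y"] by (simp flip: add.assoc)
  qed
  also have "\<dots> = (\<integral>x. \<integral>y. f (- y + x) * g x \<partial>M \<partial>M)"
  proof (rule Fubini_compact_support[OF c2 D L(1)])
    fix x y assume "y \<notin> D"
    then have "x \<notin> L \<or> - y + x \<notin> K"
      using DI[of x "- y + x"] by (auto simp: diff_conv_add_uminus minus_add add.assoc)
    then show "f (- y + x) * g x = 0"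
      using K(2)[of "- y + x"] L(2)[of x] by auto
  qed (use L in simp)
  also have "\<dots> = (\<integral>x. (\<integral>y. f (- y) \<partial>M) * g x \<partial>M)"
  proof (rule Bochner_Integration.integral_cong[OF refl])
    fix x
    have "(\<lambda>y. f (- y + x)) \<in> borel_measurable M"
      by (rule Cc_measurable[OF Cc_uminus[OF Cc_translate_right[OF f]]])
    then have "(\<integral>y. f (- y + x) \<partial>M) = (\<integral>y. f (- (x + y) + x) \<partial>M)"
      by (simp add: integral_translate_left[of "\<lambda>y. f (- y + x)" x])
    then show "(\<integral>y. f (- y + x) * g x \<partial>M) = (\<integral>y. f (- y) \<partial>M) * g x"
      by (simp add: minus_add add.assoc)
  qed
  finally show ?thesis by (simp add: mult.commute)
qed

text \<open>The product identity is divided by the integral of a bump function. Inner regularity of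
  the whole group yields a compact set of positive measure, which makes that integral
  nonzero.\<close>

lemma Cc_integral_uminus:
  assumes f: "f \<in> Cc"
  shows "(\<integral>x. f (- x) \<partial>M) = (\<integral>x. f x \<partial>M)"
proof -
  have "emeasure M UNIV \<noteq> 0" using haar unfolding left_haar_measure_def by blast
  then have "(SUP K\<in>{K. compact K \<and> K \<subseteq> UNIV}. emeasure M K) \<noteq> 0"
    using inner_regular[of UNIV] by simp
  then have "\<exists>K. compact K \<and> emeasure M K \<noteq> 0"
    by (metis (mono_tags, lifting) SUP_eq_const compact_empty emeasure_empty empty_subsetI mem_Collect_eq
        equals0D)
  then obtain K where K: "compact K" "emeasure M K \<noteq> 0" by blast
  obtain \<phi> :: "'g \<Rightarrow> real" where \<phi>: "(\<lambda>x. complex_of_real (\<phi> x)) \<in> Cc" "\<And>x. 0 \<le> \<phi> x"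
      "\<And>x. x \<in> K \<Longrightarrow> \<phi> x = 1"
    using bump_function[OF K(1) open_UNIV subset_UNIV] by metis
  have int: "integrable M \<phi>"
    using integrable_Re[OF Cc_integrable[OF \<phi>(1)]] by simp
  have "0 < measure M K"
    using K emeasure_compact_finite[OF K(1)]
    by (metis emeasure_eq_ennreal_measure ennreal_0 infinity_ennreal_def less_irrefl linorder_neqE measure_nonneg not_le)
  also have "measure M K = (\<integral>x. indicator K x \<partial>M)" using K by simp
  also have "\<dots> \<le> (\<integral>x. \<phi> x \<partial>M)"
  proof (rule integral_mono[OF _ int])
    show "integrable M (indicator K :: 'g \<Rightarrow> real)"
      using K(1) emeasure_compact_finite[OF K(1)] by (intro integrable_real_indicator) auto
  qed (use \<phi> in \<open>auto simp: indicator_def\<close>)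
  finally have "(\<integral>x. complex_of_real (\<phi> x) \<partial>M) \<noteq> 0" by simp
  then show ?thesis
    using Cc_integral_uminus_product[OF f \<phi>(1)] by (simp add: mult.commute)
qed

section \<open>Invariance of the Haar measure under inversion\<close>

lemma uminus_image_eq_vimage: "uminus ` A = uminus -` A" for A :: "'h::group_add set"
proof (intro equalityI subsetI)
  fix x assume "x \<in> uminus -` A"
  then show "x \<in> uminus ` A" by (intro rev_image_eqI[of "- x"]) auto
qed auto

text \<open>A bump function between the indicators of \<open>K\<close> and \<open>U\<close> carries
  the invariance from integrals over C_c to measures; inner regularity then exhausts
  \<open>U\<close> by such \<open>K\<close>.\<close>

lemma emeasure_uminus_open_le:
  assumes U: "open U"
  shows "emeasure M U \<le> emeasure M (uminus ` U)"
  unfolding inner_regular[OF U]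
proof (rule SUP_least)
  fix K assume "K \<in> {K. compact K \<and> K \<subseteq> U}"
  then have K: "compact K" "K \<subseteq> U" by auto
  have uU: "uminus ` U = uminus -` U" by (rule uminus_image_eq_vimage)
  have "open (uminus -` U)"
    by (rule open_vimage[OF U]) (intro continuous_intros)
  then have [measurable, simp]: "uminus -` U \<in> sets borel" by simp
  obtain \<phi> :: "'g \<Rightarrow> real" where \<phi>: "(\<lambda>x. complex_of_real (\<phi> x)) \<in> Cc" "\<And>x. 0 \<le> \<phi> x" "\<And>x. \<phi> x \<le> 1"
      "\<And>x. x \<in> K \<Longrightarrow> \<phi> x = 1" "\<And>x. x \<notin> U \<Longrightarrow> \<phi> x = 0"
    using bump_function[OF K(1) U K(2)] by metis
  have int: "integrable M \<phi>" using integrable_Re[OF Cc_integrable[OF \<phi>(1)]] by simp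
  have int': "integrable M (\<lambda>x. \<phi> (- x))" using integrable_Re[OF Cc_integrable[OF Cc_uminus[OF \<phi>(1)]]] by simp
  have "emeasure M K = (\<integral>\<^sup>+x. indicator K x \<partial>M)" using K by simp
  also have "\<dots> \<le> (\<integral>\<^sup>+x. ennreal (\<phi> x) \<partial>M)"
    by (intro nn_integral_mono) (use \<phi> in \<open>auto simp: indicator_def\<close>)
  also have "\<dots> = ennreal (\<integral>x. \<phi> x \<partial>M)"
    by (rule nn_integral_eq_integral) (use int \<phi> in auto)
  also have "(\<integral>x. \<phi> x \<partial>M) = (\<integral>x. \<phi> (- x) \<partial>M)"
    using Cc_integral_uminus[OF \<phi>(1)] by simp
  also have "ennreal \<dots> = (\<integral>\<^sup>+x. ennreal (\<phi> (- x)) \<partial>M)"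
    by (rule nn_integral_eq_integral[symmetric]) (use int' \<phi> in auto)
  also have "\<dots> \<le> (\<integral>\<^sup>+x. indicator (uminus -` U) x \<partial>M)"
    by (intro nn_integral_mono) (use \<phi> in \<open>auto simp: indicator_def\<close>)
  also have "\<dots> = emeasure M (uminus ` U)" by (simp add: uU)
  finally show "emeasure M K \<le> emeasure M (uminus ` U)" .
qed

lemma uminus_image_uminus: "uminus ` uminus ` A = A" for A :: "'h::group_add set"
  by (simp add: image_image)

lemma open_uminus: "open U \<Longrightarrow> open (uminus ` U)" for U :: "'g set"
  unfolding uminus_image_eq_vimage by (rule open_vimage) (auto intro: continuous_intros)

lemma borel_uminus: "A \<in> sets borel \<Longrightarrow> uminus ` A \<in> sets borel" for A :: "'g set"
  using measurable_sets_borel[OF borel_measurable_continuous_onI[OF continuous_on_minus[OF continuous_on_id]], of A]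
  by (simp add: uminus_image_eq_vimage)

lemma emeasure_uminus_le:
  assumes A: "A \<in> sets borel"
  shows "emeasure M (uminus ` A) \<le> emeasure M A"
  unfolding outer_regular[OF A]
proof (rule INF_greatest)
  fix U assume "U \<in> {U. open U \<and> A \<subseteq> U}"
  then have U: "open U" "A \<subseteq> U" by auto
  have "emeasure M (uminus ` A) \<le> emeasure M (uminus ` U)"
    by (intro emeasure_mono image_mono U) (simp add: borel_uminus borel_open U)
  also have "\<dots> \<le> emeasure M U"
    using emeasure_uminus_open_le[OF open_uminus[OF U(1)]] by (simp only: uminus_image_uminus)
  finally show "emeasure M (uminus ` A) \<le> emeasure M U" .
qed

lemma emeasure_uminus:
  assumes A: "A \<in> sets borel"
  shows "emeasure M (uminus ` A) = emeasure M A"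
  using emeasure_uminus_le[OF A] emeasure_uminus_le[OF borel_uminus[OF A]]
  by (simp only: uminus_image_uminus order_antisym)

lemma distr_uminus: "distr M M uminus = M"
  by (rule distr_homeo[where g=uminus]) (auto intro!: continuous_intros simp: emeasure_uminus)

lemma integral_uminus:
  fixes f :: "'g \<Rightarrow> 'b::{banach, second_countable_topology}"
  assumes "f \<in> borel_measurable M"
  shows "(\<integral>x. f (- x) \<partial>M) = (\<integral>x. f x \<partial>M)"
  using integral_distr[OF measurable_homeo[of uminus] assms] distr_uminus
  by (simp add: continuous_intros)

end

section \<open>Density of compactly supported functions\<close>

lemma nn_integral_lp_fun:
  assumes "f \<in> lp_fun M p"
  shows "(\<integral>\<^sup>+x. ennreal (norm (f x) powr p) \<partial>M) = ennreal (\<integral>x. norm (f x) powr p \<partial>M)"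
  by (rule nn_integral_eq_integral[OF lp_fun_integrable[OF assms]]) simp

text \<open>Fatou's lemma for the p-th powers. It serves to extend convolution beyond C_c: there the
  limit function is known pointwise, and only its membership and norm bound remain to be
  obtained.\<close>

lemma lp_Fatou:
  assumes p: "1 \<le> p" and u: "\<And>n. u n \<in> lp_fun M p"
    and lim: "\<And>x. x \<in> space M \<Longrightarrow> (\<lambda>n. u n x) \<longlonglongrightarrow> f x"
    and c: "\<And>n. lp_norm M p (u n) \<le> c n" "c \<longlonglongrightarrow> C"
  shows "f \<in> lp_fun M p" "lp_norm M p f \<le> C"
proof -
  have [measurable]: "u n \<in> borel_measurable M" for n using lp_fun_measurable[OF u] .
  have f [measurable]: "f \<in> borel_measurable M"
    by (rule borel_measurable_LIMSEQ_metric[of u]) (use lim in auto)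
  have c0: "0 \<le> c n" for n using c(1)[of n] lp_norm_nonneg[of M p "u n"] by linarith
  have C0: "0 \<le> C" by (rule LIMSEQ_le_const[OF c(2)]) (use c0 in auto)
  have "(\<integral>\<^sup>+x. ennreal (norm (f x) powr p) \<partial>M) = (\<integral>\<^sup>+x. liminf (\<lambda>n. ennreal (norm (u n x) powr p)) \<partial>M)"
  proof (rule nn_integral_cong)
    fix x assume "x \<in> space M"
    then have "(\<lambda>n. norm (u n x)) \<longlonglongrightarrow> norm (f x)" by (intro tendsto_norm lim)
    then have "(\<lambda>n. ennreal (norm (u n x) powr p)) \<longlonglongrightarrow> ennreal (norm (f x) powr p)"
      by (intro tendsto_ennrealI tendsto_powr') (use p in auto)
    then show "ennreal (norm (f x) powr p) = liminf (\<lambda>n. ennreal (norm (u n x) powr p))"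
      by (intro lim_imp_Liminf[symmetric]) auto
  qed
  also have "\<dots> \<le> liminf (\<lambda>n. \<integral>\<^sup>+x. ennreal (norm (u n x) powr p) \<partial>M)"
    by (rule nn_integral_liminf) simp
  also have "\<dots> \<le> liminf (\<lambda>n. ennreal (c n powr p))"
  proof (rule Liminf_mono[OF always_eventually], rule allI)
    fix n
    have "lp_norm M p (u n) powr p \<le> c n powr p"
      using c(1)[of n] p by (intro powr_mono2) auto
    then show "(\<integral>\<^sup>+x. ennreal (norm (u n x) powr p) \<partial>M) \<le> ennreal (c n powr p)"
      unfolding nn_integral_lp_fun[OF u] by (simp add: lp_norm_powr[OF p] ennreal_leI)
  qed
  also have "\<dots> = ennreal (C powr p)"
    by (rule lim_imp_Liminf) (use c p c0 in \<open>auto intro!: tendsto_ennrealI tendsto_powr'\<close>)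
  finally have le: "(\<integral>\<^sup>+x. ennreal (norm (f x) powr p) \<partial>M) \<le> ennreal (C powr p)" .
  have "integrable M (\<lambda>x. norm (f x) powr p)"
    by (rule integrableI_nonneg) (use le in \<open>auto simp: le_less_trans\<close>)
  then show f': "f \<in> lp_fun M p" by (intro lp_funI f)
  show "lp_norm M p f \<le> C"
    by (rule lp_norm_le[OF p C0]) (use le in \<open>simp add: nn_integral_lp_fun[OF f'] \<close>)
qed

context unimodular_haar
begin

text \<open>Outer regularity gives an open \<open>U\<close> slightly larger than \<open>A\<close>,
  inner regularity a compact \<open>K\<close> inside \<open>U\<close> of nearly the same measure;
  \<open>K\<close> need not lie in \<open>A\<close>. A bump function for K and U differs from the
  indicator of \<open>A\<close> only where one of U - A and U - K is hit.\<close>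

lemma indicator_approx:
  assumes A: "A \<in> sets borel" "emeasure M A < \<infinity>" and p: "1 \<le> p" and e: "0 < e"
  shows "\<exists>k\<in>Cc. lp_norm M p (\<lambda>x. indicator A x - k x) < e"
proof -
  \<comment> \<open>Two errors below \<eta> add up to less than half of e^p, and the p-th root of
    1/2 turns this into a strict bound by e.\<close>
  define \<eta> where "\<eta> = e powr p / 4"
  have \<eta>: "0 < \<eta>" using e by (simp add: \<eta>_def)
  have eA: "emeasure M A = ennreal (measure M A)"
    using A by (intro emeasure_eq_ennreal_measure) auto
  have "(INF U\<in>{U. open U \<and> A \<subseteq> U}. emeasure M U) < ennreal (measure M A + \<eta>)"
    unfolding outer_regular[OF A(1), symmetric] eA using \<eta> by (intro ennreal_lessI) (auto intro: add_nonneg_pos)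
  then obtain U where U: "open U" "A \<subseteq> U" "emeasure M U < ennreal (measure M A + \<eta>)"
    unfolding INF_less_iff by blast
  then have Ufin: "emeasure M U < \<infinity>" using ennreal_less_top less_trans by fastforce
  then have eU: "emeasure M U = ennreal (measure M U)"
    by (intro emeasure_eq_ennreal_measure) auto
  have mU: "measure M U < measure M A + \<eta>"
    using U(3) unfolding eU by (simp add: ennreal_less_iff)
  have "\<exists>K. compact K \<and> K \<subseteq> U \<and> measure M U - \<eta> < measure M K"
  proof (cases "measure M U < \<eta>")
    case True
    then show ?thesis by (intro exI[of _ "{}"]) auto
  next
    case False
    then have "ennreal (measure M U - \<eta>) < (SUP K\<in>{K. compact K \<and> K \<subseteq> U}. emeasure M K)"
      unfolding inner_regular[OF U(1), symmetric] eU using \<eta> by (intro ennreal_lessI) auto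
    then obtain K where K: "compact K" "K \<subseteq> U" "ennreal (measure M U - \<eta>) < emeasure M K"
      unfolding less_SUP_iff by blast
    have "emeasure M K = ennreal (measure M K)"
      using emeasure_compact_finite[OF K(1)] by (intro emeasure_eq_ennreal_measure) auto
    then show ?thesis using K False by (auto simp: ennreal_less_iff)
  qed
  then obtain K where K: "compact K" "K \<subseteq> U" "measure M U - \<eta> < measure M K" by blast
  obtain \<phi> :: "'g \<Rightarrow> real" where \<phi>: "(\<lambda>x. complex_of_real (\<phi> x)) \<in> Cc" "\<And>x. 0 \<le> \<phi> x" "\<And>x. \<phi> x \<le> 1"
      "\<And>x. x \<in> K \<Longrightarrow> \<phi> x = 1" "\<And>x. x \<notin> U \<Longrightarrow> \<phi> x = 0"
    using bump_function[OF K(1) U(1) K(2)] by metis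
  have [measurable]: "A \<in> sets borel" "U \<in> sets borel" "K \<in> sets borel" using A U K by auto
  have [simp]: "A \<in> sets M" "U \<in> sets M" "K \<in> sets M" by simp_all
  have iU: "integrable M (indicator U :: 'g \<Rightarrow> real)" using Ufin by (intro integrable_real_indicator) auto
  have iA: "integrable M (indicator A :: 'g \<Rightarrow> real)" using A by (intro integrable_real_indicator) auto
  have iK: "integrable M (indicator K :: 'g \<Rightarrow> real)"
    using emeasure_compact_finite[OF K(1)] by (intro integrable_real_indicator) auto
  define g where "g x = (indicator A x :: complex) - complex_of_real (\<phi> x)" for x
  have [measurable]: "g \<in> borel_measurable M"
    unfolding g_def using Cc_measurable[OF \<phi>(1)] by simp
  have pw: "norm (g x) powr p \<le> (indicator U x - indicator A x) + (indicator U x - indicator K x)" for x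
  proof -
    have "norm (g x) \<le> 1"
    proof (cases "x \<in> A")
      case True
      then have "g x = complex_of_real (1 - \<phi> x)" by (simp add: g_def)
      then show ?thesis using \<phi>(2,3)[of x] by (simp only: norm_of_real)
    next
      case False
      then show ?thesis using \<phi>(2,3)[of x] by (simp add: g_def)
    qed
    then have "norm (g x) powr p \<le> 1 powr p" using p by (intro powr_mono2) auto
    moreover have "g x = 0" if "x \<in> A" "x \<in> K" using that \<phi>(4) by (simp add: g_def)
    moreover have "g x = 0" if "x \<notin> U" using that \<phi>(5) U(2) by (auto simp: g_def indicator_def)
    ultimately show ?thesis using K(2) U(2) by (auto simp: indicator_def)
  qed
  have "(\<integral>x. norm (g x) powr p \<partial>M)
      \<le> (\<integral>x. (indicator U x - indicator A x) + (indicator U x - indicator K x) \<partial>M)"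
  proof (rule integral_mono[OF _ _ pw])
    show "integrable M (\<lambda>x. norm (g x) powr p)"
    proof (rule Bochner_Integration.integrable_bound)
      show "integrable M (\<lambda>x. (indicator U x - indicator A x) + (indicator U x - indicator K x) :: real)"
        using iU iA iK by simp
      show "AE x in M. norm (norm (g x) powr p)
          \<le> norm ((indicator U x - indicator A x) + (indicator U x - indicator K x) :: real)"
        using order_trans[OF pw abs_ge_self] by (intro AE_I2) simp
    qed simp
  qed (use iU iA iK in auto)
  also have "\<dots> = (measure M U - measure M A) + (measure M U - measure M K)"
    using iU iA iK by simp
  also have "\<dots> \<le> e powr p / 2"
    using mU K(3) by (simp add: \<eta>_def)
  also have "\<dots> = (e / 2 powr (1 / p)) powr p"
    using e p by (simp add: powr_divide powr_powr)
  finally have "lp_norm M p g \<le> e / 2 powr (1 / p)"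
    using e p by (intro lp_norm_le) auto
  also have "\<dots> < e"
    using e p by (simp add: field_simps)
  finally have "lp_norm M p (\<lambda>x. indicator A x - complex_of_real (\<phi> x)) < e"
    by (simp add: g_def [abs_def])
  then show ?thesis using \<phi>(1) by (intro bexI[of _ "\<lambda>x. complex_of_real (\<phi> x)"])
qed

text \<open>The approximable functions contain the indicators of sets of finite measure and are
  closed under sums, hence contain the simple functions of L^p; dominated convergence reaches the
  rest.\<close>

theorem Cc_dense:
  assumes h: "h \<in> lp_fun M p" and p: "1 \<le> p" and e: "0 < e"
  shows "\<exists>k\<in>Cc. lp_norm M p (\<lambda>x. h x - k x) < e"
proof -
  have p0: "0 \<le> p" using p by simp
  have hm: "h \<in> borel_measurable M" by (rule lp_fun_measurable[OF h])
  define P where "P f \<longleftrightarrow> f \<in> lp_fun M p \<and> (\<forall>e>0. \<exists>k\<in>Cc. lp_norm M p (\<lambda>x. f x - k x) < e)" for f :: "'g \<Rightarrow> complex"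
  have P_zero: "P (\<lambda>x. 0)"
    by (auto simp: P_def intro!: bexI[of _ "\<lambda>x. 0"])
  have P_add: "P (\<lambda>x. f x + g x)" if "P f" "P g" for f g
    unfolding P_def
  proof (intro conjI allI impI)
    have fg: "f \<in> lp_fun M p" "g \<in> lp_fun M p" using that by (auto simp: P_def)
    then show "(\<lambda>x. f x + g x) \<in> lp_fun M p" by (intro lp_fun_add p0)
    fix e :: real assume "0 < e"
    then have "\<exists>k\<in>Cc. lp_norm M p (\<lambda>x. f x - k x) < e / 2" "\<exists>k\<in>Cc. lp_norm M p (\<lambda>x. g x - k x) < e / 2"
      using that half_gt_zero[of e] unfolding P_def by blast+
    then obtain k l where k: "k \<in> Cc" "lp_norm M p (\<lambda>x. f x - k x) < e / 2"
      and l: "l \<in> Cc" "lp_norm M p (\<lambda>x. g x - l x) < e / 2"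
      by blast
    have "lp_norm M p (\<lambda>x. (f x + g x) - (k x + l x)) = lp_norm M p (\<lambda>x. (f x - k x) + (g x - l x))"
      by (simp add: algebra_simps)
    also have "\<dots> \<le> lp_norm M p (\<lambda>x. f x - k x) + lp_norm M p (\<lambda>x. g x - l x)"
      by (intro Minkowski_lp_norm lp_fun_diff fg Cc_in_lp_fun k l p p0)
    also have "\<dots> < e" using k l by simp
    finally show "\<exists>k\<in>Cc. lp_norm M p (\<lambda>x. f x + g x - k x) < e"
      using Cc_add[OF k(1) l(1)] by (intro bexI[of _ "\<lambda>x. k x + l x"])
  qed
  have P_scale: "P (\<lambda>x. indicator A x *\<^sub>R y)" if A: "A \<in> sets borel" "emeasure M A < \<infinity>" for A and y :: complex
    unfolding P_def
  proof (intro conjI allI impI)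
    have "(indicator A :: 'g \<Rightarrow> complex) \<in> lp_fun M p"
    proof (rule lp_funI)
      have "integrable M (indicator A :: 'g \<Rightarrow> real)" using A by (intro integrable_real_indicator) auto
      moreover have "(\<lambda>x. norm (indicator A x :: complex) powr p) = indicator A"
        using p by (auto simp: indicator_def)
      ultimately show "integrable M (\<lambda>x. norm (indicator A x :: complex) powr p)" by simp
    qed (use A in simp)
    from lp_fun_scale[OF this, of y]
    show "(\<lambda>x. indicator A x *\<^sub>R y) \<in> lp_fun M p"
      by (rule back_subst[where P="\<lambda>f. f \<in> lp_fun M p"]) (auto simp: fun_eq_iff indicator_def)
    fix e :: real assume e: "0 < e"
    then have "0 < e / (norm y + 1)" by (simp add: add_nonneg_pos)
    then obtain k where k: "k \<in> Cc" "lp_norm M p (\<lambda>x. indicator A x - k x) < e / (norm y + 1)"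
      using indicator_approx[OF A p] by blast
    have "lp_norm M p (\<lambda>x. indicator A x *\<^sub>R y - y * k x) = norm y * lp_norm M p (\<lambda>x. indicator A x - k x)"
      unfolding lp_norm_scale[OF p, symmetric]
      by (rule arg_cong[where f="lp_norm M p"]) (auto simp: fun_eq_iff indicator_def algebra_simps)
    also have "\<dots> \<le> (norm y + 1) * lp_norm M p (\<lambda>x. indicator A x - k x)"
      by (intro mult_right_mono) auto
    also have "\<dots> < (norm y + 1) * (e / (norm y + 1))"
      using k(2) by (intro mult_strict_left_mono) (auto simp: add_nonneg_pos)
    also have "\<dots> = e" using norm_ge_zero[of y] by (simp add: add_nonneg_eq_0_iff)
    finally show "\<exists>k\<in>Cc. lp_norm M p (\<lambda>x. indicator A x *\<^sub>R y - k x) < e"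
      using Cc_scale[OF k(1)] by (intro bexI[of _ "\<lambda>x. y * k x"])
  qed
  have P_simple: "P s" if s: "simple_function M s" "s \<in> lp_fun M p" for s
  proof -
    \<comment> \<open>Chebyshev: on the level set of a nonzero value y, the p-th power of s divided
      by that of y equals 1. The value 0 contributes nothing to the sum below.\<close>
    have fin: "emeasure M (s -` {y}) < \<infinity>" if "y \<noteq> 0" for y
    proof -
      have [measurable]: "s -` {y} \<in> sets borel"
        using simple_functionD(2)[OF s(1), of "{y}"] by simp
      have "integrable M (\<lambda>x. norm (s x) powr p / norm y powr p)"
        using lp_fun_integrable[OF s(2)] by simp
      then have "integrable M (\<lambda>x. indicator (s -` {y}) x :: real)"
      proof (rule Bochner_Integration.integrable_bound)
        show "AE x in M. norm (indicator (s -` {y}) x :: real) \<le> norm (norm (s x) powr p / norm y powr p)"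
          using that by (intro AE_I2) (auto simp: indicator_def)
      qed simp
      then show ?thesis by (simp add: integrable_indicator_iff)
    qed
    have sum: "P (\<lambda>x. \<Sum>y\<in>Y. indicator (s -` {y}) x *\<^sub>R y)" if "finite Y" for Y
      using that
    proof (induction Y)
      case (insert y Y)
      have "P (\<lambda>x. indicator (s -` {y}) x *\<^sub>R y)"
      proof (cases "y = 0")
        case False
        show ?thesis
          by (rule P_scale[OF _ fin[OF False]]) (use simple_functionD(2)[OF s(1), of "{y}"] in simp)
      qed (use P_zero in simp)
      from P_add[OF this insert.IH] show ?case
        by (simp only: sum.insert[OF insert.hyps])
    qed (use P_zero in simp)
    have s_eq: "s = (\<lambda>x. \<Sum>y\<in>range s. indicator (s -` {y}) x *\<^sub>R y)"
    proof
      fix x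
      have "s x = (\<Sum>y\<in>s ` space M. indicator (s -` {y} \<inter> space M) x *\<^sub>R y)"
        by (rule simple_function_indicator_representation_banach[OF s(1)]) simp
      then show "s x = (\<Sum>y\<in>range s. indicator (s -` {y}) x *\<^sub>R y)"
        by (simp only: space_haar Int_UNIV_right)
    qed
    have "finite (range s)" using simple_functionD(1)[OF s(1)] by simp
    from sum[OF this] show ?thesis by (simp only: s_eq[symmetric])
  qed
  \<comment> \<open>The factor 2 in the bound on \<open>F i\<close> is the origin of the majorant
    \<open>3 * h x\<close> below.\<close>
  obtain F where F: "\<And>i. simple_function M (F i)" "\<And>x. (\<lambda>i. F i x) \<longlonglongrightarrow> h x"
      "\<And>i x. dist (F i x) 0 \<le> 2 * dist (h x) 0"
    using borel_measurable_implies_sequence_metric[OF hm, of 0] by auto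
  have Fm: "F i \<in> borel_measurable M" for i using F(1) by (rule borel_measurable_simple_function)
  have Flp: "F i \<in> lp_fun M p" for i
    by (rule lp_fun_bound[OF lp_fun_scale[OF h, of 2] p0 Fm]) (use F(3) in \<open>auto simp: norm_mult\<close>)
  have "(\<lambda>i. \<integral>x. norm (h x - F i x) powr p \<partial>M) \<longlonglongrightarrow> (\<integral>x. 0 \<partial>M)"
  proof (rule integral_dominated_convergence)
    show "integrable M (\<lambda>x. norm (3 * h x) powr p)"
      by (rule lp_fun_integrable[OF lp_fun_scale[OF h]])
    show "AE x in M. (\<lambda>i. norm (h x - F i x) powr p) \<longlonglongrightarrow> 0"
    proof (rule AE_I2)
      fix x
      have "(\<lambda>i. norm (h x - F i x)) \<longlonglongrightarrow> norm (h x - h x)" by (intro tendsto_intros F)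
      then have "(\<lambda>i. norm (h x - F i x) powr p) \<longlonglongrightarrow> norm (h x - h x) powr p"
        by (rule tendsto_powr') (use p in auto)
      then show "(\<lambda>i. norm (h x - F i x) powr p) \<longlonglongrightarrow> 0" by simp
    qed
    show "AE x in M. norm (norm (h x - F i x) powr p) \<le> norm (3 * h x) powr p" for i
    proof (rule AE_I2)
      fix x
      have "norm (h x - F i x) \<le> norm (3 * h x)"
        using norm_triangle_ineq4[of "h x" "F i x"] F(3)[of i x] by (simp add: norm_mult)
      then show "norm (norm (h x - F i x) powr p) \<le> norm (3 * h x) powr p"
        using p by (auto intro!: powr_mono2)
    qed
  qed (use hm Fm in auto)
  then have "(\<lambda>i. \<integral>x. norm (h x - F i x) powr p \<partial>M) \<longlonglongrightarrow> 0" by simp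
  then have "eventually (\<lambda>i. (\<integral>x. norm (h x - F i x) powr p \<partial>M) < (e / 2) powr p) sequentially"
    by (rule order_tendstoD) (use e in simp)
  then obtain i where i: "(\<integral>x. norm (h x - F i x) powr p \<partial>M) < (e / 2) powr p"
    using eventually_happens'[OF sequentially_bot] by blast
  then have 1: "lp_norm M p (\<lambda>x. h x - F i x) \<le> e / 2"
    by (intro lp_norm_le p) (use e in auto)
  obtain k where k: "k \<in> Cc" "lp_norm M p (\<lambda>x. F i x - k x) < e / 2"
    using P_simple[OF F(1) Flp, of i] e half_gt_zero[of e] unfolding P_def by blast
  have "lp_norm M p (\<lambda>x. h x - k x) < e"
    using lp_norm_dist_triangle[OF h Flp[of i] Cc_in_lp_fun[OF k(1) p0] p] 1 k(2) by simp
  then show ?thesis using k(1) by blast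
qed

end

section \<open>Convolution\<close>

definition conj_exp :: "real \<Rightarrow> real" where
  "conj_exp p = p / (p - 1)"

lemma conj_exp:
  assumes "1 < p"
  shows "1 < conj_exp p" "1 / p + 1 / conj_exp p = 1" "(p - 1) * conj_exp p = p"
    "conj_exp (conj_exp p) = p"
  using assms by (auto simp: conj_exp_def field_simps)

text \<open>The involution of the group algebra. No modular function appears, since the group is
  unimodular wherever adjoints are taken.\<close>

definition star :: "('g::group_add \<Rightarrow> complex) \<Rightarrow> 'g \<Rightarrow> complex" where
  "star f = (\<lambda>x. cnj (f (- x)))"

lemma star_star [simp]: "star (star f) = f"
  by (simp add: star_def)

lemma star_Cc: "f \<in> Cc \<Longrightarrow> star f \<in> Cc"
  for f :: "'g::{topological_group_add, t2_space} \<Rightarrow> complex"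
  unfolding star_def by (intro Cc_cnj Cc_uminus)

context unimodular_haar
begin

section \<open>Reflections and the pointwise theory of convolution\<close>

lemma measurable_compose_homeo:
  fixes f :: "'g \<Rightarrow> 'b::topological_space"
  assumes "f \<in> borel_measurable M" "continuous_on UNIV \<phi>"
  shows "(\<lambda>x. f (\<phi> x)) \<in> borel_measurable M"
  by (rule measurable_compose[OF measurable_homeo[OF assms(2)] assms(1)])

text \<open>Inversion followed by a translation, both measure preserving. This is the substitution
  that occurs inside every convolution integral.\<close>

lemma distr_reflect: "distr M M (\<lambda>t. - t + s) = M"
proof (rule distr_homeo[where g="\<lambda>t. s - t"])
  fix A :: "'g set" assume A: "A \<in> sets borel"
  have "(\<lambda>t. s - t) ` A = (+) s ` uminus ` A"
    by (simp add: image_image)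
  also have "emeasure M \<dots> = emeasure M (uminus ` A)"
    using haar borel_uminus[OF A] unfolding left_haar_measure_def by blast
  finally show "emeasure M ((\<lambda>t. s - t) ` A) = emeasure M A"
    using emeasure_uminus[OF A] by simp
next
  show "- (s - x) + s = x" for x by (simp add: minus_diff_eq)
  show "s - (- x + s) = x" for x
    by (metis add.assoc add.right_neutral diff_conv_add_uminus minus_add minus_minus right_minus)
qed (intro continuous_intros)

lemma continuous_reflect: "continuous_on UNIV (\<lambda>t. - t + s)" for s :: 'g
  by (intro continuous_intros)

lemma integral_reflect:
  fixes f :: "'g \<Rightarrow> 'b::{banach, second_countable_topology}"
  assumes "f \<in> borel_measurable M"
  shows "(\<integral>t. f (- t + s) \<partial>M) = (\<integral>t. f t \<partial>M)"
  using integral_distr[OF measurable_homeo[OF continuous_reflect] assms, of s] distr_reflect[of s] by simp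

lemma lp_fun_reflect:
  assumes "h \<in> lp_fun M p"
  shows "(\<lambda>t. h (- t + s)) \<in> lp_fun M p"
proof (rule lp_funI)
  have m: "(\<lambda>x. norm (h x) powr p) \<in> borel_measurable M"
    using lp_fun_measurable[OF assms] by simp
  show "(\<lambda>t. h (- t + s)) \<in> borel_measurable M"
    by (rule measurable_compose_homeo[OF lp_fun_measurable[OF assms] continuous_reflect])
  show "integrable M (\<lambda>t. norm (h (- t + s)) powr p)"
    using integrable_distr_eq[OF measurable_homeo[OF continuous_reflect] m, of s]
      lp_fun_integrable[OF assms] distr_reflect[of s] by simp
qed

lemma lp_norm_reflect:
  assumes "h \<in> lp_fun M p"
  shows "lp_norm M p (\<lambda>t. h (- t + s)) = lp_norm M p h"
  using integral_reflect[of "\<lambda>x. norm (h x) powr p" s] lp_fun_measurable[OF assms]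
  by (simp add: lp_norm_def)

lemma AE_reflect:
  assumes "AE x in M. P x"
  shows "AE t in M. P (- t + s)"
proof (rule AE_distrD[OF measurable_homeo[OF continuous_reflect]])
  show "AE x in distr M M (\<lambda>t. - t + s). P x"
    unfolding distr_reflect by (rule assms)
qed

text \<open>Hoelder in t, the reflection preserving the norm of h. The convolution thus exists at
  every s, not merely almost everywhere, with a bound uniform in s.\<close>

lemma convol_integrable:
  assumes f: "f \<in> Cc" and h: "h \<in> lp_fun M p" and p: "1 < p"
  shows "integrable M (\<lambda>t. f t * h (- t + s))"
    and "norm (convol M f h s) \<le> lp_norm M (conj_exp p) f * lp_norm M p h"
proof -
  let ?q = "conj_exp p"
  note q = conj_exp[OF p]
  have f': "f \<in> lp_fun M ?q" using q by (intro Cc_in_lp_fun f) simp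
  have pq: "1 / ?q + 1 / p = 1" using q(2) by simp
  note H = Hoelder_lp_norm[OF f' lp_fun_reflect[OF h, of s] q(1) p pq]
  have "(\<lambda>t. f t * h (- t + s)) \<in> borel_measurable M"
    using Cc_measurable[OF f] lp_fun_measurable[OF lp_fun_reflect[OF h]] by simp
  then show int: "integrable M (\<lambda>t. f t * h (- t + s))"
    using H(1) by (simp add: integrable_norm_iff norm_mult flip: integrable_norm_iff)
  have "norm (convol M f h s) \<le> (\<integral>t. norm (f t * h (- t + s)) \<partial>M)"
    unfolding convol_def by (rule integral_norm_bound)
  also have "\<dots> \<le> lp_norm M ?q f * lp_norm M p h"
    using H(2) by (simp add: norm_mult lp_norm_reflect[OF h])
  finally show "norm (convol M f h s) \<le> lp_norm M ?q f * lp_norm M p h" .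
qed

lemma convol_diff_right:
  assumes "f \<in> Cc" "h \<in> lp_fun M p" "k \<in> lp_fun M p" "1 < p"
  shows "convol M f (\<lambda>x. h x - k x) = (\<lambda>s. convol M f h s - convol M f k s)"
  using convol_integrable(1)[OF assms(1,2,4)] convol_integrable(1)[OF assms(1,3,4)]
  by (simp add: convol_def right_diff_distrib fun_eq_iff)

lemma convol_add_right:
  assumes "f \<in> Cc" "h \<in> lp_fun M p" "k \<in> lp_fun M p" "1 < p"
  shows "convol M f (\<lambda>x. h x + k x) = (\<lambda>s. convol M f h s + convol M f k s)"
  using convol_integrable(1)[OF assms(1,2,4)] convol_integrable(1)[OF assms(1,3,4)]
  by (simp add: convol_def distrib_left fun_eq_iff)

lemma convol_add_left:
  assumes "f \<in> Cc" "g \<in> Cc" "h \<in> lp_fun M p" "1 < p"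
  shows "convol M (\<lambda>x. f x + g x) h = (\<lambda>s. convol M f h s + convol M g h s)"
  using convol_integrable(1)[OF assms(1,3,4)] convol_integrable(1)[OF assms(2,3,4)]
  by (simp add: convol_def distrib_right fun_eq_iff)

lemma convol_scale_right: "convol M f (\<lambda>x. c * h x) = (\<lambda>s. c * convol M f h s)"
  by (simp add: convol_def fun_eq_iff mult.left_commute)

lemma convol_scale_left: "convol M (\<lambda>x. c * f x) h = (\<lambda>s. c * convol M f h s)"
  by (simp add: convol_def fun_eq_iff mult.assoc)

lemma convol_cong_AE:
  assumes "f \<in> borel_measurable M" "h \<in> borel_measurable M" "k \<in> borel_measurable M" "AE x in M. h x = k x"
  shows "convol M f h = convol M f k"
proof
  fix s
  have [measurable]: "(\<lambda>t. h (- t + s)) \<in> borel_measurable M" "(\<lambda>t. k (- t + s)) \<in> borel_measurable M"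
    by (rule measurable_compose_homeo[OF assms(2) continuous_reflect]
          measurable_compose_homeo[OF assms(3) continuous_reflect])+
  show "convol M f h s = convol M f k s"
    unfolding convol_def
    by (rule integral_cong_AE) (use assms(1) AE_reflect[OF assms(4), of s] in auto)
qed

section \<open>The convolution algebra on C_c and its adjoints\<close>

lemma convol_Cc:
  assumes f: "f \<in> Cc" and h: "h \<in> Cc"
  shows "convol M f h \<in> Cc"
proof -
  obtain K where K: "compact K" "\<And>x. x \<notin> K \<Longrightarrow> f x = 0" using Cc_supportE[OF f] by metis
  obtain L where L: "compact L" "\<And>x. x \<notin> L \<Longrightarrow> h x = 0" using Cc_supportE[OF h] by metis
  define D where "D = (\<lambda>z. fst z + snd z) ` (K \<times> L)"
  have D: "compact D" unfolding D_def
    by (rule compact_continuous_image) (intro continuous_intros compact_Times K L)+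
  have c: "continuous_on UNIV (\<lambda>z. f (snd z) * h (- snd z + fst z))"
    by (intro continuous_on_mult continuous_on_compose_UNIV[OF Cc_continuous[OF f]]
        continuous_on_compose_UNIV[OF Cc_continuous[OF h]] continuous_intros)
  have "continuous_on UNIV (convol M f h)"
    unfolding convol_def
    by (rule continuous_on_parametric_integral[OF c K(1)]) (use K in simp)
  then show ?thesis
  proof (rule CcI[OF _ D])
    fix s assume s: "s \<notin> D"
    have "f t * h (- t + s) = 0" for t
    proof (rule ccontr)
      assume "f t * h (- t + s) \<noteq> 0"
      then have "t \<in> K" "- t + s \<in> L" using K(2)[of t] L(2)[of "- t + s"] by auto
      then have "t + (- t + s) \<in> D" unfolding D_def by force
      then show False using s by (simp flip: add.assoc)
    qed
    then show "convol M f h s = 0" by (simp only: convol_def Bochner_Integration.integral_zero)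
  qed
qed

text \<open>Fubini, followed by the left translation of u by t.\<close>

lemma convol_assoc:
  assumes f: "f \<in> Cc" and g: "g \<in> Cc" and h: "h \<in> Cc"
  shows "convol M (convol M f g) h = convol M f (convol M g h)"
proof
  fix s
  note fc = Cc_continuous[OF f] and gc = Cc_continuous[OF g] and hc = Cc_continuous[OF h]
  obtain K where K: "compact K" "\<And>x. x \<notin> K \<Longrightarrow> f x = 0" using Cc_supportE[OF f] by metis
  obtain L where L: "compact L" "\<And>x. x \<notin> L \<Longrightarrow> h x = 0" using Cc_supportE[OF h] by metis
  define D where "D = (\<lambda>x. s - x) ` L"
  have D: "compact D" unfolding D_def
    by (rule compact_continuous_image) (intro continuous_intros L)+
  have c: "continuous_on UNIV (\<lambda>z. f (snd z) * g (- snd z + fst z) * h (- fst z + s))"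
    by (intro continuous_on_mult continuous_on_compose_UNIV[OF fc]
        continuous_on_compose_UNIV[OF gc] continuous_on_compose_UNIV[OF hc] continuous_intros)
  have "convol M (convol M f g) h s = (\<integral>u. \<integral>t. f t * g (- t + u) * h (- u + s) \<partial>M \<partial>M)"
    by (simp add: convol_def)
  also have "\<dots> = (\<integral>t. \<integral>u. f t * g (- t + u) * h (- u + s) \<partial>M \<partial>M)"
  proof (rule Fubini_compact_support[OF c D K(1)])
    fix u t assume u: "u \<notin> D"
    have "- u + s \<notin> L"
    proof
      assume "- u + s \<in> L"
      then have "s - (- u + s) \<in> D" by (auto simp: D_def)
      moreover have "s - (- u + s) = u"
        by (metis add.assoc add.right_neutral diff_conv_add_uminus minus_add minus_minus right_minus)
      ultimately show False using u by simp
    qed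
    then show "f t * g (- t + u) * h (- u + s) = 0" using L(2) by simp
  qed (use K in simp)
  also have "\<dots> = (\<integral>t. f t * convol M g h (- t + s) \<partial>M)"
  proof (rule Bochner_Integration.integral_cong[OF refl])
    fix t
    have "(\<lambda>u. g (- t + u) * h (- u + s)) \<in> borel_measurable M"
      by (intro Cc_measurable Cc_mult_continuous Cc_translate_left g continuous_on_compose_UNIV[OF hc]
          continuous_intros)
    then have *: "(\<integral>u. g (- t + u) * h (- u + s) \<partial>M) = (\<integral>u. g (- t + (t + u)) * h (- (t + u) + s) \<partial>M)"
      by (rule integral_translate_left[symmetric])
    show "(\<integral>u. f t * g (- t + u) * h (- u + s) \<partial>M) = f t * convol M g h (- t + s)"
    proof -
      have "- t + (t + u) = u" "- (t + u) + s = - u + (- t + s)" for u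
        by (simp_all only: add.assoc[symmetric] left_minus add_0 minus_add)
      with * show ?thesis by (simp add: convol_def mult.assoc)
    qed
  qed
  finally show "convol M (convol M f g) h s = convol M f (convol M g h) s"
    by (simp add: convol_def)
qed

lemma Cc_pairing_integrable: "f \<in> Cc \<Longrightarrow> g \<in> Cc \<Longrightarrow> integrable M (\<lambda>x. f x * cnj (g x))"
  by (intro Cc_integrable Cc_mult_continuous Cc_continuous Cc_cnj)

text \<open>Interchanging the integrals isolates f; the left and the right adjoint identities are
  two readings of the inner integral.\<close>

lemma pairing_convol:
  assumes f: "f \<in> Cc" and g: "g \<in> Cc" and h: "h \<in> Cc"
  shows "(\<integral>s. convol M f g s * cnj (h s) \<partial>M) = (\<integral>t. f t * (\<integral>s. g (- t + s) * cnj (h s) \<partial>M) \<partial>M)"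
proof -
  note fc = Cc_continuous[OF f] and gc = Cc_continuous[OF g] and hc = Cc_continuous[OF h]
  obtain K where K: "compact K" "\<And>x. x \<notin> K \<Longrightarrow> f x = 0" using Cc_supportE[OF f] by metis
  obtain L where L: "compact L" "\<And>x. x \<notin> L \<Longrightarrow> h x = 0" using Cc_supportE[OF h] by metis
  have c: "continuous_on UNIV (\<lambda>z. f (snd z) * g (- snd z + fst z) * cnj (h (fst z)))"
    by (intro continuous_on_mult continuous_on_compose_UNIV[OF fc]
        continuous_on_compose_UNIV[OF gc] continuous_on_cnj continuous_on_compose_UNIV[OF hc] continuous_intros)
  have "(\<integral>s. convol M f g s * cnj (h s) \<partial>M) = (\<integral>s. \<integral>t. f t * g (- t + s) * cnj (h s) \<partial>M \<partial>M)"
    by (simp add: convol_def)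
  also have "\<dots> = (\<integral>t. \<integral>s. f t * g (- t + s) * cnj (h s) \<partial>M \<partial>M)"
    by (rule Fubini_compact_support[OF c L(1) K(1)]) (use K L in auto)
  finally show ?thesis by (simp add: mult.assoc)
qed

text \<open>A left translation of s and a second interchange isolate g; inverting t then produces
  \<open>star f\<close>. The inversion is where unimodularity enters.\<close>

lemma pairing_convol_left:
  assumes f: "f \<in> Cc" and g: "g \<in> Cc" and h: "h \<in> Cc"
  shows "(\<integral>s. convol M f g s * cnj (h s) \<partial>M) = (\<integral>s. g s * cnj (convol M (star f) h s) \<partial>M)"
proof -
  note fc = Cc_continuous[OF f] and gc = Cc_continuous[OF g] and hc = Cc_continuous[OF h]
  obtain K where K: "compact K" "\<And>x. x \<notin> K \<Longrightarrow> f x = 0" using Cc_supportE[OF f] by metis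
  obtain L where L: "compact L" "\<And>x. x \<notin> L \<Longrightarrow> g x = 0" using Cc_supportE[OF g] by metis
  have c: "continuous_on UNIV (\<lambda>z. f (fst z) * g (snd z) * cnj (h (fst z + snd z)))"
    by (intro continuous_on_mult continuous_on_compose_UNIV[OF fc]
        continuous_on_compose_UNIV[OF gc] continuous_on_cnj continuous_on_compose_UNIV[OF hc] continuous_intros)
  have "(\<integral>t. f t * (\<integral>s. g (- t + s) * cnj (h s) \<partial>M) \<partial>M)
      = (\<integral>t. \<integral>s. f t * g s * cnj (h (t + s)) \<partial>M \<partial>M)"
  proof (rule Bochner_Integration.integral_cong[OF refl])
    fix t
    have "(\<lambda>s. g (- t + s) * cnj (h s)) \<in> borel_measurable M"
      by (intro Cc_measurable Cc_mult_continuous Cc_translate_left g Cc_continuous Cc_cnj h)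
    then show "f t * (\<integral>s. g (- t + s) * cnj (h s) \<partial>M) = (\<integral>s. f t * g s * cnj (h (t + s)) \<partial>M)"
      using integral_translate_left[of "\<lambda>s. g (- t + s) * cnj (h s)" t]
      by (simp add: mult.assoc flip: add.assoc)
  qed
  also have "\<dots> = (\<integral>s. \<integral>t. f t * g s * cnj (h (t + s)) \<partial>M \<partial>M)"
    by (rule Fubini_compact_support[OF c K(1) L(1)]) (use K L in auto)
  also have "\<dots> = (\<integral>s. g s * cnj (convol M (star f) h s) \<partial>M)"
  proof (rule Bochner_Integration.integral_cong[OF refl])
    fix s
    have "(\<lambda>t. star f t * h (- t + s)) \<in> borel_measurable M"
      by (intro Cc_measurable Cc_mult_continuous star_Cc f continuous_on_compose_UNIV[OF hc] continuous_intros)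
    then have "convol M (star f) h s = (\<integral>t. cnj (f t) * h (t + s) \<partial>M)"
      using integral_uminus[of "\<lambda>t. star f t * h (- t + s)"] by (simp add: convol_def star_def)
    then have "cnj (convol M (star f) h s) = (\<integral>t. f t * cnj (h (t + s)) \<partial>M)"
      by (simp flip: Bochner_Integration.integral_cnj)
    moreover have "f t * g s * cnj (h (t + s)) = g s * (f t * cnj (h (t + s)))" for t by simp
    ultimately show "(\<integral>t. f t * g s * cnj (h (t + s)) \<partial>M) = g s * cnj (convol M (star f) h s)"
      by (simp only: integral_mult_right_zero)
  qed
  finally show ?thesis by (simp add: pairing_convol[OF f g h])
qed

text \<open>The inner integral of \<open>pairing_convol\<close> at t is the conjugate of the
  convolution of h with \<open>star g\<close>, because the inverse of - s + t is - t + s.\<close>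

lemma pairing_convol_right:
  assumes f: "f \<in> Cc" and g: "g \<in> Cc" and h: "h \<in> Cc"
  shows "(\<integral>s. convol M f g s * cnj (h s) \<partial>M) = (\<integral>s. f s * cnj (convol M h (star g) s) \<partial>M)"
proof -
  have "cnj (convol M h (star g) t) = (\<integral>s. g (- t + s) * cnj (h s) \<partial>M)" for t
    by (simp add: convol_def star_def minus_add mult.commute flip: Bochner_Integration.integral_cnj)
  then show ?thesis by (simp add: pairing_convol[OF f g h])
qed

text \<open>Young's inequality for exponents 1 and p. Splitting |f| as |f|^(1/q) times |f|^(1/p)
  lets Hoelder bound the p-th power pointwise by ||f||_1^(p/q) times the convolution of |f| with
  |h|^p; Fubini integrates this, and p/q + 1 = p.\<close>

lemma convol_norm_le_Cc:
  assumes f: "f \<in> Cc" and h: "h \<in> Cc" and p: "1 < p"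
  shows "lp_norm M p (convol M f h) \<le> (\<integral>t. norm (f t) \<partial>M) * lp_norm M p h"
proof -
  define q where "q = conj_exp p"
  have q: "1 < q" "1 / q + 1 / p = 1" using conj_exp[OF p] by (auto simp: q_def)
  have p1: "1 \<le> p" and p0: "0 \<le> p" using p by auto
  define A where "A = (\<integral>t. norm (f t) \<partial>M)"
  have A0: "0 \<le> A" by (simp add: A_def)
  note fc = Cc_continuous[OF f] and hc = Cc_continuous[OF h]
  obtain K where K: "compact K" "\<And>x. x \<notin> K \<Longrightarrow> f x = 0" using Cc_supportE[OF f] by metis
  have powr_cont: "continuous_on UNIV (\<lambda>z. complex_of_real (norm z powr r))" if "0 < r" for r
    using that by (intro continuous_on_of_real continuous_on_powr' continuous_intros) auto
  define f1 where "f1 t = complex_of_real (norm (f t) powr (1 / q))" for t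
  define f2 where "f2 t = complex_of_real (norm (f t) powr (1 / p))" for t
  define hp where "hp t = complex_of_real (norm (h t) powr p)" for t
  have f1: "f1 \<in> Cc" unfolding f1_def by (rule Cc_compose[OF f powr_cont]) (use q in auto)
  have f2: "f2 \<in> Cc" unfolding f2_def by (rule Cc_compose[OF f powr_cont]) (use p in auto)
  have hp: "hp \<in> Cc" unfolding hp_def by (rule Cc_compose[OF h powr_cont]) (use p in auto)
  have pw: "norm (convol M f h s) powr p \<le> A powr (p / q) * (\<integral>t. norm (f t) * norm (h (- t + s)) powr p \<partial>M)" for s
  proof -
    define g where "g t = f2 t * h (- t + s)" for t
    have g: "g \<in> Cc"
      unfolding g_def by (rule Cc_mult_continuous[OF f2 continuous_on_compose_UNIV[OF hc continuous_reflect]])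
    have split: "norm (f t * h (- t + s)) = norm (f1 t) * norm (g t)" for t
    proof (cases "f t = 0")
      case False
      have "norm (f t) powr (1 / q) * norm (f t) powr (1 / p) = norm (f t)"
        using False q(2) by (simp flip: powr_add)
      then show ?thesis by (simp add: f1_def f2_def g_def norm_mult flip: mult.assoc)
    qed (simp add: f1_def f2_def g_def)
    have "norm (convol M f h s) \<le> (\<integral>t. norm (f t * h (- t + s)) \<partial>M)"
      unfolding convol_def by (rule integral_norm_bound)
    also have "\<dots> = (\<integral>t. norm (f1 t) * norm (g t) \<partial>M)" by (simp only: split)
    also have "\<dots> \<le> lp_norm M q f1 * lp_norm M p g"
      by (rule Hoelder_lp_norm(2)) (use f1 g p q in \<open>auto intro!: Cc_in_lp_fun\<close>)
    finally have "norm (convol M f h s) powr p \<le> (lp_norm M q f1 * lp_norm M p g) powr p"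
      using p by (intro powr_mono2) auto
    also have "\<dots> = lp_norm M q f1 powr p * lp_norm M p g powr p"
      by (simp add: powr_mult)
    also have "lp_norm M p g powr p = (\<integral>t. norm (f t) * norm (h (- t + s)) powr p \<partial>M)"
      using p by (simp add: lp_norm_powr[OF p1] g_def f2_def norm_mult powr_mult powr_powr)
    also have "lp_norm M q f1 = A powr (1 / q)"
      using q by (simp add: lp_norm_def f1_def powr_powr A_def)
    finally show ?thesis by (simp add: powr_powr)
  qed
  have c: "continuous_on UNIV (\<lambda>z. complex_of_real (norm (f (snd z))) * hp (- snd z + fst z))"
    by (intro continuous_on_mult continuous_on_of_real continuous_on_norm continuous_on_compose_UNIV[OF fc]
        continuous_on_compose_UNIV[OF Cc_continuous[OF hp]] continuous_intros)
  obtain L where L: "compact L" "\<And>x. x \<notin> L \<Longrightarrow> hp x = 0" using Cc_supportE[OF hp] by metis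
  define D where "D = (\<lambda>z. fst z + snd z) ` (K \<times> L)"
  have D: "compact D" unfolding D_def
    by (rule compact_continuous_image) (intro continuous_intros compact_Times K L)+
  have "(\<integral>s. \<integral>t. complex_of_real (norm (f t)) * hp (- t + s) \<partial>M \<partial>M)
      = (\<integral>t. \<integral>s. complex_of_real (norm (f t)) * hp (- t + s) \<partial>M \<partial>M)"
  proof (rule Fubini_compact_support[OF c D K(1)])
    fix s t assume s: "s \<notin> D"
    show "complex_of_real (norm (f t)) * hp (- t + s) = 0"
    proof (rule ccontr)
      assume "complex_of_real (norm (f t)) * hp (- t + s) \<noteq> 0"
      then have "t \<in> K" "- t + s \<in> L" using K(2)[of t] L(2)[of "- t + s"] by auto
      then have "t + (- t + s) \<in> D" unfolding D_def by force
      then show False using s by (simp flip: add.assoc)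
    qed
  qed (use K in simp)
  also have "\<dots> = complex_of_real A * (\<integral>s. hp s \<partial>M)"
    using integral_translate_left[OF Cc_measurable[OF hp]] by (simp add: A_def)
  finally have "(\<integral>s. complex_of_real (\<integral>t. norm (f t) * norm (h (- t + s)) powr p \<partial>M) \<partial>M)
      = complex_of_real (A * (\<integral>s. norm (h s) powr p \<partial>M))"
    by (simp add: hp_def flip: of_real_mult)
  then have F: "(\<integral>s. (\<integral>t. norm (f t) * norm (h (- t + s)) powr p \<partial>M) \<partial>M)
      = A * (\<integral>s. norm (h s) powr p \<partial>M)"
    by (simp flip: of_real_mult)
  have "convol M (\<lambda>t. complex_of_real (norm (f t))) hp \<in> Cc"
    by (intro convol_Cc hp Cc_compose[OF f] continuous_intros) simp
  from integrable_Re[OF Cc_integrable[OF this]]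
  have int: "integrable M (\<lambda>s. \<integral>t. norm (f t) * norm (h (- t + s)) powr p \<partial>M)"
    by (simp add: convol_def hp_def flip: of_real_mult)
  have "(\<integral>s. norm (convol M f h s) powr p \<partial>M)
      \<le> (\<integral>s. A powr (p / q) * (\<integral>t. norm (f t) * norm (h (- t + s)) powr p \<partial>M) \<partial>M)"
    by (intro integral_mono pw Cc_norm_powr_integrable convol_Cc f h p0 integrable_mult_right int)
  also have "\<dots> = A powr (p / q) * (A * lp_norm M p h powr p)"
    by (simp add: F lp_norm_powr[OF p1])
  also have "A powr (p / q) * (A * lp_norm M p h powr p) = (A * lp_norm M p h) powr p"
  proof (cases "A = 0")
    case False
    have "p / q + 1 = p" using q p by (simp add: field_simps)
    then have "A powr (p / q) * A powr 1 = A powr p" by (simp only: flip: powr_add)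
    then show ?thesis using A0 False by (simp add: powr_mult flip: mult.assoc)
  qed (use p in simp)
  finally show ?thesis
    unfolding A_def[symmetric] by (intro lp_norm_le p1) (use A0 in auto)
qed

lemma Cc_approx_sequence:
  assumes h: "h \<in> lp_fun M p" and p: "1 \<le> p"
  obtains k where "\<And>n. k n \<in> Cc" "(\<lambda>n. lp_norm M p (\<lambda>x. h x - k n x)) \<longlonglongrightarrow> 0"
proof -
  have "\<forall>n. \<exists>k. k \<in> Cc \<and> lp_norm M p (\<lambda>x. h x - k x) < 1 / real (Suc n)"
    using Cc_dense[OF h p] by (metis of_nat_0_less_iff zero_less_Suc zero_less_divide_1_iff)
  then obtain k where k: "\<And>n. k n \<in> Cc" "\<And>n. lp_norm M p (\<lambda>x. h x - k n x) < 1 / real (Suc n)"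
    by metis
  have "(\<lambda>n. lp_norm M p (\<lambda>x. h x - k n x)) \<longlonglongrightarrow> 0"
  proof (rule tendsto_sandwich[OF _ _ tendsto_const LIMSEQ_Suc[OF lim_1_over_n]])
    show "\<forall>\<^sub>F n in sequentially. lp_norm M p (\<lambda>x. h x - k n x) \<le> 1 / real (Suc n)"
      using k(2) by (intro always_eventually allI less_imp_le)
  qed simp
  then show ?thesis using that k(1) by blast
qed

text \<open>By the bound uniform in s, the convolutions with C_c approximants of h converge at every
  point, so Fatou extends Young's inequality to h.\<close>

theorem convol_lp:
  assumes f: "f \<in> Cc" and h: "h \<in> lp_fun M p" and p: "1 < p"
  shows "convol M f h \<in> lp_fun M p"
    and "lp_norm M p (convol M f h) \<le> (\<integral>t. norm (f t) \<partial>M) * lp_norm M p h"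
proof -
  define A where "A = (\<integral>t. norm (f t) \<partial>M)"
  have p1: "1 \<le> p" and p0: "0 \<le> p" using p by auto
  obtain k where k: "\<And>n. k n \<in> Cc" "(\<lambda>n. lp_norm M p (\<lambda>x. h x - k n x)) \<longlonglongrightarrow> 0"
    using Cc_approx_sequence[OF h p1] by metis
  have klp: "k n \<in> lp_fun M p" for n by (intro Cc_in_lp_fun k p0)
  have lim: "(\<lambda>n. convol M f (k n) s) \<longlonglongrightarrow> convol M f h s" for s
  proof (rule Lim_transform2[where f="\<lambda>_. convol M f h s", OF tendsto_const])
    show "(\<lambda>n. convol M f h s - convol M f (k n) s) \<longlonglongrightarrow> 0"
    proof (rule Lim_null_comparison)
      show "\<forall>\<^sub>F n in sequentially. norm (convol M f h s - convol M f (k n) s)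
          \<le> lp_norm M (conj_exp p) f * lp_norm M p (\<lambda>x. h x - k n x)"
        using convol_integrable(2)[OF f lp_fun_diff[OF h klp p0] p, of _ s]
        by (simp add: convol_diff_right[OF f h klp p])
      show "(\<lambda>n. lp_norm M (conj_exp p) f * lp_norm M p (\<lambda>x. h x - k n x)) \<longlonglongrightarrow> 0"
        using tendsto_mult_left[OF k(2), of "lp_norm M (conj_exp p) f"] by simp
    qed
  qed
  have bound: "lp_norm M p (convol M f (k n)) \<le> A * (lp_norm M p h + lp_norm M p (\<lambda>x. h x - k n x))" for n
  proof -
    have "lp_norm M p (k n) \<le> lp_norm M p h + lp_norm M p (\<lambda>x. h x - k n x)"
      using lp_norm_triangle_diff[OF h lp_fun_diff[OF h klp[of n] p0] p1] by simp
    then show ?thesis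
      using convol_norm_le_Cc[OF f k(1)[of n] p] mult_left_mono[of "lp_norm M p (k n)" _ A]
      by (force simp: A_def)
  qed
  have c: "(\<lambda>n. A * (lp_norm M p h + lp_norm M p (\<lambda>x. h x - k n x))) \<longlonglongrightarrow> A * (lp_norm M p h + 0)"
    by (intro tendsto_intros k)
  note F = lp_Fatou[OF p1 Cc_in_lp_fun[OF convol_Cc[OF f k(1)] p0] lim bound c]
  show "convol M f h \<in> lp_fun M p" by (rule F(1))
  show "lp_norm M p (convol M f h) \<le> (\<integral>t. norm (f t) \<partial>M) * lp_norm M p h"
    using F(2) by (simp add: A_def)
qed

end

section \<open>Tracial algebras\<close>

text \<open>Real scalars suffice: the complex pairing on C_c is used through its real part, which
  yields the same norms.\<close>

locale semi_inner =
  fixes ip :: "'v::real_vector \<Rightarrow> 'v \<Rightarrow> real"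
  assumes ip_commute: "ip x y = ip y x"
    and ip_add_left: "ip (x + y) z = ip x z + ip y z"
    and ip_scaleR_left: "ip (r *\<^sub>R x) z = r * ip x z"
    and ip_nonneg: "0 \<le> ip x x"
begin

lemma ip_add_right: "ip z (x + y) = ip z x + ip z y"
  using ip_add_left ip_commute by metis

lemma ip_scaleR_right: "ip z (r *\<^sub>R x) = r * ip z x"
  using ip_scaleR_left ip_commute by metis

lemma ip_minus_left: "ip (- x) z = - ip x z"
  using ip_scaleR_left[of "-1" x z] by simp

lemma ip_minus_right: "ip z (- x) = - ip z x"
  using ip_scaleR_right[of z "-1" x] by simp

lemma ip_diff_left: "ip (x - y) z = ip x z - ip y z"
  by (simp only: diff_conv_add_uminus ip_add_left ip_minus_left)

lemma ip_diff_right: "ip z (x - y) = ip z x - ip z y"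
  by (simp only: diff_conv_add_uminus ip_add_right ip_minus_right)

lemmas ip_simps = ip_add_left ip_add_right ip_scaleR_left ip_scaleR_right ip_diff_left ip_diff_right

definition nrm :: "'v \<Rightarrow> real" where
  "nrm x = sqrt (ip x x)"

lemma nrm_nonneg [simp]: "0 \<le> nrm x"
  by (simp add: nrm_def ip_nonneg)

lemma nrm_square: "(nrm x)\<^sup>2 = ip x x"
  by (simp add: nrm_def ip_nonneg)

lemma nrm_scaleR: "nrm (r *\<^sub>R x) = \<bar>r\<bar> * nrm x"
  by (simp add: nrm_def ip_simps real_sqrt_mult flip: mult.assoc)

lemma Cauchy_Schwarz: "\<bar>ip x y\<bar> \<le> nrm x * nrm y"
proof -
  have *: "(ip x y)\<^sup>2 \<le> ip x x * ip y y"
  proof (cases "ip y y = 0")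
    case True
    have "ip x y = 0"
    proof (rule ccontr)
      assume n: "ip x y \<noteq> 0"
      \<comment> \<open>Chosen so that the norm square of x + r y becomes -1.\<close>
      define r where "r = - (ip x x + 1) / (2 * ip x y)"
      have "0 \<le> ip (x + r *\<^sub>R y) (x + r *\<^sub>R y)" by (rule ip_nonneg)
      also have "\<dots> = ip x x + 2 * r * ip x y"
        using True by (simp add: ip_simps ip_commute[of y x])
      also have "\<dots> = - 1" using n by (simp add: r_def field_simps)
      finally show False by simp
    qed
    then show ?thesis by (simp add: True)
  next
    case False
    then have pos: "ip y y > 0" using ip_nonneg[of y] by simp
    define r where "r = - ip x y / ip y y"
    have "0 \<le> ip (x + r *\<^sub>R y) (x + r *\<^sub>R y)" by (rule ip_nonneg)
    also have "\<dots> = ip x x - (ip x y)\<^sup>2 / ip y y"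
      using pos by (simp add: ip_simps ip_commute[of y x] r_def power2_eq_square field_simps)
    finally show ?thesis using pos by (simp add: field_simps)
  qed
  have "\<bar>ip x y\<bar> = sqrt ((ip x y)\<^sup>2)" by simp
  also have "\<dots> \<le> sqrt (ip x x * ip y y)" by (rule real_sqrt_le_mono[OF *])
  finally show ?thesis by (simp add: nrm_def real_sqrt_mult)
qed

lemma nrm_triangle: "nrm (x + y) \<le> nrm x + nrm y"
proof (rule power2_le_imp_le)
  have "(nrm (x + y))\<^sup>2 = ip x x + 2 * ip x y + ip y y"
    by (simp add: nrm_square ip_simps ip_commute[of y x])
  also have "\<dots> \<le> (nrm x + nrm y)\<^sup>2"
    using Cauchy_Schwarz[of x y] by (simp add: power2_sum nrm_square)
  finally show "(nrm (x + y))\<^sup>2 \<le> (nrm x + nrm y)\<^sup>2" .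
qed simp

lemma nrm_minus: "nrm (- x) = nrm x"
  by (simp add: nrm_def ip_minus_left ip_minus_right)

lemma nrm_triangle_diff: "nrm (x - y) \<le> nrm x + nrm y"
  using nrm_triangle[of x "- y"] by (simp add: nrm_minus)

lemma nrm_sum: "nrm (\<Sum>i\<in>I. f i) \<le> (\<Sum>i\<in>I. nrm (f i))"
proof (induction I rule: infinite_finite_induct)
  case (insert i I)
  then show ?case using nrm_triangle[of "f i" "\<Sum>i\<in>I. f i"] by simp
qed (simp_all add: nrm_def ip_scaleR_left[of 0 0, simplified])

text \<open>
  The relations \<open>A y = B x\<close> and \<open>A' x = B' y\<close> hold when \<open>A\<close>, \<open>B\<close> are left and right multiplication
  by \<open>\<alpha>\<close>, and \<open>x = w (\<alpha> \<alpha>\<^sup>*)\<close>, \<open>y = w (\<alpha>\<^sup>* \<alpha>)\<close> for a polynomial \<open>w\<close>.  They encode the trace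
  identity \<open>\<tau> (w (\<alpha> \<alpha>\<^sup>*)\<^sup>2) = \<tau> (w (\<alpha>\<^sup>* \<alpha>)\<^sup>2)\<close> without mentioning a trace.
\<close>

lemma intertwined_decay:
  fixes A A' B B' :: "'v \<Rightarrow> 'v"
  assumes adjA: "\<And>x y. ip (A x) y = ip x (A' y)" and adjB: "\<And>x y. ip (B x) y = ip x (B' y)"
    and lin: "\<And>r x y. A (x - r *\<^sub>R y) = A x - r *\<^sub>R A y" "\<And>r x y. A' (x - r *\<^sub>R y) = A' x - r *\<^sub>R A' y"
      "\<And>r x y. B (x - r *\<^sub>R y) = B x - r *\<^sub>R B y" "\<And>r x y. B' (x - r *\<^sub>R y) = B' x - r *\<^sub>R B' y"
    and comm: "\<And>x. A (B x) = B (A x)" "\<And>x. A (B' x) = B' (A x)"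
      "\<And>x. A' (B x) = B (A' x)" "\<And>x. A' (B' x) = B' (A' x)"
    and rel: "A y = B x" "A' x = B' y" and eq: "ip x x = ip y y"
    and M: "0 < M" "\<And>v. ip (A v) (A v) \<le> M * ip v v"
    and d: "0 < d" "\<And>v. d * ip v v \<le> ip (A' v) (A' v)"
  shows "(\<lambda>n. nrm (((\<lambda>v. v - (1 / M) *\<^sub>R A' (A v)) ^^ n) y)) \<longlonglongrightarrow> 0"
proof -
  define r where "r = 1 / M"
  have r: "0 < r" "r * M = 1" using M by (auto simp: r_def)
  define S where "S v = v - r *\<^sub>R A (A' v)" for v
  define S' where "S' v = v - r *\<^sub>R A' (A v)" for v
  \<comment> \<open>The invariant of the simultaneous iteration, u standing for w(\<alpha> (adj
    \<alpha>)) and v for w((adj \<alpha>) \<alpha>). The two intertwining relations are what lets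
    the equality of norms pass to the next polynomial.\<close>
  define P where "P u v \<longleftrightarrow> A v = B u \<and> A' u = B' v \<and> ip u u = ip v v" for u v
  have P_step: "P (S u) (S' v)" if P: "P u v" for u v
  proof -
    have Av: "A v = B u" and A'u: "A' u = B' v" and uv: "ip u u = ip v v" using P by (auto simp: P_def)
    have 1: "A (S' v) = B (S u)"
      by (simp add: S_def S'_def lin Av comm[symmetric])
    have 2: "A' (S u) = B' (S' v)"
      by (simp add: S_def S'_def lin A'u comm[symmetric])
    \<comment> \<open>The cross terms in the norm squares of \<open>S u\<close> and
      \<open>S' v\<close>; both equal \<open>ip (A v) (A v)\<close>.\<close>
    have 3: "ip (A (A' u)) u = ip (A' (A v)) v"
    proof -
      have "ip (A (A' u)) u = ip (B' (A v)) u" by (simp add: A'u comm)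
      also have "\<dots> = ip (A v) (B u)" using adjB ip_commute by metis
      also have "\<dots> = ip (A' (A v)) v" using adjA ip_commute Av by metis
      finally show ?thesis .
    qed
    \<comment> \<open>The quadratic terms. The relations give B (B' v) = A' (A v), and commutation
      moves B B' past A.\<close>
    have 4: "ip (A (A' u)) (A (A' u)) = ip (A' (A v)) (A' (A v))"
    proof -
      have "B (B' v) = A' (A v)" by (simp add: A'u[symmetric] Av comm)
      have "ip (A (A' u)) (A (A' u)) = ip (B' (A v)) (B' (A v))" by (simp add: A'u comm)
      also have "\<dots> = ip (A v) (B (B' (A v)))" using adjB ip_commute by metis
      also have "B (B' (A v)) = A (B (B' v))" by (simp add: comm)
      also have "ip (A v) (A (B (B' v))) = ip (A' (A v)) (B (B' v))" using adjA ip_commute by metis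
      finally show ?thesis using \<open>B (B' v) = A' (A v)\<close> by simp
    qed
    have "ip (S u) (S u) = ip (S' v) (S' v)"
      using 3 4 uv by (simp add: S_def S'_def ip_simps ip_commute[of u "A (A' u)"] ip_commute[of v "A' (A v)"])
    with 1 2 show ?thesis by (simp add: P_def)
  qed
  have P: "P ((S ^^ n) x) ((S' ^^ n) y)" for n
    by (induction n) (use rel eq P_step in \<open>auto simp: P_def\<close>)
  \<comment> \<open>The maximum with 0 covers a vanishing form \<open>ip\<close>, for which
    \<open>d\<close> may exceed \<open>M\<close>.\<close>
  define m where "m = max 0 (1 - r * d)"
  have m: "0 \<le> m" "m < 1" using r d by (auto simp: m_def)
  \<comment> \<open>As r M = 1, the quadratic term in r cancels one of the two linear terms, leaving
    a loss of r times the norm square of \<open>A' u\<close>, which \<open>d\<close> bounds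
    below.\<close>
  have decay: "ip (S u) (S u) \<le> m * ip u u" for u
  proof -
    have "ip (A (A' u)) u = ip (A' u) (A' u)" by (simp add: adjA)
    then have "ip (S u) (S u) = ip u u - 2 * r * ip (A' u) (A' u) + r * (r * ip (A (A' u)) (A (A' u)))"
      by (simp add: S_def ip_simps ip_commute[of u "A (A' u)"] algebra_simps)
    also have "\<dots> \<le> ip u u - 2 * r * ip (A' u) (A' u) + r * (r * (M * ip (A' u) (A' u)))"
      using M(2)[of "A' u"] r by (intro add_left_mono mult_left_mono) auto
    also have "r * (r * (M * ip (A' u) (A' u))) = r * ip (A' u) (A' u)"
      using r(2) by (simp flip: mult.assoc)
    also have "ip u u - 2 * r * ip (A' u) (A' u) + r * ip (A' u) (A' u) = ip u u - r * ip (A' u) (A' u)"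
      by (simp add: algebra_simps)
    also have "\<dots> \<le> ip u u - r * (d * ip u u)"
      using d(2)[of u] r by (intro diff_left_mono mult_left_mono) auto
    also have "\<dots> = (1 - r * d) * ip u u" by (simp add: algebra_simps)
    also have "\<dots> \<le> m * ip u u" by (intro mult_right_mono ip_nonneg) (simp add: m_def)
    finally show ?thesis .
  qed
  have bound: "ip ((S ^^ n) x) ((S ^^ n) x) \<le> m ^ n * ip x x" for n
  proof (induction n)
    case (Suc n)
    have "ip ((S ^^ Suc n) x) ((S ^^ Suc n) x) \<le> m * ip ((S ^^ n) x) ((S ^^ n) x)"
      using decay by simp
    also have "\<dots> \<le> m * (m ^ n * ip x x)" by (intro mult_left_mono Suc m)
    finally show ?case by (simp add: mult.assoc)
  qed simp
  have "(\<lambda>n. sqrt (m ^ n * ip x x)) \<longlonglongrightarrow> sqrt (0 * ip x x)"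
    using m by (intro tendsto_intros LIMSEQ_realpow_zero) auto
  then have lim: "(\<lambda>n. sqrt (m ^ n * ip x x)) \<longlonglongrightarrow> 0" by simp
  have "(\<lambda>n. nrm ((S' ^^ n) y)) \<longlonglongrightarrow> 0"
  proof (rule tendsto_sandwich[OF _ _ tendsto_const lim])
    have "nrm ((S' ^^ n) y) \<le> sqrt (m ^ n * ip x x)" for n
      unfolding nrm_def using bound[of n] P[of n] by (intro real_sqrt_le_mono) (simp add: P_def)
    then show "\<forall>\<^sub>F n in sequentially. nrm ((S' ^^ n) y) \<le> sqrt (m ^ n * ip x x)" by simp
  qed simp
  then show ?thesis by (simp add: S'_def[abs_def] r_def)
qed

end

text \<open>A real form of Hilbert algebras. Reading \<open>ip x y\<close> as the trace of (adj y)
  x, the law \<open>adj_left\<close> is formal, while \<open>adj_right\<close> is the cyclicity of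
  the trace.\<close>

locale hilbert_algebra = semi_inner ip
  for ip :: "'v::real_vector \<Rightarrow> 'v \<Rightarrow> real" +
  fixes mul :: "'v \<Rightarrow> 'v \<Rightarrow> 'v" (infixl "\<star>" 70) and adj :: "'v \<Rightarrow> 'v"
  assumes mul_add_left: "(x + y) \<star> z = x \<star> z + y \<star> z"
    and mul_add_right: "z \<star> (x + y) = z \<star> x + z \<star> y"
    and mul_scaleR_left: "(r *\<^sub>R x) \<star> z = r *\<^sub>R (x \<star> z)"
    and mul_scaleR_right: "z \<star> (r *\<^sub>R x) = r *\<^sub>R (z \<star> x)"
    and mul_assoc: "(x \<star> y) \<star> z = x \<star> (y \<star> z)"
    and adj_left: "ip (x \<star> y) z = ip y (adj x \<star> z)"
    and adj_right: "ip (x \<star> y) z = ip x (z \<star> adj y)"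
    and adj_adj: "adj (adj x) = x"
    and nrm_adj: "nrm (adj x) = nrm x"
    and mul_bounded: "\<exists>C\<ge>0. \<forall>y. nrm (x \<star> y) \<le> C * nrm y"
begin

lemma mul_minus_left: "(- x) \<star> z = - (x \<star> z)"
  using mul_scaleR_left[of "-1" x z] by simp

lemma mul_minus_right: "z \<star> (- x) = - (z \<star> x)"
  using mul_scaleR_right[of z "-1" x] by simp

lemma mul_diff_left: "(x - y) \<star> z = x \<star> z - y \<star> z"
  by (simp only: diff_conv_add_uminus mul_add_left mul_minus_left)

lemma mul_diff_right: "z \<star> (x - y) = z \<star> x - z \<star> y"
  by (simp only: diff_conv_add_uminus mul_add_right mul_minus_right)

lemmas mul_simps = mul_add_left mul_add_right mul_scaleR_left mul_scaleR_right
  mul_diff_left mul_diff_right mul_minus_left mul_minus_right mul_assoc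

lemma mul_zero_right: "x \<star> 0 = 0"
  using mul_scaleR_right[of x 0 0] by simp

lemma mul_sum_right: "x \<star> (\<Sum>i\<in>I. f i) = (\<Sum>i\<in>I. x \<star> f i)"
  by (induction I rule: infinite_finite_induct) (simp_all add: mul_zero_right mul_add_right)

lemma adj_left': "ip (adj x \<star> y) z = ip y (x \<star> z)"
  by (simp add: adj_left adj_adj)

lemma adj_right': "ip (x \<star> adj y) z = ip x (z \<star> y)"
  by (simp add: adj_right adj_adj)

text \<open>Left multiplication by r + k in the unitization. The algebra need not have an identity,
  so 1 - a is available only as an operator.\<close>

definition unital_op :: "('v \<Rightarrow> 'v) \<Rightarrow> bool" where
  "unital_op T \<longleftrightarrow> (\<exists>r k. \<forall>x. T x = r *\<^sub>R x + k \<star> x)"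

lemma unital_opI: "(\<And>x. T x = r *\<^sub>R x + k \<star> x) \<Longrightarrow> unital_op T"
  unfolding unital_op_def by blast

lemma unital_op_comp:
  assumes "unital_op S" "unital_op T"
  shows "unital_op (\<lambda>x. S (T x))"
proof -
  obtain r k where S: "\<And>x. S x = r *\<^sub>R x + k \<star> x" using assms unfolding unital_op_def by blast
  obtain s l where T: "\<And>x. T x = s *\<^sub>R x + l \<star> x" using assms unfolding unital_op_def by blast
  show ?thesis
    by (rule unital_opI[where r="r * s" and k="r *\<^sub>R l + s *\<^sub>R k + k \<star> l"])
      (simp add: S T mul_simps algebra_simps)
qed

lemma unital_op_combination:
  assumes "unital_op S" "unital_op T"
  shows "unital_op (\<lambda>x. c *\<^sub>R S x + d *\<^sub>R T x)"
proof -
  obtain r k where S: "\<And>x. S x = r *\<^sub>R x + k \<star> x" using assms unfolding unital_op_def by blast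
  obtain s l where T: "\<And>x. T x = s *\<^sub>R x + l \<star> x" using assms unfolding unital_op_def by blast
  show ?thesis
    by (rule unital_opI[where r="c * r + d * s" and k="c *\<^sub>R k + d *\<^sub>R l"])
      (simp add: S T mul_simps algebra_simps)
qed

lemma unital_op_one_minus: "unital_op (\<lambda>x. x - a \<star> x)"
  by (rule unital_opI[where r=1 and k="- a"]) (simp add: mul_simps)

lemma unital_op_id: "unital_op (\<lambda>x. x)"
  by (rule unital_opI[where r=1 and k=0]) (use mul_scaleR_left[of 0 0] in simp)

lemma unital_op_bounded:
  assumes "unital_op T"
  obtains C where "0 < C" "\<And>x. nrm (T x) \<le> C * nrm x"
proof -
  obtain r k where T: "\<And>x. T x = r *\<^sub>R x + k \<star> x" using assms unfolding unital_op_def by blast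
  obtain C where C: "0 \<le> C" "\<And>y. nrm (k \<star> y) \<le> C * nrm y" using mul_bounded by blast
  show ?thesis
  proof (rule that[of "\<bar>r\<bar> + C + 1"])
    fix x
    have "nrm (T x) \<le> \<bar>r\<bar> * nrm x + C * nrm x"
      unfolding T using nrm_triangle[of "r *\<^sub>R x" "k \<star> x"] C(2)[of x] by (simp add: nrm_scaleR)
    also have "\<dots> \<le> (\<bar>r\<bar> + C + 1) * nrm x" by (simp add: algebra_simps)
    finally show "nrm (T x) \<le> (\<bar>r\<bar> + C + 1) * nrm x" .
  qed (use C in auto)
qed

text \<open>
  The remainder \<open>E\<close> is a polynomial in \<open>(1 - a)\<^sup>* (1 - a)\<close> that approximates the projection onto the
  kernel of \<open>1 - a\<close>.
\<close>

lemma approximate_left_inverse: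
  assumes d: "0 < d" "\<And>v. d * nrm v \<le> nrm (v - adj a \<star> v)" and e: "0 < e"
  obtains E T where "nrm E < e" "unital_op T" "\<And>v. v = T (v - a \<star> v) + E \<star> v"
proof -
  define A where "A v = v - a \<star> v" for v
  define A' where "A' v = v - adj a \<star> v" for v
  define B where "B v = v - v \<star> a" for v
  define B' where "B' v = v - v \<star> adj a" for v
  \<comment> \<open>With \<alpha> = 1 - a, these are 1 - \<alpha> (adj \<alpha>) and 1 - (adj
    \<alpha>) \<alpha>: the identity cancels, so both are elements of the algebra. They start the
    iteration.\<close>
  define x where "x = a + adj a - a \<star> adj a"
  define y where "y = a + adj a - adj a \<star> a"
  obtain C where C: "0 < C" "\<And>v. nrm (A v) \<le> C * nrm v"
    using unital_op_bounded[OF unital_op_one_minus[of a]] unfolding A_def by blast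
  define M where "M = C\<^sup>2"
  have M: "0 < M" using C by (simp add: M_def)
  have MA: "ip (A v) (A v) \<le> M * ip v v" for v
    using power_mono[OF C(2)[of v] nrm_nonneg, of 2] by (simp add: power_mult_distrib nrm_square M_def)
  have dA: "d\<^sup>2 * ip v v \<le> ip (A' v) (A' v)" for v
    using power_mono[OF d(2)[of v], of 2] d(1) by (simp add: power_mult_distrib nrm_square A'_def)
  \<comment> \<open>Both elements are a + adj a minus a product, so only the inner products
    involving a (adj a) and (adj a) a have to be matched, by moving factors across on the left and
    on the right.\<close>
  have xy: "ip x x = ip y y"
  proof -
    have 1: "ip a (a \<star> adj a) = ip a (adj a \<star> a)"
      using adj_right[of a a a] adj_left[of a a a] by simp
    have 2: "ip (adj a) (a \<star> adj a) = ip (adj a) (adj a \<star> a)"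
      using adj_left'[of a "adj a" "adj a"] adj_right'[of "adj a" a "adj a"] by simp
    have 3: "ip (a \<star> adj a) (a \<star> adj a) = ip (adj a \<star> a) (adj a \<star> a)"
      using adj_right'[of a a "a \<star> adj a"] adj_left'[of a a "adj a \<star> a"] by (simp add: mul_assoc)
    have *: "ip (s - z) (s - z) = ip s s - 2 * ip s z + ip z z" for s z
      by (simp add: ip_simps ip_commute[of z s])
    show ?thesis
      unfolding x_def y_def * using 1 2 3 by (simp only: ip_add_left)
  qed
  define S' where "S' v = v - (1 / M) *\<^sub>R A' (A v)" for v
  have "(\<lambda>n. nrm (((\<lambda>v. v - (1 / M) *\<^sub>R A' (A v)) ^^ n) y)) \<longlonglongrightarrow> 0"
  proof (rule intertwined_decay[where A=A and A'=A' and M=M and x=x and y=y and B=B and B'=B' and d="d\<^sup>2"])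
    show "ip (A u) v = ip u (A' v)" for u v by (simp add: A_def A'_def ip_simps adj_left)
    show "ip (B u) v = ip u (B' v)" for u v by (simp add: B_def B'_def ip_simps adj_right)
    show "A y = B x" "A' x = B' y"
      by (simp_all add: A_def A'_def B_def B'_def x_def y_def mul_simps)
  qed (use d M MA dA xy in \<open>auto simp: A_def A'_def B_def B'_def mul_simps algebra_simps\<close>)
  then have "(\<lambda>n. nrm ((S' ^^ n) y)) \<longlonglongrightarrow> 0" by (simp add: S'_def[abs_def])
  then have "\<forall>\<^sub>F n in sequentially. nrm ((S' ^^ n) y) < e"
    using e by (rule order_tendstoD)
  then obtain n where n: "nrm ((S' ^^ n) y) < e"
    using eventually_happens'[OF sequentially_bot] by blast
  have A_mul: "A (u \<star> v) = A u \<star> v" and A'_mul: "A' (u \<star> v) = A' u \<star> v" for u v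
    by (simp_all add: A_def A'_def mul_simps)
  have uA: "unital_op A" and uA': "unital_op A'"
    using unital_op_one_minus unfolding A_def[abs_def] A'_def[abs_def] by auto
  \<comment> \<open>If 1 = T A + E, then A E = (1 - A T) A. The term subtracted from E in the next
    step is therefore again a left multiple of A and can be absorbed into T.\<close>
  have "\<exists>T. unital_op T \<and> (\<forall>v. v = T (A v) + ((S' ^^ n) y) \<star> v)"
  proof (induction n)
    case 0
    have "v = A' (A v) + y \<star> v" for v by (simp add: A_def A'_def y_def mul_simps)
    then show ?case using uA' by auto
  next
    case (Suc n)
    then obtain T where T: "unital_op T" "\<And>v. v = T (A v) + ((S' ^^ n) y) \<star> v" by blast
    define T' where "T' u = 1 *\<^sub>R T u + (1 / M) *\<^sub>R A' (1 *\<^sub>R u + (- 1) *\<^sub>R A (T u))" for u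
    have "unital_op T'"
      unfolding T'_def[abs_def]
      by (intro unital_op_combination unital_op_comp[OF uA'] unital_op_comp[OF uA] unital_op_id T)
    moreover have "v = T' (A v) + ((S' ^^ Suc n) y) \<star> v" for v
    proof -
      define w where "w = ((S' ^^ n) y) \<star> v"
      have Tw: "T (A v) = v - w" using T(2)[of v] by (simp add: w_def algebra_simps)
      have "((S' ^^ Suc n) y) \<star> v = w - (1 / M) *\<^sub>R A' (A w)"
        by (simp add: S'_def w_def mul_diff_left mul_scaleR_left A_mul A'_mul)
      moreover have "A v - A (v - w) = A w" by (simp add: A_def mul_simps)
      ultimately show ?thesis by (simp add: T'_def Tw)
    qed
    ultimately show ?case by blast
  qed
  then show ?thesis using that[OF n] by (metis A_def)
qed

text \<open>Since (1 - a)(1 - b) = 1 - c, telescoping gives (1 - a) v_n = c^(n+1) (1 - a) h, which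
  tends to 0 while v_n stays bounded. The approximate left inverse of 1 - a then leaves only E v_n,
  and this is small against k. The constant K is arbitrary, since Kunze--Stein controls only the
  rate.\<close>

theorem quasi_inverse_weak_limit:
  fixes a b h k :: 'v
  defines "C \<equiv> \<lambda>x. (a + b - a \<star> b) \<star> x"
  assumes \<rho>: "0 \<le> \<rho>" "\<rho> < 1" and K: "0 \<le> K" "\<And>n x. nrm ((C ^^ n) x) \<le> K * \<rho> ^ n * nrm x"
  defines "v \<equiv> \<lambda>n. let y = (\<Sum>j\<le>n. (C ^^ j) (h - a \<star> h)) in h - (y - b \<star> y)"
  shows "(\<lambda>n. ip (v n) k) \<longlonglongrightarrow> 0"
proof -
  define A where "A x = x - a \<star> x" for x
  define \<beta> where "\<beta> x = x - b \<star> x" for x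
  define \<Sigma> where "\<Sigma> n x = (\<Sum>j\<le>n. (C ^^ j) x)" for n x
  have v: "v n = h - \<beta> (\<Sigma> n (A h))" for n by (simp add: v_def \<beta>_def \<Sigma>_def A_def Let_def)
  have A\<beta>: "A (\<beta> x) = x - C x" for x
    by (simp add: A_def \<beta>_def C_def mul_simps)
  have tele: "\<Sigma> n x - C (\<Sigma> n x) = x - (C ^^ Suc n) x" for n x
  proof -
    have "C (\<Sigma> n x) = (\<Sum>j\<le>n. (C ^^ Suc j) x)" by (simp add: \<Sigma>_def C_def mul_sum_right)
    then have "\<Sigma> n x - C (\<Sigma> n x) = (\<Sum>j\<le>n. (C ^^ j) x - (C ^^ Suc j) x)"
      by (simp only: \<Sigma>_def sum_subtractf)
    also have "\<dots> = (C ^^ 0) x - (C ^^ Suc n) x" by (rule sum_telescope)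
    finally show ?thesis by simp
  qed
  have Av: "A (v n) = (C ^^ Suc n) (A h)" for n
  proof -
    have "A (v n) = A h - A (\<beta> (\<Sigma> n (A h)))" by (simp add: v A_def mul_simps)
    also have "\<dots> = (C ^^ Suc n) (A h)" unfolding A\<beta> tele by simp
    finally show ?thesis .
  qed
  have \<Sigma>_bound: "nrm (\<Sigma> n x) \<le> K / (1 - \<rho>) * nrm x" for n x
  proof -
    have "nrm (\<Sigma> n x) \<le> (\<Sum>j\<le>n. K * \<rho> ^ j * nrm x)"
      unfolding \<Sigma>_def by (rule order_trans[OF nrm_sum sum_mono[OF K(2)]])
    also have "\<dots> = K * (\<Sum>j\<le>n. \<rho> ^ j) * nrm x"
      by (simp add: sum_distrib_left sum_distrib_right)
    also have "(\<Sum>j\<le>n. \<rho> ^ j) \<le> 1 / (1 - \<rho>)"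
    proof -
      have "(\<Sum>j\<le>n. \<rho> ^ j) = (1 - \<rho> ^ Suc n) / (1 - \<rho>)"
        using sum_gp0[of \<rho> n] \<rho> by simp
      also have "\<dots> \<le> 1 / (1 - \<rho>)" using \<rho> by (intro divide_right_mono) auto
      finally show ?thesis .
    qed
    finally show ?thesis
      using K(1) nrm_nonneg[of x] by (simp add: mult_left_mono mult_right_mono)
  qed
  have u\<beta>: "unital_op \<beta>" and uA: "unital_op A"
    using unital_op_one_minus unfolding \<beta>_def[abs_def] A_def[abs_def] by auto
  obtain L where L: "0 < L" "\<And>x. nrm (\<beta> x) \<le> L * nrm x" using unital_op_bounded[OF u\<beta>] by blast
  \<comment> \<open>The summand 1 keeps B positive when K = 0.\<close>
  define B where "B = L * (K / (1 - \<rho>)) + 1"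
  have B0: "0 < B" using L K(1) \<rho> by (simp add: B_def add_nonneg_pos)
  have \<beta>\<Sigma>: "nrm (\<beta> (\<Sigma> n x)) \<le> B * nrm x" for n x
  proof -
    have "nrm (\<beta> (\<Sigma> n x)) \<le> L * (K / (1 - \<rho>) * nrm x)"
      using L \<Sigma>_bound[of n x] by (intro order_trans[OF L(2)] mult_left_mono) auto
    also have "\<dots> \<le> B * nrm x" by (simp add: B_def algebra_simps)
    finally show ?thesis .
  qed
  have K\<rho>: "(\<lambda>n. K * \<rho> ^ n) \<longlonglongrightarrow> 0"
    using tendsto_mult_left[OF LIMSEQ_realpow_zero[OF \<rho>], of K] by simp
  \<comment> \<open>Duality: Q is an approximate preimage of y under A, with error at most half the
    norm of y, and has norm at most \<open>B * nrm y\<close>. Testing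
    \<open>y - adj a \<star> y\<close> against Q shows that it cannot be shorter than
    \<open>nrm y / (2 * B)\<close>.\<close>
  have lower: "(1 / (2 * B)) * nrm y \<le> nrm (y - adj a \<star> y)" for y
  proof (cases "nrm y = 0")
    case False
    then have y: "0 < nrm y" using nrm_nonneg[of y] by linarith
    have "\<forall>\<^sub>F n in sequentially. K * \<rho> ^ n < 1 / 2" by (rule order_tendstoD[OF K\<rho>]) simp
    then obtain N where N: "\<And>n. n \<ge> N \<Longrightarrow> K * \<rho> ^ n < 1 / 2"
      unfolding eventually_sequentially by blast
    have "nrm ((C ^^ Suc N) y) \<le> 1 / 2 * nrm y"
      using K(2)[of "Suc N" y] N[of "Suc N"] mult_right_mono[of "K * \<rho> ^ Suc N" "1 / 2" "nrm y"] by simp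
    then have 1: "\<bar>ip y ((C ^^ Suc N) y)\<bar> \<le> nrm y * (1 / 2 * nrm y)"
      by (intro order_trans[OF Cauchy_Schwarz] mult_left_mono) auto
    define Q where "Q = \<beta> (\<Sigma> N y)"
    have "ip (y - adj a \<star> y) Q = ip y (A Q)"
      by (simp add: A_def ip_simps adj_left')
    also have "A Q = y - (C ^^ Suc N) y" unfolding Q_def A\<beta> tele ..
    also have "ip y (y - (C ^^ Suc N) y) = nrm y * nrm y - ip y ((C ^^ Suc N) y)"
      by (simp only: ip_diff_right nrm_square[symmetric] power2_eq_square)
    finally have "nrm y * nrm y / 2 \<le> ip (y - adj a \<star> y) Q" using 1 by (simp add: abs_le_iff)
    also have "\<dots> \<le> nrm (y - adj a \<star> y) * (B * nrm y)"
      using Cauchy_Schwarz[of "y - adj a \<star> y" Q] \<beta>\<Sigma>[of N y]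
        mult_left_mono[of "nrm Q" "B * nrm y" "nrm (y - adj a \<star> y)"] by (simp add: Q_def)
    finally have "nrm y * (nrm y / 2) \<le> nrm y * (B * nrm (y - adj a \<star> y))" by (simp add: ac_simps)
    then have "nrm y / 2 \<le> B * nrm (y - adj a \<star> y)" using y by simp
    then show ?thesis using B0 by (simp add: field_simps)
  qed simp
  have v_bound: "nrm (v n) \<le> nrm h + B * nrm (A h)" for n
    unfolding v using nrm_triangle_diff[of h] \<beta>\<Sigma>[of n "A h"] by (meson add_left_mono order_trans)
  define D where "D = nrm h + B * nrm (A h)"
  have D0: "0 \<le> D" using B0 by (simp add: D_def)
  obtain G where G: "0 \<le> G" "\<And>y. nrm (k \<star> y) \<le> G * nrm y" using mul_bounded by blast
  show ?thesis
  proof (rule LIMSEQ_I)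
    fix e :: real assume e: "0 < e"
    define e' where "e' = e / (2 * (G * D + 1))"
    have GD: "0 \<le> G * D" using G D0 by simp
    then have e': "0 < e'" using e by (simp add: e'_def add_nonneg_pos)
    obtain E T where E: "nrm E < e'" and T: "unital_op T" and ET: "\<And>v. v = T (A v) + E \<star> v"
      using approximate_left_inverse[OF _ lower e'] B0 unfolding A_def by (metis divide_pos_pos mult_pos_pos zero_less_numeral zero_less_one)
    obtain P where P: "0 < P" "\<And>x. nrm (T x) \<le> P * nrm x" using unital_op_bounded[OF T] by blast
    have "(\<lambda>n. P * (K * \<rho> ^ Suc n * nrm (A h)) * nrm k) \<longlonglongrightarrow> P * (0 * nrm (A h)) * nrm k"
      by (intro tendsto_intros LIMSEQ_Suc[OF K\<rho>])
    then have "\<forall>\<^sub>F n in sequentially. P * (K * \<rho> ^ Suc n * nrm (A h)) * nrm k < e / 2"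
      by (rule order_tendstoD) (use e in simp)
    then obtain N where N: "\<And>n. n \<ge> N \<Longrightarrow> P * (K * \<rho> ^ Suc n * nrm (A h)) * nrm k < e / 2"
      unfolding eventually_sequentially by blast
    have "\<bar>ip (v n) k\<bar> < e" if n: "n \<ge> N" for n
    proof -
      have "ip (v n) k = ip (T (A (v n))) k + ip (E \<star> v n) k"
        by (subst ET[of "v n"]) (simp add: ip_simps)
      moreover have "\<bar>ip (T (A (v n))) k\<bar> < e / 2"
      proof -
        have "nrm (T (A (v n))) \<le> P * (K * \<rho> ^ Suc n * nrm (A h))"
          unfolding Av using P K(2)[of "Suc n" "A h"] by (intro order_trans[OF P(2)] mult_left_mono) auto
        then have "\<bar>ip (T (A (v n))) k\<bar> \<le> P * (K * \<rho> ^ Suc n * nrm (A h)) * nrm k"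
          by (intro order_trans[OF Cauchy_Schwarz] mult_right_mono) auto
        then show ?thesis using N[OF n] by linarith
      qed
      moreover have "\<bar>ip (E \<star> v n) k\<bar> \<le> e / 2"
      proof -
        \<comment> \<open>E is small only as a vector. Cyclicity isolates it, and the remaining
          factor is controlled by left multiplication with the fixed k.\<close>
        have "ip (E \<star> v n) k = ip E (k \<star> adj (v n))" by (rule adj_right)
        also have "\<bar>\<dots>\<bar> \<le> nrm E * nrm (k \<star> adj (v n))" by (rule Cauchy_Schwarz)
        also have "\<dots> \<le> e' * (G * D)"
        proof (rule mult_mono)
          show "nrm (k \<star> adj (v n)) \<le> G * D"
            using G(2)[of "adj (v n)"] mult_left_mono[OF v_bound[of n] G(1)] by (simp add: nrm_adj D_def)
        qed (use E e' in auto)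
        also have "\<dots> \<le> e' * (G * D + 1)" using e' by (intro mult_left_mono) auto
        also have "\<dots> = e / 2" using GD by (simp add: e'_def field_simps add_nonneg_eq_0_iff)
        finally show ?thesis .
      qed
      ultimately show ?thesis by linarith
    qed
    then show "\<exists>no. \<forall>n\<ge>no. norm (ip (v n) k - 0) < e" by auto
  qed
qed

end

section \<open>The Kunze--Stein inequality\<close>

text \<open>An operator and its adjoint have the same norm: the norm square of c^n x is x paired
  with (adj c)^n applied to c^n x.\<close>

lemma (in hilbert_algebra) mul_power_bound_adj:
  assumes "\<And>x. nrm (((\<star>) (adj c) ^^ n) x) \<le> D * nrm x"
  shows "nrm (((\<star>) c ^^ n) x) \<le> D * nrm x"
proof -
  have ip_pow: "ip (((\<star>) c ^^ n) u) w = ip u (((\<star>) (adj c) ^^ n) w)" for u w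
  proof (induction n arbitrary: w)
    case (Suc n)
    have "ip (((\<star>) c ^^ Suc n) u) w = ip u (((\<star>) (adj c) ^^ n) (adj c \<star> w))"
      by (simp add: adj_left Suc.IH)
    then show ?case by (simp add: funpow_swap1[of "(\<star>) (adj c)"])
  qed simp
  define N where "N = nrm (((\<star>) c ^^ n) x)"
  have "N * N = ip x (((\<star>) (adj c) ^^ n) (((\<star>) c ^^ n) x))"
    unfolding N_def by (simp only: ip_pow[symmetric] nrm_square[symmetric] power2_eq_square)
  also have "\<dots> \<le> nrm x * nrm (((\<star>) (adj c) ^^ n) (((\<star>) c ^^ n) x))"
    by (rule order_trans[OF abs_ge_self Cauchy_Schwarz])
  also have "\<dots> \<le> nrm x * (D * N)"
    unfolding N_def by (intro mult_left_mono assms) simp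
  finally have *: "N * N \<le> N * (D * nrm x)" by (simp add: ac_simps)
  show ?thesis
  proof (cases "N = 0")
    case True
    have "0 \<le> nrm (((\<star>) (adj c) ^^ n) x)" by simp
    then have "0 \<le> D * nrm x" using assms[of x] by linarith
    then show ?thesis using True by (simp add: N_def)
  next
    case False
    then have "0 < N" by (simp add: N_def less_le)
    then show ?thesis using * by (simp add: N_def)
  qed
qed

text \<open>Functions in \<open>C\<^sub>c\<close> as a type, so that real vector space reasoning applies to them.\<close>

typedef (overloaded) 'g cc = "Cc :: ('g::t2_space \<Rightarrow> complex) set"
  by (rule exI[of _ "\<lambda>x. 0"]) simp

instantiation cc :: (t2_space) real_vector
begin

definition "0 = Abs_cc (\<lambda>x. 0)"
definition "f + g = Abs_cc (\<lambda>x. Rep_cc f x + Rep_cc g x)"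
definition "f - g = Abs_cc (\<lambda>x. Rep_cc f x - Rep_cc g x)"
definition "- f = Abs_cc (\<lambda>x. - Rep_cc f x)"
definition "r *\<^sub>R f = Abs_cc (\<lambda>x. complex_of_real r * Rep_cc f x)"

lemma Rep_cc_zero: "Rep_cc 0 = (\<lambda>x. 0)"
  by (simp add: zero_cc_def Abs_cc_inverse)

lemma Rep_cc_add: "Rep_cc (f + g) = (\<lambda>x. Rep_cc f x + Rep_cc g x)"
  unfolding plus_cc_def by (intro Abs_cc_inverse Cc_add Rep_cc)

lemma Rep_cc_diff: "Rep_cc (f - g) = (\<lambda>x. Rep_cc f x - Rep_cc g x)"
  unfolding minus_cc_def by (intro Abs_cc_inverse Cc_diff Rep_cc)

lemma Rep_cc_uminus: "Rep_cc (- f) = (\<lambda>x. - Rep_cc f x)"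
  using Cc_scale[OF Rep_cc, of "-1" f] unfolding uminus_cc_def by (intro Abs_cc_inverse) simp

lemma Rep_cc_scaleR: "Rep_cc (r *\<^sub>R f) = (\<lambda>x. complex_of_real r * Rep_cc f x)"
  unfolding scaleR_cc_def by (intro Abs_cc_inverse Cc_scale Rep_cc)

lemmas Rep_cc_simps = Rep_cc_zero Rep_cc_add Rep_cc_diff Rep_cc_uminus Rep_cc_scaleR

instance
  by standard (auto simp: Rep_cc_inject[symmetric] Rep_cc_simps fun_eq_iff algebra_simps)

end

context unimodular_haar
begin

section \<open>C_c as a Hilbert algebra\<close>

definition cc_ip :: "'g cc \<Rightarrow> 'g cc \<Rightarrow> real" where
  "cc_ip f g = Re (\<integral>x. Rep_cc f x * cnj (Rep_cc g x) \<partial>M)"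

definition cc_mul :: "'g cc \<Rightarrow> 'g cc \<Rightarrow> 'g cc" where
  "cc_mul f g = Abs_cc (convol M (Rep_cc f) (Rep_cc g))"

definition cc_star :: "'g cc \<Rightarrow> 'g cc" where
  "cc_star f = Abs_cc (star (Rep_cc f))"

lemma Rep_cc_mul: "Rep_cc (cc_mul f g) = convol M (Rep_cc f) (Rep_cc g)"
  unfolding cc_mul_def by (intro Abs_cc_inverse convol_Cc Rep_cc)

lemma Rep_cc_star: "Rep_cc (cc_star f) = star (Rep_cc f)"
  unfolding cc_star_def by (intro Abs_cc_inverse star_Cc Rep_cc)

lemma Rep_cc_lp: "0 \<le> p \<Longrightarrow> Rep_cc f \<in> lp_fun M p"
  by (intro Cc_in_lp_fun Rep_cc)

lemma sqrt_cc_ip: "sqrt (cc_ip f f) = lp_norm M 2 (Rep_cc f)"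
proof -
  have "(\<integral>x. Rep_cc f x * cnj (Rep_cc f x) \<partial>M) = (\<integral>x. complex_of_real (norm (Rep_cc f x) powr 2) \<partial>M)"
    by (intro Bochner_Integration.integral_cong refl)
      (simp add: complex_norm_square[symmetric] powr_numeral)
  then have "cc_ip f f = (\<integral>x. norm (Rep_cc f x) powr 2 \<partial>M)"
    by (simp only: cc_ip_def integral_complex_of_real Re_complex_of_real)
  then show ?thesis
    by (simp add: lp_norm_def powr_half_sqrt)
qed

sublocale H: hilbert_algebra cc_ip cc_mul cc_star
proof -
  interpret S: semi_inner cc_ip
  proof
    fix x y z :: "'g cc" and r :: real
    have "cnj (\<integral>s. Rep_cc x s * cnj (Rep_cc y s) \<partial>M) = (\<integral>s. Rep_cc y s * cnj (Rep_cc x s) \<partial>M)"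
      by (simp add: mult.commute flip: Bochner_Integration.integral_cnj)
    then show "cc_ip x y = cc_ip y x" unfolding cc_ip_def by (metis cnj.simps(1))
    show "cc_ip (x + y) z = cc_ip x z + cc_ip y z"
      using Cc_pairing_integrable[OF Rep_cc Rep_cc, of x z] Cc_pairing_integrable[OF Rep_cc Rep_cc, of y z]
      by (simp add: cc_ip_def Rep_cc_simps distrib_right)
    show "cc_ip (r *\<^sub>R x) z = r * cc_ip x z"
      by (simp add: cc_ip_def Rep_cc_simps mult.assoc)
    have "0 \<le> sqrt (cc_ip x x)" by (simp add: sqrt_cc_ip)
    then show "0 \<le> cc_ip x x" by simp
  qed
  have nrm: "S.nrm f = lp_norm M 2 (Rep_cc f)" for f by (simp add: S.nrm_def sqrt_cc_ip)
  have lp: "Rep_cc f \<in> lp_fun M 2" for f by (rule Rep_cc_lp) simp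
  show "hilbert_algebra cc_ip cc_mul cc_star"
  proof
    fix x y z :: "'g cc" and r :: real
    show "cc_mul (x + y) z = cc_mul x z + cc_mul y z"
      by (simp add: Rep_cc_inject[symmetric] Rep_cc_mul Rep_cc_simps convol_add_left[OF Rep_cc Rep_cc lp])
    show "cc_mul z (x + y) = cc_mul z x + cc_mul z y"
      by (simp add: Rep_cc_inject[symmetric] Rep_cc_mul Rep_cc_simps convol_add_right[OF Rep_cc lp lp])
    show "cc_mul (r *\<^sub>R x) z = r *\<^sub>R cc_mul x z"
      by (simp add: Rep_cc_inject[symmetric] Rep_cc_mul Rep_cc_simps convol_scale_left)
    show "cc_mul z (r *\<^sub>R x) = r *\<^sub>R cc_mul z x"
      by (simp add: Rep_cc_inject[symmetric] Rep_cc_mul Rep_cc_simps convol_scale_right)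
    show "cc_mul (cc_mul x y) z = cc_mul x (cc_mul y z)"
      by (simp add: Rep_cc_inject[symmetric] Rep_cc_mul convol_assoc[OF Rep_cc Rep_cc Rep_cc])
    show "cc_ip (cc_mul x y) z = cc_ip y (cc_mul (cc_star x) z)"
      by (simp add: cc_ip_def Rep_cc_mul Rep_cc_star pairing_convol_left[OF Rep_cc Rep_cc Rep_cc])
    show "cc_ip (cc_mul x y) z = cc_ip x (cc_mul z (cc_star y))"
      by (simp add: cc_ip_def Rep_cc_mul Rep_cc_star pairing_convol_right[OF Rep_cc Rep_cc Rep_cc])
    show "cc_star (cc_star x) = x"
      by (simp add: Rep_cc_inject[symmetric] Rep_cc_star)
    have "(\<integral>s. norm (Rep_cc x (- s)) powr 2 \<partial>M) = (\<integral>s. norm (Rep_cc x s) powr 2 \<partial>M)"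
      using integral_uminus[of "\<lambda>s. norm (Rep_cc x s) powr 2"] Cc_measurable[OF Rep_cc, of x] by simp
    then show "S.nrm (cc_star x) = S.nrm x"
      by (simp add: nrm lp_norm_def Rep_cc_star star_def)
    show "\<exists>C\<ge>0. \<forall>y. S.nrm (cc_mul x y) \<le> C * S.nrm y"
      using convol_norm_le_Cc[OF Rep_cc Rep_cc, of 2 x]
      by (intro exI[of _ "\<integral>t. norm (Rep_cc x t) \<partial>M"]) (simp add: nrm Rep_cc_mul)
  qed
qed

lemma cc_nrm: "H.nrm f = lp_norm M 2 (Rep_cc f)"
  by (simp add: H.nrm_def sqrt_cc_ip)

lemma Rep_cc_mul_power: "Rep_cc ((cc_mul c ^^ n) h) = (convol M (Rep_cc c) ^^ n) (Rep_cc h)"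
  by (induction n) (simp_all add: Rep_cc_mul)

section \<open>Duality of L^p and its conjugate exponent\<close>

lemma pairing_bound:
  assumes f: "f \<in> lp_fun M p" and g: "g \<in> lp_fun M (conj_exp p)" and p: "1 < p"
  shows "integrable M (\<lambda>x. f x * cnj (g x))"
    and "norm (\<integral>x. f x * cnj (g x) \<partial>M) \<le> lp_norm M p f * lp_norm M (conj_exp p) g"
proof -
  note H = Hoelder_lp_norm[OF f g p conj_exp(1,2)[OF p]]
  have [measurable]: "f \<in> borel_measurable M" "g \<in> borel_measurable M"
    using lp_fun_measurable[OF f] lp_fun_measurable[OF g] by auto
  have [measurable]: "(\<lambda>x. cnj (g x)) \<in> borel_measurable M"
    by (rule measurable_compose[OF lp_fun_measurable[OF g] borel_measurable_continuous_onI])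
      (intro continuous_intros)
  show "integrable M (\<lambda>x. f x * cnj (g x))"
    by (rule Bochner_Integration.integrable_bound[OF H(1)]) (auto simp: norm_mult)
  have "norm (\<integral>x. f x * cnj (g x) \<partial>M) \<le> (\<integral>x. norm (f x * cnj (g x)) \<partial>M)"
    by (rule integral_norm_bound)
  then show "norm (\<integral>x. f x * cnj (g x) \<partial>M) \<le> lp_norm M p f * lp_norm M (conj_exp p) g"
    using H(2) by (simp add: norm_mult)
qed

text \<open>\<open>u \<bar>u\<bar>\<^bsup>p - 2\<^esup>\<close> norms \<open>u\<close>; at zeros of \<open>u\<close> it vanishes because \<open>0 powr r = 0\<close> for every \<open>r\<close>.\<close>

lemma lp_norm_le_pairing:
  assumes u: "u \<in> lp_fun M p" and p: "1 < p" and D: "0 \<le> D"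
    and le: "\<And>k. k \<in> Cc \<Longrightarrow> \<bar>Re (\<integral>x. u x * cnj (k x) \<partial>M)\<bar> \<le> D * lp_norm M (conj_exp p) k"
  shows "lp_norm M p u \<le> D"
proof -
  define q where "q = conj_exp p"
  have q: "1 < q" "(p - 1) * q = p" "1 / p + 1 / q = 1" using conj_exp[OF p] by (auto simp: q_def)
  have p1: "1 \<le> p" "0 \<le> p" and q1: "1 \<le> q" "0 \<le> q" using p q by auto
  define \<phi> where "\<phi> x = complex_of_real (norm (u x) powr (p - 2)) * u x" for x
  have [measurable]: "u \<in> borel_measurable M" by (rule lp_fun_measurable[OF u])
  have norm_\<phi>: "norm (\<phi> x) = norm (u x) powr (p - 1)" for x
  proof (cases "u x = 0")
    case False
    have "norm (u x) powr (p - 2) * norm (u x) powr 1 = norm (u x) powr (p - 1)"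
      by (simp only: flip: powr_add) simp
    then show ?thesis using False by (simp add: \<phi>_def norm_mult)
  qed (simp add: \<phi>_def)
  have \<phi>_powr: "norm (\<phi> x) powr q = norm (u x) powr p" for x
    by (simp add: norm_\<phi> powr_powr q)
  have \<phi>: "\<phi> \<in> lp_fun M q"
    by (rule lp_funI) (use lp_fun_integrable[OF u] in \<open>simp_all add: \<phi>_powr, simp add: \<phi>_def[abs_def]\<close>)
  have u\<phi>: "u x * cnj (\<phi> x) = complex_of_real (norm (u x) powr p)" for x
  proof (cases "u x = 0")
    case False
    have "norm (u x) powr (p - 2) * norm (u x) powr 2 = norm (u x) powr p"
      by (simp only: flip: powr_add) simp
    then have "norm (u x) powr (p - 2) * (norm (u x))\<^sup>2 = norm (u x) powr p"
      using False by (simp add: powr_numeral)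
    moreover have "u x * cnj (\<phi> x) = complex_of_real (norm (u x) powr (p - 2)) * (u x * cnj (u x))"
      by (simp add: \<phi>_def)
    ultimately show ?thesis by (simp only: complex_norm_square[symmetric] flip: of_real_mult of_real_power)
  qed simp
  define N where "N = lp_norm M p u"
  have N0: "0 \<le> N" by (simp add: N_def)
  have pair: "(\<integral>x. u x * cnj (\<phi> x) \<partial>M) = complex_of_real (N powr p)"
    by (simp add: u\<phi> N_def lp_norm_powr[OF p1(1)])
  have norm_q: "lp_norm M q \<phi> = N powr (p / q)"
    using p1 by (simp add: lp_norm_def \<phi>_powr N_def powr_powr)
  obtain k where k: "\<And>n. k n \<in> Cc" "(\<lambda>n. lp_norm M q (\<lambda>x. \<phi> x - k n x)) \<longlonglongrightarrow> 0"
    using Cc_approx_sequence[OF \<phi> q1(1)] by metis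
  have klp: "k n \<in> lp_fun M q" for n by (intro Cc_in_lp_fun k q1)
  \<comment> \<open>Test functions are limited to C_c, so the norming function \<phi> is replaced by
    \<open>k n\<close>; the error disappears in the limit.\<close>
  have est: "N powr p \<le> N * lp_norm M q (\<lambda>x. \<phi> x - k n x) + D * (lp_norm M q \<phi> + lp_norm M q (\<lambda>x. \<phi> x - k n x))" for n
  proof -
    note d = lp_fun_diff[OF \<phi> klp[of n] q1(2)]
    note i1 = pairing_bound[OF u d[unfolded q_def] p, folded q_def]
    note i2 = pairing_bound(1)[OF u klp[of n, unfolded q_def] p]
    have "complex_of_real (N powr p) = (\<integral>x. u x * cnj (\<phi> x - k n x) + u x * cnj (k n x) \<partial>M)"
      unfolding pair[symmetric] by (simp add: algebra_simps)
    also have "\<dots> = (\<integral>x. u x * cnj (\<phi> x - k n x) \<partial>M) + (\<integral>x. u x * cnj (k n x) \<partial>M)"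
      by (rule Bochner_Integration.integral_add[OF i1(1) i2])
    finally have "N powr p = Re (\<integral>x. u x * cnj (\<phi> x - k n x) \<partial>M) + Re (\<integral>x. u x * cnj (k n x) \<partial>M)"
      by (metis Re_complex_of_real plus_complex.simps(1))
    also have "\<dots> \<le> N * lp_norm M q (\<lambda>x. \<phi> x - k n x) + D * lp_norm M q (k n)"
      using order_trans[OF complex_Re_le_cmod i1(2)] abs_le_D1[OF le[OF k(1)[of n]]]
      by (intro add_mono) (simp_all add: N_def q_def)
    also have "D * lp_norm M q (k n) \<le> D * (lp_norm M q \<phi> + lp_norm M q (\<lambda>x. \<phi> x - k n x))"
      using lp_norm_triangle_diff[OF \<phi> d q1(1)] D by (intro mult_left_mono) auto
    finally show ?thesis by simp
  qed
  have "(\<lambda>n. N * lp_norm M q (\<lambda>x. \<phi> x - k n x) + D * (lp_norm M q \<phi> + lp_norm M q (\<lambda>x. \<phi> x - k n x)))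
      \<longlonglongrightarrow> N * 0 + D * (lp_norm M q \<phi> + 0)"
    by (intro tendsto_intros k)
  from LIMSEQ_le_const[OF this] est have le: "N powr p \<le> D * N powr (p / q)"
    by (auto simp: norm_q)
  show ?thesis
  proof (cases "N = 0")
    case False
    then have "0 < N" using N0 by simp
    have "p = 1 + p / q" using q p by (simp add: field_simps)
    then have "N powr p = N powr 1 * N powr (p / q)" by (metis powr_add)
    then have "N * N powr (p / q) \<le> D * N powr (p / q)" using le \<open>0 < N\<close> by simp
    then show ?thesis using \<open>0 < N\<close> by (simp add: N_def)
  qed (use D in \<open>simp add: N_def\<close>)
qed

text \<open>Passing to the adjoint keeps the operator bound and exchanges p with its conjugate
  exponent, which moves p > 2 into the range of Kunze--Stein.\<close>

lemma convol_star_dual_bound: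
  assumes c: "c \<in> Cc" and p: "1 < p" and r: "0 \<le> r"
    and le: "\<And>h. h \<in> Cc \<Longrightarrow> lp_norm M p (convol M c h) \<le> r * lp_norm M p h"
    and g: "g \<in> Cc"
  shows "lp_norm M (conj_exp p) (convol M (star c) g) \<le> r * lp_norm M (conj_exp p) g"
proof (rule lp_norm_le_pairing)
  note q = conj_exp[OF p]
  show "convol M (star c) g \<in> lp_fun M (conj_exp p)"
    using q by (intro Cc_in_lp_fun convol_Cc star_Cc c g) simp
  fix k :: "'g \<Rightarrow> complex" assume k: "k \<in> Cc"
  have "(\<integral>x. convol M (star c) g x * cnj (k x) \<partial>M) = (\<integral>x. g x * cnj (convol M c k x) \<partial>M)"
    using pairing_convol_left[OF star_Cc[OF c] g k] by simp
  also have "norm \<dots> \<le> lp_norm M (conj_exp p) g * lp_norm M (conj_exp (conj_exp p)) (convol M c k)"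
    using p q by (intro pairing_bound Cc_in_lp_fun g convol_Cc c k) auto
  also have "\<dots> \<le> lp_norm M (conj_exp p) g * (r * lp_norm M p k)"
    unfolding q(4) by (intro mult_left_mono le k) simp
  finally have "norm (\<integral>x. convol M (star c) g x * cnj (k x) \<partial>M)
      \<le> r * lp_norm M (conj_exp p) g * lp_norm M (conj_exp (conj_exp p)) k"
    unfolding q(4) by (simp add: ac_simps)
  then show "\<bar>Re (\<integral>x. convol M (star c) g x * cnj (k x) \<partial>M)\<bar>
      \<le> r * lp_norm M (conj_exp p) g * lp_norm M (conj_exp (conj_exp p)) k"
    by (rule order_trans[OF abs_Re_le_cmod])
qed (use conj_exp(1)[OF p] r in auto)

section \<open>Transfer of decay from L^p to L^2\<close>

lemma convol_power_Cc: "c \<in> Cc \<Longrightarrow> h \<in> Cc \<Longrightarrow> (convol M c ^^ n) h \<in> Cc"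
  by (induction n) (simp_all add: convol_Cc)

text \<open>Kunze--Stein measures the left factor of a convolution as a function in L^p; this form
  exhibits the power of the operator as convolution by such a function.\<close>

lemma convol_power_Suc:
  assumes c: "c \<in> Cc" and h: "h \<in> Cc"
  shows "(convol M c ^^ Suc n) h = convol M ((convol M c ^^ n) c) h"
proof (induction n)
  case (Suc n)
  have "(convol M c ^^ Suc (Suc n)) h = convol M c ((convol M c ^^ Suc n) h)" by simp
  also have "\<dots> = convol M c (convol M ((convol M c ^^ n) c) h)" by (simp only: Suc.IH)
  also have "\<dots> = convol M ((convol M c ^^ Suc n) c) h"
    by (simp add: convol_assoc[OF c convol_power_Cc[OF c c] h])
  finally show ?case .
qed simp

lemma convol_power_bound:
  assumes c: "c \<in> Cc" and r: "0 \<le> r"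
    and le: "\<And>h. h \<in> Cc \<Longrightarrow> lp_norm M p (convol M c h) \<le> r * lp_norm M p h"
    and h: "h \<in> Cc"
  shows "lp_norm M p ((convol M c ^^ n) h) \<le> r ^ n * lp_norm M p h"
proof (induction n)
  case (Suc n)
  have "lp_norm M p ((convol M c ^^ Suc n) h) \<le> r * lp_norm M p ((convol M c ^^ n) h)"
    using le[OF convol_power_Cc[OF c h]] by simp
  also have "\<dots> \<le> r * (r ^ n * lp_norm M p h)" by (intro mult_left_mono Suc.IH r)
  finally show ?case by (simp add: mult.assoc)
qed simp

text \<open>
  The Kunze--Stein inequality turns decay of \<open>c\<^sup>n\<close> as a function in \<open>L\<^sup>p\<close>, \<open>p < 2\<close>, into decay of
  \<open>c\<^sup>n\<close> as a convolution operator on \<open>L\<^sup>2\<close>.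
\<close>

lemma kunze_stein_power_less_2:
  assumes ks: "kunze_stein M" and c: "c \<in> Cc" and p: "1 < p" "p < 2" and r: "0 < r"
    and le: "\<And>h. h \<in> Cc \<Longrightarrow> lp_norm M p (convol M c h) \<le> r * lp_norm M p h"
  shows "\<exists>K\<ge>0. \<forall>n. \<forall>h\<in>Cc. lp_norm M 2 ((convol M c ^^ n) h) \<le> K * r ^ n * lp_norm M 2 h"
proof -
  obtain C where C: "C \<ge> 1" "\<And>g h. g \<in> lp_fun M p \<Longrightarrow> h \<in> Cc \<Longrightarrow>
      lp_norm M 2 (convol M g h) \<le> C * lp_norm M p g * lp_norm M 2 h"
    using ks p unfolding kunze_stein_def by (metis less_imp_le)
  \<comment> \<open>For n = m + 1 the function has norm at most r^m times that of c, whence the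
    division by r; the summand 1 serves n = 0.\<close>
  define K where "K = 1 + C * lp_norm M p c / r"
  have K1: "1 \<le> K" using C r by (simp add: K_def)
  have "lp_norm M 2 ((convol M c ^^ n) h) \<le> K * r ^ n * lp_norm M 2 h" if h: "h \<in> Cc" for n h
  proof (cases n)
    case 0
    then show ?thesis using K1 mult_right_mono[of 1 K "lp_norm M 2 h"] by simp
  next
    case (Suc m)
    have "lp_norm M 2 ((convol M c ^^ n) h) \<le> C * lp_norm M p ((convol M c ^^ m) c) * lp_norm M 2 h"
      unfolding Suc convol_power_Suc[OF c h]
      using p by (intro C Cc_in_lp_fun convol_power_Cc c h) simp
    also have "\<dots> \<le> C * (r ^ m * lp_norm M p c) * lp_norm M 2 h"
      using C r by (intro mult_right_mono mult_left_mono convol_power_bound[OF c _ le c]) auto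
    also have "\<dots> = (C * lp_norm M p c / r) * r ^ n * lp_norm M 2 h"
      using r by (simp add: Suc)
    also have "\<dots> \<le> K * r ^ n * lp_norm M 2 h"
      using r by (intro mult_right_mono) (auto simp: K_def)
    finally show ?thesis .
  qed
  then show ?thesis using K1 by (intro exI[of _ K]) auto
qed

text \<open>For p > 2 the adjoint \<open>star c\<close> has the same bound at the conjugate
  exponent, which is below 2; the resulting decay on L^2 returns to \<open>c\<close> because adjoint
  operators on L^2 have equal norms.\<close>

theorem kunze_stein_power:
  assumes ks: "kunze_stein M" and c: "c \<in> Cc" and p: "1 < p" and r: "0 < r"
    and le: "\<And>h. h \<in> Cc \<Longrightarrow> lp_norm M p (convol M c h) \<le> r * lp_norm M p h"
  shows "\<exists>K\<ge>0. \<forall>n. \<forall>h\<in>Cc. lp_norm M 2 ((convol M c ^^ n) h) \<le> K * r ^ n * lp_norm M 2 h"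
proof -
  consider "p < 2" | "p = 2" | "p > 2" by linarith
  then show ?thesis
  proof cases
    case 1
    show ?thesis by (rule kunze_stein_power_less_2[OF ks c p 1 r le])
  next
    case 2
    then show ?thesis
      using convol_power_bound[OF c _ le] r by (intro exI[of _ 1]) auto
  next
    case 3
    have q: "1 < conj_exp p" "conj_exp p < 2" using conj_exp[OF p] 3 by (auto simp: conj_exp_def field_simps)
    obtain K where K: "K \<ge> 0"
      "\<And>n h. h \<in> Cc \<Longrightarrow> lp_norm M 2 ((convol M (star c) ^^ n) h) \<le> K * r ^ n * lp_norm M 2 h"
      using kunze_stein_power_less_2[OF ks star_Cc[OF c] q r convol_star_dual_bound[OF c p _ le]] r
      by (metis less_imp_le)
    have "lp_norm M 2 ((convol M c ^^ n) h) \<le> K * r ^ n * lp_norm M 2 h" if h: "h \<in> Cc" for n h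
    proof -
      have [simp]: "Rep_cc (Abs_cc c) = c" "Rep_cc (Abs_cc h) = h" using c h by (simp_all add: Abs_cc_inverse)
      have "H.nrm ((cc_mul (cc_star (Abs_cc c)) ^^ n) x) \<le> K * r ^ n * H.nrm x" for x
        using K(2)[OF Rep_cc] by (simp add: cc_nrm Rep_cc_mul_power Rep_cc_star)
      from H.mul_power_bound_adj[OF this, of "Abs_cc h"] show ?thesis
        by (simp add: cc_nrm Rep_cc_mul_power)
    qed
    then show ?thesis using K(1) by blast
  qed
qed

end

section \<open>Pseudofunctions\<close>

text \<open>A chosen representative of the image class, so that estimates can be carried out on
  functions.\<close>

definition op_fun ::
  "'a measure \<Rightarrow> real \<Rightarrow> (('a \<Rightarrow> complex) set \<Rightarrow> ('a \<Rightarrow> complex) set) \<Rightarrow> ('a \<Rightarrow> complex) \<Rightarrow> 'a \<Rightarrow> complex" where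
  "op_fun M p T h = (SOME g. g \<in> lp_fun M p \<and> T (lp_class M p h) = lp_class M p g)"

lemma op_fun:
  assumes T: "T \<in> carrier (bounded_ops M p)" and h: "h \<in> lp_fun M p"
  shows "op_fun M p T h \<in> lp_fun M p" "T (lp_class M p h) = lp_class M p (op_fun M p T h)"
proof -
  have "T (lp_class M p h) \<in> Lp M p" using bounded_opsD(1)[OF T] h by simp
  then have "\<exists>g. g \<in> lp_fun M p \<and> T (lp_class M p h) = lp_class M p g" by (auto simp: Lp_eq)
  from someI_ex[OF this]
  show "op_fun M p T h \<in> lp_fun M p" "T (lp_class M p h) = lp_class M p (op_fun M p T h)"
    unfolding op_fun_def by auto
qed

lemma lp_class_eq_norm:
  assumes "f \<in> lp_fun M p" "g \<in> lp_fun M p" "1 \<le> p"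
  shows "lp_class M p f = lp_class M p g \<longleftrightarrow> lp_norm M p (\<lambda>x. f x - g x) = 0"
proof
  assume "lp_class M p f = lp_class M p g"
  then have "AE x in M. f x = g x" using lp_class_eq_iff assms by blast
  then have "lp_norm M p (\<lambda>x. f x - g x) = lp_norm M p (\<lambda>x. 0)"
    using lp_fun_measurable[OF assms(1)] lp_fun_measurable[OF assms(2)]
    by (intro lp_norm_cong_AE) auto
  then show "lp_norm M p (\<lambda>x. f x - g x) = 0" by simp
next
  assume "lp_norm M p (\<lambda>x. f x - g x) = 0"
  from lp_norm_eq_0D[OF lp_fun_diff[OF assms(1,2)] assms(3) this] assms
  show "lp_class M p f = lp_class M p g" by (simp add: lp_class_eq_iff)
qed

text \<open>Chosen representatives are linear only up to null sets. The second clause keeps what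
  linearity and boundedness together imply for norms of differences.\<close>

definition op_fun_bounded ::
  "'a measure \<Rightarrow> real \<Rightarrow> real \<Rightarrow> (('a \<Rightarrow> complex) set \<Rightarrow> ('a \<Rightarrow> complex) set) \<Rightarrow> bool" where
  "op_fun_bounded M p C T \<longleftrightarrow>
     (\<forall>h\<in>lp_fun M p. lp_norm M p (op_fun M p T h) \<le> C * lp_norm M p h) \<and>
     (\<forall>h\<in>lp_fun M p. \<forall>k\<in>lp_fun M p.
        lp_norm M p (\<lambda>x. op_fun M p T h x - op_fun M p T k x) \<le> C * lp_norm M p (\<lambda>x. h x - k x))"

lemma op_fun_boundedD:
  assumes "op_fun_bounded M p C T" "h \<in> lp_fun M p"
  shows "lp_norm M p (op_fun M p T h) \<le> C * lp_norm M p h"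
    and "k \<in> lp_fun M p \<Longrightarrow>
      lp_norm M p (\<lambda>x. op_fun M p T h x - op_fun M p T k x) \<le> C * lp_norm M p (\<lambda>x. h x - k x)"
  using assms by (auto simp: op_fun_bounded_def)

lemma op_fun_bounded_mono:
  assumes "op_fun_bounded M p C T" "C \<le> D"
  shows "op_fun_bounded M p D T"
proof -
  have "x \<le> D * lp_norm M p g" if "x \<le> C * lp_norm M p g" for x g
    using that mult_right_mono[OF assms(2) lp_norm_nonneg[of M p g]] by linarith
  then show ?thesis using assms(1) unfolding op_fun_bounded_def by blast
qed

lemma op_fun_bounded:
  assumes T: "T \<in> carrier (bounded_ops M p)" and p: "1 \<le> p"
  obtains C where "0 \<le> C" "op_fun_bounded M p C T"
proof -
  obtain C where C: "0 \<le> C" "\<And>X. X \<in> Lp M p \<Longrightarrow> Lp_norm M p (T X) \<le> C * Lp_norm M p X"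
    using bounded_ops_bound[OF T] by metis
  have 1: "lp_norm M p (op_fun M p T h) \<le> C * lp_norm M p h" if h: "h \<in> lp_fun M p" for h
    using C(2)[OF lp_class_in_Lp[OF h]] op_fun[OF T h] h by (simp add: Lp_norm_class)
  have p0: "0 \<le> p" using p by simp
  have 2: "lp_norm M p (\<lambda>x. op_fun M p T h x - op_fun M p T k x) \<le> C * lp_norm M p (\<lambda>x. h x - k x)"
    if h: "h \<in> lp_fun M p" and k: "k \<in> lp_fun M p" for h k
  proof -
    have sub: "lp_class M p (\<lambda>x. u x - w x) = Lp_add M p (lp_class M p u) (Lp_scale M p (-1) (lp_class M p w))"
      if "u \<in> lp_fun M p" "w \<in> lp_fun M p" for u w
      using lp_fun_scale[OF that(2), of "-1"] that p0 by (simp add: Lp_scale_class Lp_add_class)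
    have "T (lp_class M p (\<lambda>x. h x - k x)) = lp_class M p (\<lambda>x. op_fun M p T h x - op_fun M p T k x)"
      using h k op_fun[OF T h] op_fun[OF T k] bounded_opsD(3,4)[OF T] by (simp add: sub)
    then show ?thesis
      using C(2)[OF lp_class_in_Lp[OF lp_fun_diff[OF h k p0]]] lp_fun_diff[OF h k p0]
        lp_fun_diff[OF op_fun(1)[OF T h] op_fun(1)[OF T k] p0]
      by (simp add: Lp_norm_class)
  qed
  show ?thesis using 1 2 by (intro that[OF C(1)]) (simp add: op_fun_bounded_def)
qed

lemma op_fun_bounded_common:
  assumes S: "S \<in> carrier (bounded_ops M p)" and T: "T \<in> carrier (bounded_ops M p)" and p: "1 \<le> p"
  obtains C where "0 \<le> C" "op_fun_bounded M p C S" "op_fun_bounded M p C T"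
proof -
  obtain C where C: "0 \<le> C" "op_fun_bounded M p C S" using op_fun_bounded[OF S p] by blast
  obtain D where D: "0 \<le> D" "op_fun_bounded M p D T" using op_fun_bounded[OF T p] by blast
  show ?thesis
    by (rule that[of "max C D"]) (use C D in \<open>auto intro: op_fun_bounded_mono\<close>)
qed

text \<open>
  Negation in \<open>PF\<close> is a description over the carrier of \<open>PF\<close> itself, so it is meaningful only for
  elements whose negative is known to lie in \<open>PF\<close>.
\<close>

lemma a_inv_PF:
  assumes p: "1 \<le> p" and y: "y \<in> carrier (PF M p)" and n: "op_neg M p y \<in> carrier (PF M p)"
  shows "\<ominus>\<^bsub>PF M p\<^esub> y = op_neg M p y"
proof -
  interpret abelian_group "bounded_ops M p" by (rule abelian_group_bounded_ops[OF p])
  have yb: "y \<in> carrier (bounded_ops M p)" and nb: "op_neg M p y \<in> carrier (bounded_ops M p)"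
    using y n by (auto simp: PF_def)
  have add: "add (PF M p) = add (bounded_ops M p)" "zero (PF M p) = zero (bounded_ops M p)"
    by (simp_all add: PF_def)
  have "(THE x. x \<in> carrier (PF M p) \<and> y \<oplus>\<^bsub>bounded_ops M p\<^esub> x = \<zero>\<^bsub>bounded_ops M p\<^esub>
      \<and> x \<oplus>\<^bsub>bounded_ops M p\<^esub> y = \<zero>\<^bsub>bounded_ops M p\<^esub>) = op_neg M p y"
  proof (rule the_equality)
    show "op_neg M p y \<in> carrier (PF M p) \<and> y \<oplus>\<^bsub>bounded_ops M p\<^esub> op_neg M p y = \<zero>\<^bsub>bounded_ops M p\<^esub>
        \<and> op_neg M p y \<oplus>\<^bsub>bounded_ops M p\<^esub> y = \<zero>\<^bsub>bounded_ops M p\<^esub>"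
      using n op_neg_add[OF p yb] a_comm[OF yb nb] by simp
    fix x assume x: "x \<in> carrier (PF M p) \<and> y \<oplus>\<^bsub>bounded_ops M p\<^esub> x = \<zero>\<^bsub>bounded_ops M p\<^esub>
        \<and> x \<oplus>\<^bsub>bounded_ops M p\<^esub> y = \<zero>\<^bsub>bounded_ops M p\<^esub>"
    then have "x \<in> carrier (bounded_ops M p)" by (simp add: PF_def)
    then have "\<ominus>\<^bsub>bounded_ops M p\<^esub> y = x" using x yb by (intro minus_equality) auto
    moreover have "\<ominus>\<^bsub>bounded_ops M p\<^esub> y = op_neg M p y"
      using op_neg_add[OF p yb] yb nb by (intro minus_equality) auto
    ultimately show "x = op_neg M p y" by simp
  qed
  then show ?thesis by (simp add: a_inv_def m_inv_def add)
qed

context unimodular_haar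
begin

section \<open>Convolution operators and membership in PF\<close>

lemma lambda_p_class:
  assumes f: "f \<in> Cc" and h: "h \<in> lp_fun M p" and p: "1 < p"
  shows "lambda_p M p f (lp_class M p h) = lp_class M p (convol M f h)"
proof -
  have "(\<Union>g\<in>lp_class M p h. ae_eq M p `` {convol M f g}) = lp_class M p (convol M f h)"
  proof (rule lp_class_UN[OF h])
    show "convol M f g \<in> lp_fun M p" if "g \<in> lp_fun M p" for g by (rule convol_lp(1)[OF f that p])
    show "AE x in M. convol M f h x = convol M f g x"
      if "g \<in> lp_fun M p" "AE x in M. h x = g x" for g
      using convol_cong_AE[OF Cc_measurable[OF f] lp_fun_measurable[OF h] lp_fun_measurable[OF that(1)] that(2)]
      by simp
  qed
  then show ?thesis using h by (simp add: lambda_p_def)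
qed

lemma lambda_p_bounded_ops:
  assumes f: "f \<in> Cc" and p: "1 < p"
  shows "lambda_p M p f \<in> carrier (bounded_ops M p)"
proof (rule bounded_opsI)
  have p0: "0 \<le> p" using p by simp
  note [simp] = lambda_p_class[OF f _ p] convol_lp(1)[OF f _ p] Lp_add_class[OF _ _ p0] Lp_scale_class
    lp_fun_add[OF _ _ p0] lp_fun_scale Lp_norm_class
  show "lambda_p M p f X \<in> Lp M p" if "X \<in> Lp M p" for X
    using that by (elim LpE) simp
  show "lambda_p M p f X = undefined" if "X \<notin> Lp M p" for X
    using that by (simp add: lambda_p_def)
  show "lambda_p M p f (Lp_add M p X Y) = Lp_add M p (lambda_p M p f X) (lambda_p M p f Y)"
    if "X \<in> Lp M p" "Y \<in> Lp M p" for X Y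
    using that by (elim LpE) (simp add: convol_add_right[OF f _ _ p])
  show "lambda_p M p f (Lp_scale M p c X) = Lp_scale M p c (lambda_p M p f X)"
    if "X \<in> Lp M p" for c X
    using that by (elim LpE) (simp add: convol_scale_right)
  show "Lp_norm M p (lambda_p M p f X) \<le> (\<integral>t. norm (f t) \<partial>M) * Lp_norm M p X"
    if "X \<in> Lp M p" for X
    using that by (elim LpE) (simp add: convol_lp(2)[OF f _ p])
qed

text \<open>Both sides are bounded in h, and they agree on the approximants of h in C_c; so the norm
  of the difference is below any multiple of the approximation error.\<close>

lemma convol_assoc_lp:
  assumes f: "f \<in> Cc" and g: "g \<in> Cc" and h: "h \<in> lp_fun M p" and p: "1 < p"
  shows "lp_norm M p (\<lambda>x. convol M f (convol M g h) x - convol M (convol M f g) h x) = 0"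
proof -
  have p1: "1 \<le> p" and p0: "0 \<le> p" using p by auto
  obtain k where k: "\<And>n. k n \<in> Cc" "(\<lambda>n. lp_norm M p (\<lambda>x. h x - k n x)) \<longlonglongrightarrow> 0"
    using Cc_approx_sequence[OF h p1] by metis
  have klp: "k n \<in> lp_fun M p" for n by (intro Cc_in_lp_fun k p0)
  define A where "A f = (\<integral>t. norm (f t) \<partial>M)" for f :: "'g \<Rightarrow> complex"
  have A0: "0 \<le> A f" for f by (simp add: A_def)
  have est: "lp_norm M p (\<lambda>x. convol M f (convol M g h) x - convol M (convol M f g) h x)
      \<le> (A f * A g + A (convol M f g)) * lp_norm M p (\<lambda>x. h x - k n x)" for n
  proof -
    define d where "d x = h x - k n x" for x
    have d: "d \<in> lp_fun M p" unfolding d_def by (rule lp_fun_diff[OF h klp p0])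
    have 1: "convol M g d = (\<lambda>s. convol M g h s - convol M g (k n) s)"
      unfolding d_def by (rule convol_diff_right[OF g h klp p])
    have 2: "convol M f (convol M g d) = (\<lambda>s. convol M f (convol M g h) s - convol M f (convol M g (k n)) s)"
      unfolding 1 by (rule convol_diff_right[OF f convol_lp(1)[OF g h p] convol_lp(1)[OF g klp p] p])
    have 3: "convol M (convol M f g) d = (\<lambda>s. convol M (convol M f g) h s - convol M (convol M f g) (k n) s)"
      unfolding d_def by (rule convol_diff_right[OF convol_Cc[OF f g] h klp p])
    have "lp_norm M p (\<lambda>x. convol M f (convol M g h) x - convol M (convol M f g) h x)
      = lp_norm M p (\<lambda>x. convol M f (convol M g d) x - convol M (convol M f g) d x)"
      unfolding 2 3 convol_assoc[OF f g k(1)] by simp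
    also have "\<dots> \<le> lp_norm M p (convol M f (convol M g d)) + lp_norm M p (convol M (convol M f g) d)"
      by (intro lp_norm_triangle_diff convol_lp f g d convol_Cc p p1)
    also have "\<dots> \<le> A f * (A g * lp_norm M p d) + A (convol M f g) * lp_norm M p d"
    proof (rule add_mono)
      have "lp_norm M p (convol M f (convol M g d)) \<le> A f * lp_norm M p (convol M g d)"
        unfolding A_def by (intro convol_lp f g d p)
      also have "\<dots> \<le> A f * (A g * lp_norm M p d)"
        by (intro mult_left_mono A0) (auto simp: A_def intro!: convol_lp g d p)
      finally show "lp_norm M p (convol M f (convol M g d)) \<le> A f * (A g * lp_norm M p d)" .
      show "lp_norm M p (convol M (convol M f g) d) \<le> A (convol M f g) * lp_norm M p d"
        unfolding A_def by (intro convol_lp convol_Cc f g d p)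
    qed
    finally show ?thesis by (simp add: d_def[abs_def] algebra_simps)
  qed
  have "(\<lambda>n. (A f * A g + A (convol M f g)) * lp_norm M p (\<lambda>x. h x - k n x)) \<longlonglongrightarrow> (A f * A g + A (convol M f g)) * 0"
    by (intro tendsto_intros k)
  from LIMSEQ_le_const[OF this] est
  have "lp_norm M p (\<lambda>x. convol M f (convol M g h) x - convol M (convol M f g) h x) \<le> 0" by auto
  then show ?thesis by (simp add: antisym)
qed

definition conv_approx ::
  "real \<Rightarrow> real \<Rightarrow> (('g \<Rightarrow> complex) set \<Rightarrow> ('g \<Rightarrow> complex) set) \<Rightarrow> ('g \<Rightarrow> complex) \<Rightarrow> bool" where
  "conv_approx p e T f \<longleftrightarrow> f \<in> Cc \<and>
     (\<forall>h\<in>lp_fun M p. lp_norm M p (\<lambda>x. op_fun M p T h x - convol M f h x) \<le> e * lp_norm M p h)"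

lemma conv_approxD:
  assumes "conv_approx p e T f"
  shows "f \<in> Cc"
    and "h \<in> lp_fun M p \<Longrightarrow> lp_norm M p (\<lambda>x. op_fun M p T h x - convol M f h x) \<le> e * lp_norm M p h"
  using assms by (auto simp: conv_approx_def)

text \<open>The closure in operator norm becomes an estimate on functions. The converse uses half of
  \<epsilon>, since the supremum turns a strict bound into a weak one.\<close>

lemma PF_iff:
  assumes p: "1 < p"
  shows "T \<in> carrier (PF M p) \<longleftrightarrow> T \<in> carrier (bounded_ops M p) \<and>
    (\<forall>\<epsilon>>0. \<exists>f. conv_approx p \<epsilon> T f)"
    (is "_ \<longleftrightarrow> _ \<and> ?approx")
proof (cases "T \<in> carrier (bounded_ops M p)")
  case T: True
  have p1: "1 \<le> p" and p0: "0 \<le> p" using p by auto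
  interpret abelian_group "bounded_ops M p" by (rule abelian_group_bounded_ops[OF p1])
  have diff_norm: "Lp_norm M p ((T \<ominus>\<^bsub>bounded_ops M p\<^esub> lambda_p M p f) (lp_class M p h))
      = lp_norm M p (\<lambda>x. op_fun M p T h x - convol M f h x)"
    if f: "f \<in> Cc" and h: "h \<in> lp_fun M p" for f h
  proof -
    note c = convol_lp(1)[OF f h p] and o = op_fun[OF T h]
    have "(T \<ominus>\<^bsub>bounded_ops M p\<^esub> lambda_p M p f) (lp_class M p h)
        = lp_class M p (\<lambda>x. op_fun M p T h x + - 1 * convol M f h x)"
      unfolding bounded_ops_minus_apply[OF p1 lambda_p_bounded_ops[OF f p] lp_class_in_Lp[OF h]]
        lambda_p_class[OF f h p] o(2) Lp_scale_class[OF c] Lp_add_class[OF o(1) lp_fun_scale[OF c] p0] ..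
    then show ?thesis using Lp_norm_class[OF lp_fun_diff[OF o(1) c p0]] by simp
  qed
  have closed: "T \<ominus>\<^bsub>bounded_ops M p\<^esub> lambda_p M p f \<in> carrier (bounded_ops M p)" if "f \<in> Cc" for f
    using T lambda_p_bounded_ops[OF that p] by (rule minus_closed)
  have "(\<forall>\<epsilon>>0. \<exists>f\<in>Cc. op_norm M p (T \<ominus>\<^bsub>bounded_ops M p\<^esub> lambda_p M p f) < \<epsilon>) \<longleftrightarrow> ?approx"
  proof (intro iffI allI impI)
    fix \<epsilon> :: real assume e: "0 < \<epsilon>"
    assume "\<forall>\<epsilon>>0. \<exists>f\<in>Cc. op_norm M p (T \<ominus>\<^bsub>bounded_ops M p\<^esub> lambda_p M p f) < \<epsilon>"
    with e obtain f where f: "f \<in> Cc" "op_norm M p (T \<ominus>\<^bsub>bounded_ops M p\<^esub> lambda_p M p f) < \<epsilon>" by blast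
    have "lp_norm M p (\<lambda>x. op_fun M p T h x - convol M f h x) \<le> \<epsilon> * lp_norm M p h"
      if h: "h \<in> lp_fun M p" for h
      using op_norm_bound[OF p1 closed[OF f(1)] lp_class_in_Lp[OF h]]
        mult_right_mono[OF less_imp_le[OF f(2)] lp_norm_nonneg[of M p h]]
      unfolding diff_norm[OF f(1) h] Lp_norm_class[OF h] by linarith
    then show "\<exists>f. conv_approx p \<epsilon> T f" using f(1) by (auto simp: conv_approx_def)
  next
    fix \<epsilon> :: real assume e: "0 < \<epsilon>"
    assume ?approx
    with half_gt_zero[OF e] obtain f where "conv_approx p (\<epsilon> / 2) T f" by blast
    note f = conv_approxD[OF this]
    have "op_norm M p (T \<ominus>\<^bsub>bounded_ops M p\<^esub> lambda_p M p f) \<le> \<epsilon> / 2"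
    proof (rule op_norm_le)
      fix X assume "X \<in> Lp M p"
      then obtain h where h: "h \<in> lp_fun M p" and X: "X = lp_class M p h" by (rule LpE)
      show "Lp_norm M p ((T \<ominus>\<^bsub>bounded_ops M p\<^esub> lambda_p M p f) X) \<le> \<epsilon> / 2 * Lp_norm M p X"
        unfolding X diff_norm[OF f(1) h] Lp_norm_class[OF h] by (rule f(2)[OF h])
    qed (use e in simp)
    then show "\<exists>f\<in>Cc. op_norm M p (T \<ominus>\<^bsub>bounded_ops M p\<^esub> lambda_p M p f) < \<epsilon>"
      using f(1) e by (intro bexI[of _ f]) auto
  qed
  then show ?thesis using T by (simp add: PF_def)
qed (simp add: PF_def)

text \<open>Write S T - a b = S (T - b) + (S - a) b. The norm of b is at most C + e, hence at most C
  + 1, and the two errors add up to C e + e (C + 1).\<close>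

lemma approx_product:
  assumes S: "S \<in> carrier (bounded_ops M p)" and T: "T \<in> carrier (bounded_ops M p)" and p: "1 < p"
    and aS: "conv_approx p e S a" and bT: "conv_approx p e T b"
    and C: "0 \<le> C" "op_fun_bounded M p C S" "op_fun_bounded M p C T"
    and e: "0 < e" "e \<le> 1" and h: "h \<in> lp_fun M p"
  shows "lp_norm M p (\<lambda>x. op_fun M p S (op_fun M p T h) x - convol M a (convol M b h) x)
    \<le> (2 * C + 1) * e * lp_norm M p h"
proof -
  note a = conv_approxD[OF aS] and b = conv_approxD[OF bT]
  have p1: "1 \<le> p" and p0: "0 \<le> p" using p by auto
  define N where "N = lp_norm M p h"
  have N: "0 \<le> N" by (simp add: N_def)
  define u where "u = op_fun M p T h"
  define w where "w = convol M b h"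
  have u: "u \<in> lp_fun M p" unfolding u_def by (rule op_fun(1)[OF T h])
  have w: "w \<in> lp_fun M p" unfolding w_def by (rule convol_lp(1)[OF b(1) h p])
  have uw: "lp_norm M p (\<lambda>x. u x - w x) \<le> e * N"
    using b(2)[OF h] by (simp add: u_def w_def N_def)
  have "lp_norm M p w \<le> lp_norm M p u + lp_norm M p (\<lambda>x. u x - w x)"
    using lp_norm_triangle_diff[OF u lp_fun_diff[OF u w p0] p1] by simp
  also have "\<dots> \<le> C * N + e * N"
    using uw op_fun_boundedD(1)[OF C(3) h] by (simp add: u_def N_def)
  also have "\<dots> \<le> (C + 1) * N" using e N mult_right_mono[of e 1 N] by (simp add: algebra_simps)
  finally have wN: "lp_norm M p w \<le> (C + 1) * N" .
  have "lp_norm M p (\<lambda>x. op_fun M p S u x - convol M a w x)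
      \<le> lp_norm M p (\<lambda>x. op_fun M p S u x - op_fun M p S w x) + lp_norm M p (\<lambda>x. op_fun M p S w x - convol M a w x)"
    by (intro lp_norm_dist_triangle op_fun[OF S] u w convol_lp a p p1)
  also have "\<dots> \<le> C * (e * N) + e * ((C + 1) * N)"
    using e order_trans[OF op_fun_boundedD(2)[OF C(2) u w] mult_left_mono[OF uw C(1)]]
      order_trans[OF a(2)[OF w] mult_left_mono[OF wN, of e]] by (intro add_mono) auto
  also have "\<dots> = (2 * C + 1) * e * N" by (simp add: algebra_simps)
  finally show ?thesis by (simp add: u_def w_def N_def)
qed

lemma op_fun_mult:
  assumes p: "1 \<le> p" and S: "S \<in> carrier (bounded_ops M p)" and T: "T \<in> carrier (bounded_ops M p)"
    and h: "h \<in> lp_fun M p"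
  shows "lp_class M p (op_fun M p (S \<otimes>\<^bsub>bounded_ops M p\<^esub> T) h) = lp_class M p (op_fun M p S (op_fun M p T h))"
proof -
  note ST = bounded_ops_mult_closed[OF p S T]
  have "lp_class M p (op_fun M p (S \<otimes>\<^bsub>bounded_ops M p\<^esub> T) h) = S (T (lp_class M p h))"
    unfolding op_fun(2)[OF ST h, symmetric] by (rule bounded_ops_mult_apply[OF lp_class_in_Lp[OF h]])
  then show ?thesis
    unfolding op_fun(2)[OF T h] op_fun(2)[OF S op_fun(1)[OF T h]] .
qed

lemma lp_norm_le_of_zero_dist:
  assumes "f \<in> lp_fun M p" "g \<in> lp_fun M p" "k \<in> lp_fun M p" "1 \<le> p"
    and "lp_norm M p (\<lambda>x. f x - g x) = 0"
  shows "lp_norm M p (\<lambda>x. f x - k x) \<le> lp_norm M p (\<lambda>x. g x - k x)"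
  using lp_norm_dist_triangle[OF assms(1-4)] assms(5) by simp

text \<open>The subtraction in \<open>bullet\<close> negates a product over the carrier of PF, so
  the product has to lie there; convolution of the approximants shows that it does.\<close>

lemma PF_mult_closed:
  assumes p: "1 < p" and S: "S \<in> carrier (PF M p)" and T: "T \<in> carrier (PF M p)"
  shows "S \<otimes>\<^bsub>bounded_ops M p\<^esub> T \<in> carrier (PF M p)"
proof -
  have p1: "1 \<le> p" and p0: "0 \<le> p" using p by auto
  have Sb: "S \<in> carrier (bounded_ops M p)" and Tb: "T \<in> carrier (bounded_ops M p)"
    using S T by (auto simp: PF_def)
  note STb = bounded_ops_mult_closed[OF p1 Sb Tb]
  obtain C where C: "0 \<le> C" "op_fun_bounded M p C S" "op_fun_bounded M p C T"
    using op_fun_bounded_common[OF Sb Tb p1] by blast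
  show ?thesis
    unfolding PF_iff[OF p]
  proof (intro conjI allI impI STb)
    fix \<epsilon> :: real assume \<epsilon>: "0 < \<epsilon>"
    \<comment> \<open>\<open>approx_product\<close> asks for e at most 1 and loses the factor 2 * C
      + 1.\<close>
    define e where "e = min 1 (\<epsilon> / (2 * C + 1))"
    have e: "0 < e" "e \<le> 1" using \<epsilon> C(1) by (auto simp: e_def)
    have "(2 * C + 1) * e \<le> (2 * C + 1) * (\<epsilon> / (2 * C + 1))"
      using C(1) by (intro mult_left_mono) (auto simp: e_def)
    also have "\<dots> = \<epsilon>" using C(1) by simp
    finally have e\<epsilon>: "(2 * C + 1) * e \<le> \<epsilon>" .
    obtain a b where ab: "conv_approx p e S a" "conv_approx p e T b"
      using S T e unfolding PF_iff[OF p] by blast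
    note a = conv_approxD[OF ab(1)] and b = conv_approxD[OF ab(2)]
    show "\<exists>f. conv_approx p \<epsilon> (S \<otimes>\<^bsub>bounded_ops M p\<^esub> T) f"
      unfolding conv_approx_def
    proof (intro exI conjI ballI)
      show "convol M a b \<in> Cc" by (rule convol_Cc[OF a(1) b(1)])
      fix h assume h: "h \<in> lp_fun M p"
      note Th = op_fun(1)[OF Tb h]
      note STh = op_fun(1)[OF Sb Th]
      note bh = convol_lp(1)[OF b(1) h p]
      note abh = convol_lp(1)[OF a(1) bh p]
      note abh' = convol_lp(1)[OF convol_Cc[OF a(1) b(1)] h p]
      have z: "lp_norm M p (\<lambda>x. op_fun M p (S \<otimes>\<^bsub>bounded_ops M p\<^esub> T) h x - op_fun M p S (op_fun M p T h) x) = 0"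
        using op_fun_mult[OF p1 Sb Tb h] lp_class_eq_norm[OF op_fun(1)[OF STb h] STh p1] by simp
      have "lp_norm M p (\<lambda>x. op_fun M p (S \<otimes>\<^bsub>bounded_ops M p\<^esub> T) h x - convol M (convol M a b) h x)
        \<le> lp_norm M p (\<lambda>x. op_fun M p S (op_fun M p T h) x - convol M (convol M a b) h x)"
        by (rule lp_norm_le_of_zero_dist[OF op_fun(1)[OF STb h] STh abh' p1 z])
      also have "\<dots> \<le> lp_norm M p (\<lambda>x. op_fun M p S (op_fun M p T h) x - convol M a (convol M b h) x)"
        using lp_norm_dist_triangle[OF STh abh abh' p1] convol_assoc_lp[OF a(1) b(1) h p] by simp
      also have "\<dots> \<le> (2 * C + 1) * e * lp_norm M p h"
        by (rule approx_product[OF Sb Tb p ab C e h])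
      also have "\<dots> \<le> \<epsilon> * lp_norm M p h" using e\<epsilon> by (intro mult_right_mono) auto
      finally show "lp_norm M p (\<lambda>x. op_fun M p (S \<otimes>\<^bsub>bounded_ops M p\<^esub> T) h x - convol M (convol M a b) h x)
        \<le> \<epsilon> * lp_norm M p h" .
    qed
  qed
qed

lemma PF_neg_closed:
  assumes p: "1 < p" and T: "T \<in> carrier (PF M p)"
  shows "op_neg M p T \<in> carrier (PF M p)"
proof -
  have p1: "1 \<le> p" and p0: "0 \<le> p" using p by auto
  have Tb: "T \<in> carrier (bounded_ops M p)" using T by (auto simp: PF_def)
  note nb = op_neg_closed[OF p1 Tb]
  show ?thesis
    unfolding PF_iff[OF p]
  proof (intro conjI allI impI nb)
    fix \<epsilon> :: real assume \<epsilon>: "0 < \<epsilon>"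
    obtain b where "conv_approx p \<epsilon> T b" using T \<epsilon> unfolding PF_iff[OF p] by blast
    note b = conv_approxD[OF this]
    show "\<exists>f. conv_approx p \<epsilon> (op_neg M p T) f"
      unfolding conv_approx_def
    proof (intro exI conjI ballI)
      show "(\<lambda>x. - 1 * b x) \<in> Cc" by (rule Cc_scale[OF b(1)])
      fix h assume h: "h \<in> lp_fun M p"
      note Th = op_fun[OF Tb h] and nh = op_fun[OF nb h]
      note Th' = lp_fun_scale[OF Th(1), of "-1"]
      note bh = lp_fun_scale[OF convol_lp(1)[OF b(1) h p], of "-1"]
      have "lp_class M p (op_fun M p (op_neg M p T) h) = lp_class M p (\<lambda>x. - 1 * op_fun M p T h x)"
        unfolding nh(2)[symmetric] using h Th by (simp add: op_neg_def Lp_scale_class)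
      then have z: "lp_norm M p (\<lambda>x. op_fun M p (op_neg M p T) h x - - 1 * op_fun M p T h x) = 0"
        using lp_class_eq_norm[OF nh(1) Th' p1] by simp
      have "lp_norm M p (\<lambda>x. op_fun M p (op_neg M p T) h x - convol M (\<lambda>x. - 1 * b x) h x)
        \<le> lp_norm M p (\<lambda>x. - 1 * op_fun M p T h x - - 1 * convol M b h x)"
        unfolding convol_scale_left by (rule lp_norm_le_of_zero_dist[OF nh(1) Th' bh p1 z])
      also have "\<dots> = lp_norm M p (\<lambda>x. op_fun M p T h x - convol M b h x)"
        by (simp add: lp_norm_minus_commute)
      also have "\<dots> \<le> \<epsilon> * lp_norm M p h" by (rule b(2)[OF h])
      finally show "lp_norm M p (\<lambda>x. op_fun M p (op_neg M p T) h x - convol M (\<lambda>x. - 1 * b x) h x) \<le> \<epsilon> * lp_norm M p h" .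
    qed
  qed
qed

section \<open>The operation bullet on representatives\<close>

definition bullet_fun where
  "bullet_fun p S T h = (\<lambda>x. (op_fun M p S h x + op_fun M p T h x) - op_fun M p S (op_fun M p T h) x)"

lemma bullet_fun_lp:
  assumes "S \<in> carrier (bounded_ops M p)" "T \<in> carrier (bounded_ops M p)" "h \<in> lp_fun M p" "0 \<le> p"
  shows "bullet_fun p S T h \<in> lp_fun M p"
  unfolding bullet_fun_def using assms by (intro lp_fun_diff lp_fun_add op_fun(1))

text \<open>Turns both the hypothesis and the conclusion of direct finiteness into statements about
  norms of functions. Closure under products and negatives makes the subtraction in PF the pointwise
  one.\<close>

lemma bullet_PF_eq_zero_iff:
  assumes p: "1 < p" and S: "S \<in> carrier (PF M p)" and T: "T \<in> carrier (PF M p)"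
  shows "bullet (PF M p) S T = \<zero>\<^bsub>PF M p\<^esub> \<longleftrightarrow>
    (\<forall>h\<in>lp_fun M p. lp_norm M p (bullet_fun p S T h) = 0)"
proof -
  have p1: "1 \<le> p" and p0: "0 \<le> p" using p by auto
  have Sb: "S \<in> carrier (bounded_ops M p)" and Tb: "T \<in> carrier (bounded_ops M p)"
    using S T by (auto simp: PF_def)
  note ST = PF_mult_closed[OF p S T]
  have PF_ops: "add (PF M p) = add (bounded_ops M p)" "zero (PF M p) = zero (bounded_ops M p)"
    "mult (PF M p) = mult (bounded_ops M p)"
    by (simp_all add: PF_def)
  have b: "bullet (PF M p) S T = (\<lambda>X\<in>Lp M p. Lp_add M p (Lp_add M p (S X) (T X)) (Lp_scale M p (-1) (S (T X))))"
    unfolding bullet_def a_minus_def PF_ops a_inv_PF[OF p1 ST PF_neg_closed[OF p ST]]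
    by (auto simp: bounded_ops_def op_neg_def compose_def restrict_def fun_eq_iff)
  have z: "\<zero>\<^bsub>PF M p\<^esub> = (\<lambda>X\<in>Lp M p. Lp_zero M p)"
    by (simp add: PF_ops bounded_ops_def)
  have "bullet (PF M p) S T = \<zero>\<^bsub>PF M p\<^esub> \<longleftrightarrow>
      (\<forall>X\<in>Lp M p. Lp_add M p (Lp_add M p (S X) (T X)) (Lp_scale M p (-1) (S (T X))) = Lp_zero M p)"
    unfolding b z restrict_def by metis
  also have "\<dots> \<longleftrightarrow> (\<forall>h\<in>lp_fun M p.
      Lp_add M p (Lp_add M p (S (lp_class M p h)) (T (lp_class M p h)))
        (Lp_scale M p (-1) (S (T (lp_class M p h)))) = Lp_zero M p)"
    by (simp add: Lp_eq)
  also have "\<dots> \<longleftrightarrow>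
    (\<forall>h\<in>lp_fun M p. lp_norm M p (bullet_fun p S T h) = 0)"
  proof (rule ball_cong[OF refl])
    fix h assume h: "h \<in> lp_fun M p"
    note Sh = op_fun[OF Sb h] and Th = op_fun[OF Tb h]
    note STh = op_fun[OF Sb Th(1)]
    note sum = lp_fun_add[OF Sh(1) Th(1) p0]
    have "Lp_add M p (Lp_add M p (S (lp_class M p h)) (T (lp_class M p h))) (Lp_scale M p (-1) (S (T (lp_class M p h))))
      = lp_class M p (\<lambda>x. (op_fun M p S h x + op_fun M p T h x) + - 1 * op_fun M p S (op_fun M p T h) x)"
      unfolding Sh(2) Th(2) STh(2) Lp_scale_class[OF STh(1)] Lp_add_class[OF Sh(1) Th(1) p0]
        Lp_add_class[OF sum lp_fun_scale[OF STh(1)] p0] ..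
    then show "Lp_add M p (Lp_add M p (S (lp_class M p h)) (T (lp_class M p h)))
        (Lp_scale M p (-1) (S (T (lp_class M p h)))) = Lp_zero M p \<longleftrightarrow>
      lp_norm M p (bullet_fun p S T h) = 0"
      unfolding Lp_zero_class
      using lp_class_eq_norm[OF lp_fun_diff[OF sum STh(1) p0] lp_fun_zero p1] by (simp add: bullet_fun_def)
  qed
  finally show ?thesis .
qed

end

section \<open>Direct finiteness of PF\<close>

lemma sum_powers_le_half:
  fixes r :: real
  assumes "0 \<le> r" "r \<le> 1 / 2"
  shows "(\<Sum>j\<in>{1..n}. r ^ j) \<le> 2 * r"
proof -
  \<comment> \<open>The extra factor 1 - (1 / 2)^n is what makes the induction close.\<close>
  have "(\<Sum>j\<in>{1..n}. r ^ j) \<le> 2 * r * (1 - (1 / 2) ^ n)"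
  proof (induction n)
    case (Suc n)
    have "r * r ^ n \<le> r * (1 / 2) ^ n"
      using assms by (intro mult_left_mono power_mono) auto
    then show ?case using Suc by (simp add: algebra_simps)
  qed simp
  also have "\<dots> \<le> 2 * r * 1" using assms by (intro mult_left_mono) auto
  finally show ?thesis by simp
qed

context unimodular_haar
begin

text \<open>One error e for each of the two linear terms and (2 C + 1) e for the product.\<close>

lemma approx_bullet:
  assumes S: "S \<in> carrier (bounded_ops M p)" and T: "T \<in> carrier (bounded_ops M p)" and p: "1 < p"
    and ab: "conv_approx p e S a" "conv_approx p e T b"
    and C: "0 \<le> C" "op_fun_bounded M p C S" "op_fun_bounded M p C T"
    and e: "0 < e" "e \<le> 1" and h: "h \<in> lp_fun M p"
  shows "lp_norm M p (\<lambda>x. bullet_fun p S T h x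
      - ((convol M a h x + convol M b h x) - convol M a (convol M b h) x))
    \<le> (2 * C + 3) * e * lp_norm M p h"
proof -
  note a = conv_approxD[OF ab(1)] and b = conv_approxD[OF ab(2)]
  have p1: "1 \<le> p" and p0: "0 \<le> p" using p by auto
  note Sh = op_fun(1)[OF S h] and Th = op_fun(1)[OF T h]
  note STh = op_fun(1)[OF S Th]
  note ah = convol_lp(1)[OF a(1) h p] and bh = convol_lp(1)[OF b(1) h p]
  note abh = convol_lp(1)[OF a(1) bh p]
  note d1 = lp_fun_diff[OF Sh ah p0] and d2 = lp_fun_diff[OF Th bh p0] and d3 = lp_fun_diff[OF STh abh p0]
  have "lp_norm M p (\<lambda>x. bullet_fun p S T h x
      - ((convol M a h x + convol M b h x) - convol M a (convol M b h) x))
    = lp_norm M p (\<lambda>x. ((op_fun M p S h x - convol M a h x) + (op_fun M p T h x - convol M b h x))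
      - (op_fun M p S (op_fun M p T h) x - convol M a (convol M b h) x))"
    by (simp add: bullet_fun_def algebra_simps)
  also have "\<dots> \<le> lp_norm M p (\<lambda>x. op_fun M p S h x - convol M a h x)
      + lp_norm M p (\<lambda>x. op_fun M p T h x - convol M b h x)
      + lp_norm M p (\<lambda>x. op_fun M p S (op_fun M p T h) x - convol M a (convol M b h) x)"
    using lp_norm_triangle_diff[OF lp_fun_add[OF d1 d2 p0] d3 p1] Minkowski_lp_norm[OF d1 d2 p1] by simp
  also have "\<dots> \<le> e * lp_norm M p h + e * lp_norm M p h + (2 * C + 1) * e * lp_norm M p h"
    by (intro add_mono a(2) b(2) h approx_product[OF S T p ab C e h])
  also have "\<dots> = (2 * C + 3) * e * lp_norm M p h" by (simp add: algebra_simps)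
  finally show ?thesis .
qed

text \<open>The factor in front of e depends on C and the norms of h and k alone. The Kunze--Stein
  constant, which depends on the approximants, enters only the L^2 limit and is gone once n tends to
  infinity.\<close>

lemma bullet_pairing_bound:
  assumes ks: "kunze_stein M" and p: "1 < p"
    and S: "S \<in> carrier (bounded_ops M p)" and T: "T \<in> carrier (bounded_ops M p)"
    and ab: "conv_approx p e S a" "conv_approx p e T b"
    and C: "0 \<le> C" "op_fun_bounded M p C S" "op_fun_bounded M p C T"
    and e: "0 < e" "(2 * C + 3) * e \<le> 1 / 2"
    and zero: "\<And>h. h \<in> lp_fun M p \<Longrightarrow> lp_norm M p (bullet_fun p S T h) = 0"
    and h: "h \<in> Cc" and k: "k \<in> Cc"
  shows "\<bar>Re (\<integral>x. bullet_fun p T S h x * cnj (k x) \<partial>M)\<bar>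
    \<le> (2 * C + 3) * e * (1 + 2 * (C + 2)\<^sup>2) * lp_norm M p h * lp_norm M (conj_exp p) k"
proof -
  note a = conv_approxD[OF ab(1)] and b = conv_approxD[OF ab(2)]
  have p1: "1 \<le> p" and p0: "0 \<le> p" using p by auto
  note lp = Rep_cc_lp[OF p0]
  \<comment> \<open>Bounds c = a + b - a b on L^p, as S bullet T vanishes. It is also the ratio of
    the geometric series, which being at most 1/2 has tail at most 2 r.\<close>
  define r where "r = (2 * C + 3) * e"
  have r: "0 < r" "r \<le> 1 / 2" using C(1) e by (auto simp: r_def)
  have "1 * e \<le> (2 * C + 3) * e" using C(1) e by (intro mult_right_mono) auto
  then have e1: "e \<le> 1" using e by linarith
  define pn where "pn z = lp_norm M p (Rep_cc z)" for z :: "'g cc"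
  have pn0: "0 \<le> pn z" for z by (simp add: pn_def)
  have pn_add: "pn (z + w) \<le> pn z + pn w" for z w
    unfolding pn_def Rep_cc_simps by (rule Minkowski_lp_norm[OF lp lp p1])
  have pn_diff: "pn (z - w) \<le> pn z + pn w" for z w
    unfolding pn_def Rep_cc_simps by (rule lp_norm_triangle_diff[OF lp lp p1])
  have pn_sum: "pn (\<Sum>i\<in>I. f i) \<le> (\<Sum>i\<in>I. pn (f i))" for f :: "nat \<Rightarrow> 'g cc" and I
  proof (induction I rule: infinite_finite_induct)
    case (insert i I)
    then show ?case using pn_add[of "f i" "\<Sum>i\<in>I. f i"] by simp
  qed (simp_all add: pn_def Rep_cc_simps)
  define a' where "a' = Abs_cc a"
  define b' where "b' = Abs_cc b"
  define x where "x = Abs_cc h"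
  define k' where "k' = Abs_cc k"
  have [simp]: "Rep_cc a' = a" "Rep_cc b' = b" "Rep_cc x = h" "Rep_cc k' = k"
    using a(1) b(1) h k by (simp_all add: a'_def b'_def x_def k'_def Abs_cc_inverse)
  \<comment> \<open>The norm of f is at most C + e, hence 1 - f has norm at most 1 + C + 1.\<close>
  have one_minus: "pn (z - cc_mul f z) \<le> (C + 2) * pn z"
    if f: "\<And>h. h \<in> lp_fun M p \<Longrightarrow> lp_norm M p (\<lambda>x. op_fun M p R h x - convol M (Rep_cc f) h x) \<le> e * lp_norm M p h"
      and R: "R \<in> carrier (bounded_ops M p)" "op_fun_bounded M p C R" for f z R
  proof -
    note Rz = op_fun(1)[OF R(1) lp[of z]]
    note fz = convol_lp(1)[OF Rep_cc[of f] lp[of z] p]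
    have "pn (cc_mul f z) \<le> lp_norm M p (op_fun M p R (Rep_cc z))
        + lp_norm M p (\<lambda>x. op_fun M p R (Rep_cc z) x - convol M (Rep_cc f) (Rep_cc z) x)"
      using lp_norm_triangle_diff[OF Rz lp_fun_diff[OF Rz fz p0] p1] by (simp add: pn_def Rep_cc_mul)
    also have "\<dots> \<le> C * pn z + e * pn z"
      unfolding pn_def by (intro add_mono f lp op_fun_boundedD(1)[OF R(2)])
    also have "\<dots> \<le> C * pn z + 1 * pn z" using e1 pn0[of z] by (intro add_left_mono mult_right_mono)
    finally show ?thesis using pn_diff[of z "cc_mul f z"] by (simp add: algebra_simps)
  qed
  define A where "A z = z - cc_mul a' z" for z
  define B where "B z = z - cc_mul b' z" for z
  have A: "pn (A z) \<le> (C + 2) * pn z" and B: "pn (B z) \<le> (C + 2) * pn z" for z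
    using one_minus[of S a' z] one_minus[of T b' z] a b S T C by (simp_all add: A_def B_def)
  define c where "c = a' + b' - cc_mul a' b'"
  have c_mul: "cc_mul c z = (cc_mul a' z + cc_mul b' z) - cc_mul a' (cc_mul b' z)" for z
    by (simp add: c_def H.mul_simps)
  have c_bound: "pn (cc_mul c z) \<le> r * pn z" for z
  proof -
    let ?u = "bullet_fun p S T (Rep_cc z)"
    note u = bullet_fun_lp[OF S T lp[of z] p0]
    have "pn (cc_mul c z) \<le> lp_norm M p ?u + lp_norm M p (\<lambda>x. ?u x - Rep_cc (cc_mul c z) x)"
      using lp_norm_triangle_diff[OF u lp_fun_diff[OF u lp[of "cc_mul c z"] p0] p1] by (simp add: pn_def)
    also have "\<dots> \<le> 0 + r * pn z"
      using zero[OF lp[of z]] approx_bullet[OF S T p ab C e(1) e1 lp[of z]]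
      by (intro add_mono) (simp_all add: c_mul Rep_cc_simps Rep_cc_mul r_def pn_def)
    finally show ?thesis by simp
  qed
  have "lp_norm M p (convol M (Rep_cc c) g) \<le> r * lp_norm M p g" if "g \<in> Cc" for g
    using c_bound[of "Abs_cc g"] that by (simp add: pn_def Rep_cc_mul Abs_cc_inverse)
  then obtain K where K: "0 \<le> K"
      "\<And>n g. g \<in> Cc \<Longrightarrow> lp_norm M 2 ((convol M (Rep_cc c) ^^ n) g) \<le> K * r ^ n * lp_norm M 2 g"
    using kunze_stein_power[OF ks Rep_cc p r(1)] by metis
  define v where "v n = x - B (\<Sum>j\<le>n. (cc_mul c ^^ j) (A x))" for n
  have lim: "(\<lambda>n. cc_ip (v n) k') \<longlonglongrightarrow> 0"
    using H.quasi_inverse_weak_limit[of r K a' b' x k'] r K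
    by (simp add: cc_nrm Rep_cc_mul_power Rep_cc v_def A_def B_def c_def Let_def)
  define W where "W = bullet_fun p T S h"
  note hlp = Cc_in_lp_fun[OF h p0]
  have W: "W \<in> lp_fun M p" unfolding W_def by (rule bullet_fun_lp[OF T S hlp p0])
  \<comment> \<open>One r comes from replacing W by w. The other part is the tail of the series, at
    most 2 r, between A and B, each of norm at most C + 2.\<close>
  define D where "D = r * (1 + 2 * (C + 2)\<^sup>2) * lp_norm M p h"
  have close: "lp_norm M p (\<lambda>s. W s - Rep_cc (v n) s) \<le> D" for n
  proof -
    \<comment> \<open>The summand j = 0 contributes h - B (A h), which is b bullet a applied to h
      and hence close to (T bullet S) h; all other summands carry a power of c.\<close>
    define y where "y = (\<Sum>j\<in>{1..n}. (cc_mul c ^^ j) (A x))"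
    define w where "w = (cc_mul b' x + cc_mul a' x) - cc_mul b' (cc_mul a' x)"
    have "{..n} = insert 0 {1..n}" by auto
    then have "(\<Sum>j\<le>n. (cc_mul c ^^ j) (A x)) = A x + y" by (simp add: y_def)
    then have "v n = x - B (A x + y)" by (simp only: v_def)
    then have v: "v n = w - B y"
      by (simp add: w_def A_def B_def H.mul_simps algebra_simps)
    have pow: "pn ((cc_mul c ^^ j) z) \<le> r ^ j * pn z" for j z
    proof (induction j)
      case (Suc j)
      have "pn ((cc_mul c ^^ Suc j) z) \<le> r * pn ((cc_mul c ^^ j) z)" using c_bound by simp
      also have "\<dots> \<le> r * (r ^ j * pn z)" using r by (intro mult_left_mono Suc) auto
      finally show ?case by (simp add: mult.assoc)
    qed simp
    have "pn y \<le> (\<Sum>j\<in>{1..n}. r ^ j * pn (A x))"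
      unfolding y_def by (rule order_trans[OF pn_sum sum_mono[OF pow]])
    also have "\<dots> = (\<Sum>j\<in>{1..n}. r ^ j) * pn (A x)" by (simp add: sum_distrib_right)
    also have "\<dots> \<le> 2 * r * ((C + 2) * pn x)"
      using r C(1) by (intro mult_mono A sum_powers_le_half) (auto simp: pn0)
    finally have y: "pn y \<le> 2 * r * ((C + 2) * pn x)" .
    have "pn (B y) \<le> (C + 2) * pn y" by (rule B)
    also have "\<dots> \<le> (C + 2) * (2 * r * ((C + 2) * pn x))"
      using C(1) by (intro mult_left_mono y) auto
    finally have By: "pn (B y) \<le> 2 * r * (C + 2)\<^sup>2 * pn x"
      by (simp add: power2_eq_square ac_simps)
    have Ww: "lp_norm M p (\<lambda>s. W s - Rep_cc w s) \<le> r * pn x"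
      using approx_bullet[OF T S p ab(2,1) C(1,3,2) e(1) e1 hlp]
      by (simp add: W_def w_def Rep_cc_simps Rep_cc_mul r_def pn_def)
    have "lp_norm M p (\<lambda>s. W s - Rep_cc (v n) s) \<le> lp_norm M p (\<lambda>s. W s - Rep_cc w s)
        + lp_norm M p (\<lambda>s. Rep_cc w s - Rep_cc (v n) s)"
      by (rule lp_norm_dist_triangle[OF W lp lp p1])
    also have "lp_norm M p (\<lambda>s. Rep_cc w s - Rep_cc (v n) s) = pn (B y)"
      by (simp add: v pn_def Rep_cc_simps)
    finally show ?thesis using Ww By by (simp add: D_def pn_def algebra_simps)
  qed
  let ?q = "conj_exp p"
  have kq: "k \<in> lp_fun M ?q" using conj_exp(1)[OF p] by (intro Cc_in_lp_fun k) auto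
  have est: "\<bar>Re (\<integral>s. W s * cnj (k s) \<partial>M)\<bar> \<le> D * lp_norm M ?q k + \<bar>cc_ip (v n) k'\<bar>" for n
  proof -
    note d = lp_fun_diff[OF W lp[of "v n"] p0]
    note i1 = pairing_bound[OF d kq p] and i2 = pairing_bound(1)[OF lp[of "v n"] kq p]
    have "(\<integral>s. W s * cnj (k s) \<partial>M) = (\<integral>s. (W s - Rep_cc (v n) s) * cnj (k s) + Rep_cc (v n) s * cnj (k s) \<partial>M)"
      by (simp add: algebra_simps)
    also have "\<dots> = (\<integral>s. (W s - Rep_cc (v n) s) * cnj (k s) \<partial>M) + (\<integral>s. Rep_cc (v n) s * cnj (k s) \<partial>M)"
      by (rule Bochner_Integration.integral_add[OF i1(1) i2])
    finally have "Re (\<integral>s. W s * cnj (k s) \<partial>M) = Re (\<integral>s. (W s - Rep_cc (v n) s) * cnj (k s) \<partial>M) + cc_ip (v n) k'"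
      by (simp add: cc_ip_def)
    moreover have "\<bar>Re (\<integral>s. (W s - Rep_cc (v n) s) * cnj (k s) \<partial>M)\<bar> \<le> D * lp_norm M ?q k"
      using i1(2) mult_right_mono[OF close[of n] lp_norm_nonneg[of M ?q k]]
        abs_Re_le_cmod[of "\<integral>s. (W s - Rep_cc (v n) s) * cnj (k s) \<partial>M"] by linarith
    ultimately show ?thesis by linarith
  qed
  \<comment> \<open>Only the weak L^2 term depends on n, so it can be sent to 0 with the
    approximants fixed.\<close>
  have "(\<lambda>n. D * lp_norm M ?q k + \<bar>cc_ip (v n) k'\<bar>) \<longlonglongrightarrow> D * lp_norm M ?q k + \<bar>0\<bar>"
    by (intro tendsto_intros lim)
  from LIMSEQ_le_const[OF this] est have "\<bar>Re (\<integral>s. W s * cnj (k s) \<partial>M)\<bar> \<le> D * lp_norm M ?q k"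
    by auto
  then show ?thesis by (simp add: W_def D_def r_def)
qed

text \<open>C depends on S and T only, so the bound linear in e forces T bullet S to vanish on C_c;
  density and boundedness extend this to L^p.\<close>

theorem directly_finite_PF:
  assumes ks: "kunze_stein M" and p: "1 < p"
  shows "directly_finite (PF M p)"
  unfolding directly_finite_def
proof (intro ballI impI)
  fix S T
  assume S: "S \<in> carrier (PF M p)" and T: "T \<in> carrier (PF M p)" and ST: "bullet (PF M p) S T = \<zero>\<^bsub>PF M p\<^esub>"
  have p1: "1 \<le> p" and p0: "0 \<le> p" using p by auto
  have Sb: "S \<in> carrier (bounded_ops M p)" and Tb: "T \<in> carrier (bounded_ops M p)"
    using S T by (auto simp: PF_def)
  obtain C where C: "0 \<le> C" "op_fun_bounded M p C S" "op_fun_bounded M p C T"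
    using op_fun_bounded_common[OF Sb Tb p1] by blast
  have zero: "lp_norm M p (bullet_fun p S T h) = 0"
    if "h \<in> lp_fun M p" for h
    using ST that unfolding bullet_PF_eq_zero_iff[OF p S T] by blast
  define W where "W = bullet_fun p T S"
  have W: "W h \<in> lp_fun M p" if h: "h \<in> lp_fun M p" for h
    unfolding W_def by (rule bullet_fun_lp[OF Tb Sb h p0])
  have W_Cc: "lp_norm M p (W h) = 0" if h: "h \<in> Cc" for h
  proof -
    note hlp = Cc_in_lp_fun[OF h p0]
    define Q where "Q = (2 * C + 3) * (1 + 2 * (C + 2)\<^sup>2) * lp_norm M p h"
    have Q: "0 \<le> Q" using C(1) by (simp add: Q_def)
    have bound: "lp_norm M p (W h) \<le> Q * e" if e: "0 < e" "(2 * C + 3) * e \<le> 1 / 2" for e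
    proof (rule lp_norm_le_pairing[OF W[OF hlp] p])
      show "0 \<le> Q * e" using Q e by simp
      fix k :: "'g \<Rightarrow> complex" assume k: "k \<in> Cc"
      obtain a b where ab: "conv_approx p e S a" "conv_approx p e T b"
        using S T e unfolding PF_iff[OF p] by blast
      show "\<bar>Re (\<integral>x. W h x * cnj (k x) \<partial>M)\<bar> \<le> Q * e * lp_norm M (conj_exp p) k"
        using bullet_pairing_bound[OF ks p Sb Tb ab C e zero h k]
        by (simp add: W_def Q_def ac_simps)
    qed
    have lim: "(\<lambda>n. Q * (1 / (2 * (2 * C + 3)) * (1 / real (Suc n)))) \<longlonglongrightarrow> Q * (1 / (2 * (2 * C + 3)) * 0)"
      by (intro tendsto_intros LIMSEQ_Suc[OF lim_1_over_n])
    \<comment> \<open>The choice e = 1 / (2 (2 C + 3) (n + 1)) satisfies the smallness condition for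
      every n and tends to 0.\<close>
    have "lp_norm M p (W h) \<le> Q * (1 / (2 * (2 * C + 3)) * (1 / real (Suc n)))" for n
    proof (rule bound)
      show "0 < 1 / (2 * (2 * C + 3)) * (1 / real (Suc n))" using C(1) by simp
      have "t * (1 / (2 * t) * s) = 1 / 2 * s" if "t \<noteq> 0" for s t :: real
        using that by simp
      from this[of "2 * C + 3" "1 / real (Suc n)"]
      have "(2 * C + 3) * (1 / (2 * (2 * C + 3)) * (1 / real (Suc n))) = 1 / 2 * (1 / real (Suc n))"
        using C(1) by linarith
      also have "\<dots> \<le> 1 / 2 * 1" by (intro mult_left_mono) auto
      finally show "(2 * C + 3) * (1 / (2 * (2 * C + 3)) * (1 / real (Suc n))) \<le> 1 / 2" by simp
    qed
    with LIMSEQ_le_const[OF lim] have "lp_norm M p (W h) \<le> 0" by auto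
    then show ?thesis by (simp add: antisym)
  qed
  \<comment> \<open>The operator T bullet S is Lipschitz in norm with constant 2 C + C^2: C for each
    linear term and C^2 for the composition.\<close>
  have "lp_norm M p (W h) = 0" if h: "h \<in> lp_fun M p" for h
  proof -
    obtain k where k: "\<And>n. k n \<in> Cc" "(\<lambda>n. lp_norm M p (\<lambda>x. h x - k n x)) \<longlonglongrightarrow> 0"
      using Cc_approx_sequence[OF h p1] by metis
    have klp: "k n \<in> lp_fun M p" for n by (intro Cc_in_lp_fun k p0)
    have "lp_norm M p (W h) \<le> (2 * C + C * C) * lp_norm M p (\<lambda>x. h x - k n x)" for n
    proof -
      define N where "N = lp_norm M p (\<lambda>x. h x - k n x)"
      note Sh = op_fun(1)[OF Sb h] and Th = op_fun(1)[OF Tb h]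
      note Sk = op_fun(1)[OF Sb klp[of n]] and Tk = op_fun(1)[OF Tb klp[of n]]
      note TSh = op_fun(1)[OF Tb Sh] and TSk = op_fun(1)[OF Tb Sk]
      note d1 = lp_fun_diff[OF Th Tk p0] and d2 = lp_fun_diff[OF Sh Sk p0] and d3 = lp_fun_diff[OF TSh TSk p0]
      have "lp_norm M p (W h) \<le> lp_norm M p (W (k n)) + lp_norm M p (\<lambda>x. W h x - W (k n) x)"
        using Minkowski_lp_norm[OF W[OF klp[of n]] lp_fun_diff[OF W[OF h] W[OF klp[of n]] p0] p1] by simp
      also have "(\<lambda>x. W h x - W (k n) x)
          = (\<lambda>x. ((op_fun M p T h x - op_fun M p T (k n) x) + (op_fun M p S h x - op_fun M p S (k n) x))
            - (op_fun M p T (op_fun M p S h) x - op_fun M p T (op_fun M p S (k n)) x))"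
        by (simp add: W_def bullet_fun_def algebra_simps)
      also have "lp_norm M p \<dots> \<le> (C * N + C * N) + C * (C * N)"
      proof (rule order_trans[OF lp_norm_triangle_diff[OF lp_fun_add[OF d1 d2 p0] d3 p1]], rule add_mono)
        show "lp_norm M p (\<lambda>x. (op_fun M p T h x - op_fun M p T (k n) x) + (op_fun M p S h x - op_fun M p S (k n) x)) \<le> C * N + C * N"
          unfolding N_def
          by (rule order_trans[OF Minkowski_lp_norm[OF d1 d2 p1]
                add_mono[OF op_fun_boundedD(2)[OF C(3) h klp] op_fun_boundedD(2)[OF C(2) h klp]]])
        show "lp_norm M p (\<lambda>x. op_fun M p T (op_fun M p S h) x - op_fun M p T (op_fun M p S (k n)) x) \<le> C * (C * N)"
          unfolding N_def
          by (rule order_trans[OF op_fun_boundedD(2)[OF C(3) Sh Sk]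
                mult_left_mono[OF op_fun_boundedD(2)[OF C(2) h klp] C(1)]])
      qed
      finally show ?thesis using W_Cc[OF k(1)[of n]] by (simp add: N_def algebra_simps)
    qed
    moreover have "(\<lambda>n. (2 * C + C * C) * lp_norm M p (\<lambda>x. h x - k n x)) \<longlonglongrightarrow> (2 * C + C * C) * 0"
      by (intro tendsto_intros k)
    ultimately have "lp_norm M p (W h) \<le> 0"
      using LIMSEQ_le_const[of _ "(2 * C + C * C) * 0" "lp_norm M p (W h)"] by auto
    then show ?thesis by (simp add: antisym)
  qed
  then show "bullet (PF M p) T S = \<zero>\<^bsub>PF M p\<^esub>"
    unfolding bullet_PF_eq_zero_iff[OF p T S] W_def by blast
qed

end

theorem theorem1p5:
  fixes \<mu> :: "'g::{topological_group_add, t2_space} measure"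
  assumes "locally_compact_space (euclidean :: 'g topology)"
    and "left_haar_measure \<mu>"
    and "unimodular \<mu>"
    and "kunze_stein \<mu>"
  shows "\<forall>p>1. directly_finite (PF \<mu> p)"
proof -
  interpret unimodular_haar \<mu>
    using assms(1-3) by unfold_locales
  show ?thesis using directly_finite_PF assms(4) by blast
qed

end
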